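(* Consider the setting, notation and assumptions of the context. (i) Suppose we are under weak identification and fixed alternatives, and let $\mathcal{N}_1\sim\mathcal{N}(\theta_1,1)$ and $\mathcal{N}_2^*\sim\mathcal{N}(\theta_2,1)$ be independent, where $\theta_1=m_1(\Delta)$ and $\theta_2=m_2(\Delta)$; here $\tilde\rho=\rho(\beta_0)$. Consider the test of $H_0:\theta_1=\theta_2=0$ against $H_1:\theta_1\ne0$ or $\theta_2\ne0$. Let $\mathcal{U},\nu_1(a_1,a_2),\nu_2(a_1,a_2)$ and $(\widetilde{\mathcal{N}}_1,\widetilde{\mathcal{N}}_2)^\top=\mathcal{U}^\top(\mathcal{N}_1,\mathcal{N}_2^* )^\top$ be as in the context, and let $\Phi_\alpha$ denote the class of size-$\alpha$ tests for $H_0$ constructed based on $(\widetilde{\mathcal{N}}_1^2,\widetilde{\mathcal{N}}_2^2)$. Then, for any $(a_1,a_2)\in\mathbb{A}_0$, $\phi_{a_1,a_2,\infty}$ is an admissible test within $\Phi_\alpha$. In addition, let $(\widetilde\theta_1,\widetilde\theta_2)=(\theta_1,\theta_2)\,\mathcal{U}$. If $(\widetilde\theta_1^2,\widetilde\theta_2^2)=b\cdot(\nu_1(a_1,a_2),\nu_2(a_1,a_2))$ for some positive constant $b$, then for any test $\phi\in\Phi_\alpha$ there exists some $\overline b>0$ such that for any $0<b<\overline b$ we have $\mathbb{E}\phi\le\mathbb{E}\phi_{a_1,a_2,\infty}$. (ii) Suppose we are under strong identification and local alternatives and $$\begin{pmatrix}\mathcal{N}_1\\ \mathcal{N}_2\end{pmatrix}\sim\mathcal{N}\left(\begin{pmatrix}0\\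 \theta\end{pmatrix},\begin{pmatrix}1&\rho\\ \rho&1\end{pmatrix}\right),$$ where $\theta=\widetilde\Delta\widetilde{\mathcal{C}}/\Psi^{1/2}$; here $\mathcal{N}_2^*=(1-\rho^2)^{-1/2}(\mathcal{N}_2-\rho\mathcal{N}_1)$ and $\tilde\rho=\rho$. Consider the test of $H_0:\theta=0$ against $H_1:\theta\neq0$. Then $\phi_{a_1,a_2,\infty}$ is uniformly most powerful (UMP) among the class of level-$\alpha$ tests that are constructed based on $(\mathcal{N}_1,\mathcal{N}_2)$ and invariant to the sign change if and only if $a_1=0$ and $a_2\rho=0$. In this case, this test is also UMP among the class of unbiased level-$\alpha$ tests that are constructed based on $(\mathcal{N}_1,\mathcal{N}_2)$. (iii) Suppose Assumption 2 holds, $\big(Q_{e(\beta_0),e(\beta_0)}-\Delta^2\mathcal{C},\,Q_{X,e(\beta_0)}-\Delta\mathcal{C},\,Q_{X,X}-\mathcal{C}\big)^\top=O_p(1)$, and we are under strong identification with fixed alternatives ($\mathcal{C}=\widetilde{\mathcal{C}}/d_n$ for a bounded constant $\widetilde{\mathcal{C}}$ and deterministic $d_n\to0$ with $|\mathcal{C}|\to\infty$, and $\Delta\ne0$ fixed). If $1\ge a_{1,n}\ge\frac{\tilde q\,\Phi_1(\beta_0)}{\mathcal{C}^2\Delta_*^4(\beta_0)}$ for some constant $\tilde q>\mathbb{C}_{\alpha,\max}(\rho(\beta_0))$ and $(a_{1,n},a_{2,n})\in\mathbb{A}_0$, where $\Delta_*(\beta_0)=\Phi_1^{1/2}(\beta_0)\Psi^{-1/2}(\beta_0)\rho^{-1}(\beta_0)$,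 then $$1\{a_{1,n}AR^2(\beta_0)+a_{2,n}LM^2(\beta_0)+(1-a_{1,n}-a_{2,n})LM^{*2}(\beta_0)\ge\mathbb{C}_\alpha(a_{1,n},a_{2,n};\widehat\rho(\beta_0))\}\xrightarrow{p}1 .$$
   Context: **Linear combination test in the limit experiment.** $\alpha\in(0,1)$. For $\rho\in(-1,1)$, $\mathbb{C}_\alpha(a_1,a_2;\rho)$ is the $(1-\alpha)$ quantile of $a_1\mathcal{Z}_1^2+a_2(\rho\mathcal{Z}_1+(1-\rho^2)^{1/2}\mathcal{Z}_2)^2+(1-a_1-a_2)\mathcal{Z}_2^2$ with $\mathcal{Z}_1,\mathcal{Z}_2$ independent standard normals. $\mathbb{A}_0=\{(a_1,a_2)\in[0,1]^2:a_1+a_2\le\overline a\}$ for a fixed $\overline a<1$; $\mathbb{C}_{\alpha,\max}(\rho)=\sup_{(a_1,a_2)\in\mathbb{A}_0}\mathbb{C}_\alpha(a_1,a_2;\rho)$. For combination weights $(a_1,a_2)\in\mathbb{A}_0$ and $\tilde\rho\in(-1,1)$, $$\phi_{a_1,a_2,\infty}=1\{a_1\mathcal{N}_1^2+a_2(\tilde\rho\mathcal{N}_1+(1-\tilde\rho^2)^{1/2}\mathcal{N}_2^* )^2+(1-a_1-a_2)\mathcal{N}_2^{*2}\ge\mathbb{C}_\alpha(a_1,a_2;\tilde\rho)\}.$$ $\mathcal{U}$ (a $2\times2$ unitary matrix) and $\nu_1(a_1,a_2)\ge\nu_2(a_1,a_2)\ge0$ come from the eigenvalue decomposition $$\begin{pmatrix}a_1+a_2\tilde\rho^2&a_2\tilde\rho(1-\tilde\rho^2)^{1/2}\\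 a_2\tilde\rho(1-\tilde\rho^2)^{1/2}&1-a_1-a_2\tilde\rho^2\end{pmatrix}=\mathcal{U}\begin{pmatrix}\nu_1(a_1,a_2)&0\\0&\nu_2(a_1,a_2)\end{pmatrix}\mathcal{U}^\top,$$ so that $\phi_{a_1,a_2,\infty}=1\{\nu_1\widetilde{\mathcal{N}}_1^2+\nu_2\widetilde{\mathcal{N}}_2^2\ge\mathbb{C}_\alpha(a_1,a_2;\tilde\rho)\}$. A test in a class is admissible within that class if no test in the class has power at least as large at every alternative and strictly larger at some alternative. **Model (drifting sequence in $n$; dependence on $n$ suppressed).** $Y_i=X_i\beta+e_i$, $X_i=\Pi_i+V_i$, $i\in[n]=\{1,\dots,n\}$, all scalar, $\Pi_i=\mathbb{E}X_i$, $\mathbb{E}V_i=\mathbb{E}e_i=0$, $(e_i,V_i)$ possibly heteroskedastic. Instruments $Z_i\in\mathbb{R}^K$ are non-random, $K\to\infty$ with $n$; $Z$ has rows $Z_i^\top$, $P=Z(Z^\top Z)^{-1}Z^\top$; $Q_{a,b}=K^{-1/2}\sum_{i\in[n]}\sum_{j\ne i}a_iP_{ij}b_j$; $\mathcal{C}=Q_{\Pi,\Pi}$. $\beta_0$ is the hypothesized value, $\Delta=\beta-\beta_0$, $e_i(\beta_0)=Y_i-X_i\beta_0=e_i+X_i\Delta$. **Variance functions.** For constants $(\Phi_1,\Phi_{12},\Phi_{13},\Psi,\tau,\Upsilon)$ (the asymptotic variances/covariances of $(Q_{e,e},Q_{X,e},Q_{X,X}-\mathcal{C})$, in the arrangement $\begin{pmatrix}\Phi_1&\Phi_{12}&\Phi_{13}\\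 \Phi_{12}&\Psi&\tau\\ \Phi_{13}&\tau&\Upsilon\end{pmatrix}$): $\Phi_1(\beta_0)=\Delta^4\Upsilon+4\Delta^3\tau+\Delta^2(4\Psi+2\Phi_{13})+4\Delta\Phi_{12}+\Phi_1$; $\Phi_{12}(\beta_0)=\Delta^3\Upsilon+3\Delta^2\tau+\Delta(2\Psi+\Phi_{13})+\Phi_{12}$; $\Phi_{13}(\beta_0)=\Delta^2\Upsilon+2\Delta\tau+\Phi_{13}$; $\Psi(\beta_0)=\Delta^2\Upsilon+2\Delta\tau+\Psi$; $\tau(\beta_0)=\Delta\Upsilon+\tau$; $\rho(\beta_0)=\Phi_{12}(\beta_0)/\sqrt{\Phi_1(\beta_0)\Psi(\beta_0)}\in(-1,1)$; $\rho=\Phi_{12}/\sqrt{\Phi_1\Psi}\in(-1,1)$; $\gamma(\beta_0)=(\Phi_1(\beta_0),\Phi_{12}(\beta_0),\Phi_{13}(\beta_0),\Psi(\beta_0),\tau(\beta_0),\Upsilon,\rho(\beta_0))$. Note $1/\Delta_*^4(\beta_0)=\Psi^2(\beta_0)\rho^4(\beta_0)/\Phi_1^2(\beta_0)$. **Regimes.** Weak identification and fixed alternatives: $\mathcal{C}\to\widetilde{\mathcal{C}}\in\mathbb{R}$ and $\Delta$ fixed; then $m_1(\Delta)=\Phi_1^{-1/2}(\beta_0)\Delta^2\widetilde{\mathcal{C}}$, $m_2(\Delta)=(1-\rho^2(\beta_0))^{-1/2}(\Psi^{-1/2}(\beta_0)\Delta-\rho(\beta_0)\Phi_1^{-1/2}(\beta_0)\Delta^2)\widetilde{\mathcal{C}}$.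 Strong identification and local alternatives: $\mathcal{C}=\widetilde{\mathcal{C}}/d_n$, $\Delta=\widetilde\Delta d_n$, with $\widetilde{\mathcal{C}},\widetilde\Delta$ bounded constants independent of $n$ and $d_n\to0$ deterministic. **Assumption 2.** $\mathcal{B}\subset\mathbb{R}$ is a compact parameter space, $\inf_{\beta_0\in\mathcal{B}}\Phi_1(\beta_0)>0$, $\inf_{\beta_0\in\mathcal{B}}\Psi(\beta_0)>0$, $\Upsilon>0$, and there is an estimator $\widehat\gamma(\beta_0)=(\widehat\Phi_1(\beta_0),\widehat\Phi_{12}(\beta_0),\widehat\Phi_{13}(\beta_0),\widehat\Psi(\beta_0),\widehat\tau(\beta_0),\widehat\Upsilon,\widehat\rho(\beta_0))$ with $\|\widehat\gamma(\beta_0)-\gamma(\beta_0)\|_2=o_p(1)$ for $\beta_0\in\mathcal{B}$. **Statistics.** $AR(\beta_0)=Q_{e(\beta_0),e(\beta_0)}/\widehat\Phi_1^{1/2}(\beta_0)$, $LM(\beta_0)=Q_{X,e(\beta_0)}/\widehat\Psi^{1/2}(\beta_0)$, $LM^*(\beta_0)=(1-\widehat\rho(\beta_0)^2)^{-1/2}(LM(\beta_0)-\widehat\rho(\beta_0)AR(\beta_0))$. *)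

theory Defs
  imports "HOL-Probability.Probability" "Jordan_Normal_Form.Gauss_Jordan_Elimination"
begin

text \<open>
  Matrices of fixed size 2 are of type \<^typ>\<open>real^2^2\<close>; the instrument matrix, whose size varies
  with the sample size, is a \<^typ>\<open>real Matrix.mat\<close>. The symbol \<open>$\<close> is reserved for the former.
\<close>

no_notation Matrix.vec_index (infixl "$" 100)


section \<open>Stochastic orders for triangular arrays\<close>

text \<open>
  The probability space may change with \<open>n\<close>. Measurability is part of the definitions, since
  \<^const>\<open>measure\<close> is 0 on non-measurable sets.
\<close>

definition little_op :: "(nat \<Rightarrow> 'w measure) \<Rightarrow> (nat \<Rightarrow> 'w \<Rightarrow> 'b::real_normed_vector) \<Rightarrow> bool" where
  "little_op M X \<longleftrightarrow> (\<forall>n. X n \<in> borel_measurable (M n)) \<and>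
     (\<forall>\<epsilon>>0. (\<lambda>n. measure (M n) {\<omega> \<in> space (M n). norm (X n \<omega>) > \<epsilon>}) \<longlonglongrightarrow> 0)"

definition big_Op :: "(nat \<Rightarrow> 'w measure) \<Rightarrow> (nat \<Rightarrow> 'w \<Rightarrow> 'b::real_normed_vector) \<Rightarrow> bool" where
  "big_Op M X \<longleftrightarrow> (\<forall>n. X n \<in> borel_measurable (M n)) \<and>
     (\<forall>\<epsilon>>0. \<exists>B. \<forall>\<^sub>F n in sequentially.
        measure (M n) {\<omega> \<in> space (M n). norm (X n \<omega>) > B} \<le> \<epsilon>)"

definition conv_in_prob :: "(nat \<Rightarrow> 'w measure) \<Rightarrow> (nat \<Rightarrow> 'w \<Rightarrow> 'b::real_normed_vector) \<Rightarrow> 'b \<Rightarrow> bool" where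
  "conv_in_prob M X c \<longleftrightarrow> little_op M (\<lambda>n \<omega>. X n \<omega> - c)"


section \<open>Tests\<close>

text \<open>
  A statistical experiment is a family \<^term>\<open>P :: 'p \<Rightarrow> 'x measure\<close>; \<open>H0\<close> and \<open>H1\<close> are sets of
  parameters. Tests may be randomized.
\<close>

definition is_test :: "('x::topological_space \<Rightarrow> real) \<Rightarrow> bool" where
  "is_test \<phi> \<longleftrightarrow> \<phi> \<in> borel_measurable borel \<and> (\<forall>x. 0 \<le> \<phi> x \<and> \<phi> x \<le> 1)"

definition test_power :: "('p \<Rightarrow> 'x measure) \<Rightarrow> 'p \<Rightarrow> ('x \<Rightarrow> real) \<Rightarrow> real" where
  "test_power P \<theta> \<phi> = (\<integral>x. \<phi> x \<partial>P \<theta>)"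

definition has_size :: "('p \<Rightarrow> 'x measure) \<Rightarrow> 'p set \<Rightarrow> real \<Rightarrow> ('x \<Rightarrow> real) \<Rightarrow> bool" where
  "has_size P H0 \<alpha> \<phi> \<longleftrightarrow> (SUP \<theta>\<in>H0. test_power P \<theta> \<phi>) = \<alpha>"

definition has_level :: "('p \<Rightarrow> 'x measure) \<Rightarrow> 'p set \<Rightarrow> real \<Rightarrow> ('x \<Rightarrow> real) \<Rightarrow> bool" where
  "has_level P H0 \<alpha> \<phi> \<longleftrightarrow> (\<forall>\<theta>\<in>H0. test_power P \<theta> \<phi> \<le> \<alpha>)"

definition unbiased_test :: "('p \<Rightarrow> 'x measure) \<Rightarrow> 'p set \<Rightarrow> 'p set \<Rightarrow> real \<Rightarrow> ('x \<Rightarrow> real) \<Rightarrow> bool" where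
  "unbiased_test P H0 H1 \<alpha> \<phi> \<longleftrightarrow> has_level P H0 \<alpha> \<phi> \<and> (\<forall>\<theta>\<in>H1. \<alpha> \<le> test_power P \<theta> \<phi>)"

definition admissible_within ::
    "('p \<Rightarrow> 'x measure) \<Rightarrow> 'p set \<Rightarrow> ('x \<Rightarrow> real) set \<Rightarrow> ('x \<Rightarrow> real) \<Rightarrow> bool" where
  "admissible_within P H1 \<T> \<phi> \<longleftrightarrow> \<phi> \<in> \<T> \<and>
     \<not> (\<exists>\<psi>\<in>\<T>. (\<forall>\<theta>\<in>H1. test_power P \<theta> \<phi> \<le> test_power P \<theta> \<psi>) \<and> (\<exists>\<theta>\<in>H1. test_power P \<theta> \<phi> < test_power P \<theta> \<psi>))"

definition UMP_within ::
    "('p \<Rightarrow> 'x measure) \<Rightarrow> 'p set \<Rightarrow> ('x \<Rightarrow> real) set \<Rightarrow> ('x \<Rightarrow> real) \<Rightarrow> bool" where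
  "UMP_within P H1 \<T> \<phi> \<longleftrightarrow> \<phi> \<in> \<T> \<and> (\<forall>\<psi>\<in>\<T>. \<forall>\<theta>\<in>H1. test_power P \<theta> \<psi> \<le> test_power P \<theta> \<phi>)"


section \<open>Normal laws\<close>

definition normal_law :: "real \<Rightarrow> real measure" where
  "normal_law m = density lborel (\<lambda>x. ennreal (normal_density m 1 x))"

text \<open>Law of two independent unit-variance normals; the parameter is the pair of means.\<close>

definition indep_normal_law :: "real \<times> real \<Rightarrow> (real \<times> real) measure" where
  "indep_normal_law \<theta> = normal_law (fst \<theta>) \<Otimes>\<^sub>M normal_law (snd \<theta>)"

text \<open>Bivariate normal law with means \<open>m1\<close>, \<open>m2\<close>, unit variances and correlation \<open>r \<in> (-1,1)\<close>.\<close>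

definition bivariate_normal_law :: "real \<Rightarrow> real \<Rightarrow> real \<Rightarrow> (real \<times> real) measure" where
  "bivariate_normal_law m1 m2 r = density lborel (\<lambda>(x, y). ennreal
     (exp (- ((x - m1)\<^sup>2 - 2 * r * (x - m1) * (y - m2) + (y - m2)\<^sup>2) / (2 * (1 - r\<^sup>2)))
        / (2 * pi * sqrt (1 - r\<^sup>2))))"

definition quantile :: "real measure \<Rightarrow> real \<Rightarrow> real" where
  "quantile D p = Inf {x. p \<le> cdf D x}"


section \<open>The linear combination test in the limit experiment\<close>

definition lc_stat :: "real \<Rightarrow> real \<Rightarrow> real \<Rightarrow> real \<times> real \<Rightarrow> real" where
  "lc_stat a1 a2 r z = a1 * (fst z)\<^sup>2 + a2 * (r * fst z + sqrt (1 - r\<^sup>2) * snd z)\<^sup>2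
     + (1 - a1 - a2) * (snd z)\<^sup>2"

definition lc_crit :: "real \<Rightarrow> real \<Rightarrow> real \<Rightarrow> real \<Rightarrow> real" where
  "lc_crit \<alpha> a1 a2 r =
     quantile (distr (indep_normal_law (0, 0)) borel (lc_stat a1 a2 r)) (1 - \<alpha>)"

definition weight_set :: "real \<Rightarrow> (real \<times> real) set" where
  "weight_set abar = {(a1, a2). a1 \<in> {0..1} \<and> a2 \<in> {0..1} \<and> a1 + a2 \<le> abar}"

definition lc_crit_max :: "real \<Rightarrow> real \<Rightarrow> real \<Rightarrow> real" where
  "lc_crit_max abar \<alpha> r = (SUP (a1, a2)\<in>weight_set abar. lc_crit \<alpha> a1 a2 r)"

text \<open>The test \<open>\<phi>\<^bsub>a1,a2,\<infinity>\<^esub>\<close> as a function of \<open>(N1, N2*)\<close>.\<close>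

definition lc_test :: "real \<Rightarrow> real \<Rightarrow> real \<Rightarrow> real \<Rightarrow> real \<times> real \<Rightarrow> real" where
  "lc_test \<alpha> a1 a2 r z = of_bool (lc_stat a1 a2 r z \<ge> lc_crit \<alpha> a1 a2 r)"

definition lc_matrix :: "real \<Rightarrow> real \<Rightarrow> real \<Rightarrow> real^2^2" where
  "lc_matrix a1 a2 r = vector
     [vector [a1 + a2 * r\<^sup>2, a2 * r * sqrt (1 - r\<^sup>2)],
      vector [a2 * r * sqrt (1 - r\<^sup>2), 1 - a1 - a2 * r\<^sup>2]]"

definition lc_eigen_decomp :: "real \<Rightarrow> real \<Rightarrow> real \<Rightarrow> real^2^2 \<Rightarrow> real \<Rightarrow> real \<Rightarrow> bool" where
  "lc_eigen_decomp a1 a2 r U \<nu>1 \<nu>2 \<longleftrightarrow> orthogonal_matrix U \<and> \<nu>1 \<ge> \<nu>2 \<and> \<nu>2 \<ge> 0 \<and>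
     lc_matrix a1 a2 r = U ** vector [vector [\<nu>1, 0], vector [0, \<nu>2]] ** Finite_Cartesian_Product.transpose U"

definition rotate_obs :: "real^2^2 \<Rightarrow> real \<times> real \<Rightarrow> real^2" where
  "rotate_obs U z = Finite_Cartesian_Product.transpose U *v vector [fst z, snd z]"

text \<open>
  Size-\<open>\<alpha>\<close> tests of \<open>\<theta>1 = \<theta>2 = 0\<close> that depend on \<open>(N1, N2*)\<close> only through the squares of the
  rotated coordinates.
\<close>

definition squared_rotated_tests :: "real \<Rightarrow> real^2^2 \<Rightarrow> (real \<times> real \<Rightarrow> real) set" where
  "squared_rotated_tests \<alpha> U = {\<phi>. has_size indep_normal_law {(0, 0)} \<alpha> \<phi> \<and>
     (\<exists>g :: real \<times> real \<Rightarrow> real. is_test g \<and>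
        \<phi> = (\<lambda>z. g ((rotate_obs U z $ 1)\<^sup>2, (rotate_obs U z $ 2)\<^sup>2)))}"

text \<open>Data \<open>(N1, N2)\<close> of the strongly identified limit experiment, and the test as a function of it.\<close>

definition local_law :: "real \<Rightarrow> real \<Rightarrow> (real \<times> real) measure" where
  "local_law r \<theta> = bivariate_normal_law 0 \<theta> r"

definition local_lc_test :: "real \<Rightarrow> real \<Rightarrow> real \<Rightarrow> real \<Rightarrow> real \<times> real \<Rightarrow> real" where
  "local_lc_test \<alpha> a1 a2 r z = lc_test \<alpha> a1 a2 r (fst z, (snd z - r * fst z) / sqrt (1 - r\<^sup>2))"

definition sign_invariant :: "(real \<times> real \<Rightarrow> real) \<Rightarrow> bool" where
  "sign_invariant \<phi> \<longleftrightarrow> (\<forall>x y. \<phi> (- x, - y) = \<phi> (x, y))"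


section \<open>Variance functions\<close>

text \<open>Asymptotic (co)variances of \<open>(Q(e,e), Q(X,e), Q(X,X) - C)\<close>.\<close>

record avar =
  Phi1 :: real
  Phi12 :: real
  Phi13 :: real
  Psi :: real
  tau :: real
  Upsilon :: real

text \<open>The corresponding functions of \<open>\<beta>\<^sub>0\<close>, which enter only through \<open>D = \<beta> - \<beta>\<^sub>0\<close>.\<close>

definition Phi1_at :: "avar \<Rightarrow> real \<Rightarrow> real" where
  "Phi1_at v D = D^4 * Upsilon v + 4 * D^3 * tau v + D\<^sup>2 * (4 * Psi v + 2 * Phi13 v)
     + 4 * D * Phi12 v + Phi1 v"

definition Phi12_at :: "avar \<Rightarrow> real \<Rightarrow> real" where
  "Phi12_at v D = D^3 * Upsilon v + 3 * D\<^sup>2 * tau v + D * (2 * Psi v + Phi13 v) + Phi12 v"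

definition Phi13_at :: "avar \<Rightarrow> real \<Rightarrow> real" where
  "Phi13_at v D = D\<^sup>2 * Upsilon v + 2 * D * tau v + Phi13 v"

definition Psi_at :: "avar \<Rightarrow> real \<Rightarrow> real" where
  "Psi_at v D = D\<^sup>2 * Upsilon v + 2 * D * tau v + Psi v"

definition tau_at :: "avar \<Rightarrow> real \<Rightarrow> real" where
  "tau_at v D = D * Upsilon v + tau v"

definition rho_at :: "avar \<Rightarrow> real \<Rightarrow> real" where
  "rho_at v D = Phi12_at v D / sqrt (Phi1_at v D * Psi_at v D)"

definition rho :: "avar \<Rightarrow> real" where
  "rho v = Phi12 v / sqrt (Phi1 v * Psi v)"

definition gamma_at :: "avar \<Rightarrow> real \<Rightarrow> real^7" where
  "gamma_at v D = vector
     [Phi1_at v D, Phi12_at v D, Phi13_at v D, Psi_at v D, tau_at v D, Upsilon v, rho_at v D]"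

text \<open>
  If \<open>rho_at v D = 0\<close>, then \<open>\<Delta>\<^sub>*\<close> is infinite in the mathematical convention and 0 here; either way
  \<open>1 / \<Delta>\<^sub>*^4\<close> is 0, which agrees with \<open>1 / \<Delta>\<^sub>*^4 = \<Psi>\<^sup>2 \<rho>^4 / \<Phi>\<^sub>1\<^sup>2\<close>. Only this reciprocal is used.
\<close>

definition Delta_star :: "avar \<Rightarrow> real \<Rightarrow> real" where
  "Delta_star v D = sqrt (Phi1_at v D) / sqrt (Psi_at v D) * inverse (rho_at v D)"

text \<open>
  Means of \<open>(N1, N2*)\<close> under weak identification at deviation \<open>D\<close> and concentration \<open>C\<close>. The
  arguments \<open>p1 = \<Phi>\<^sub>1(\<beta>\<^sub>0)\<close>, \<open>ps = \<Psi>(\<beta>\<^sub>0)\<close>, \<open>r = \<rho>(\<beta>\<^sub>0)\<close> are kept separate from \<open>D\<close>, because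
  these are known in the limit experiment, whereas \<open>D\<close> and \<open>C\<close> are not.
\<close>

definition weak_mean :: "real \<Rightarrow> real \<Rightarrow> real \<Rightarrow> real \<Rightarrow> real \<Rightarrow> real \<times> real" where
  "weak_mean p1 ps r D C =
     (D\<^sup>2 * C / sqrt p1,
      (D / sqrt ps - r * D\<^sup>2 / sqrt p1) * C / sqrt (1 - r\<^sup>2))"


section \<open>The model with many instruments\<close>

text \<open>
  Observations are indexed by \<open>{..<n}\<close>, matching the indices of the \<open>n \<times> K\<close> matrix \<open>Z\<close>;
  \<open>\<mu> n i\<close> is the mean of \<open>X n i\<close>.
\<close>

definition proj_mat :: "real Matrix.mat \<Rightarrow> real Matrix.mat" where
  "proj_mat Z = Z * the (mat_inverse (Z\<^sup>T * Z)) * Z\<^sup>T"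

definition Q_form :: "real Matrix.mat \<Rightarrow> (nat \<Rightarrow> real) \<Rightarrow> (nat \<Rightarrow> real) \<Rightarrow> real" where
  "Q_form Z a b = (\<Sum>i<dim_row Z. \<Sum>j\<in>{..<dim_row Z} - {i}. a i * proj_mat Z $$ (i, j) * b j)
     / sqrt (real (dim_col Z))"

definition many_iv_model ::
    "(nat \<Rightarrow> 'w measure) \<Rightarrow> (nat \<Rightarrow> nat) \<Rightarrow> (nat \<Rightarrow> real Matrix.mat) \<Rightarrow> real \<Rightarrow>
     (nat \<Rightarrow> nat \<Rightarrow> real) \<Rightarrow> (nat \<Rightarrow> nat \<Rightarrow> 'w \<Rightarrow> real) \<Rightarrow> (nat \<Rightarrow> nat \<Rightarrow> 'w \<Rightarrow> real) \<Rightarrow>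
     (nat \<Rightarrow> nat \<Rightarrow> 'w \<Rightarrow> real) \<Rightarrow> (nat \<Rightarrow> nat \<Rightarrow> 'w \<Rightarrow> real) \<Rightarrow> bool" where
  "many_iv_model M K Z \<beta> \<mu> Y X e V \<longleftrightarrow>
     filterlim K at_top sequentially \<and>
     (\<forall>n. prob_space (M n) \<and> Z n \<in> carrier_mat n (K n) \<and> invertible_mat ((Z n)\<^sup>T * Z n)) \<and>
     (\<forall>n. \<forall>i<n. integrable (M n) (e n i) \<and> integrable (M n) (V n i) \<and>
        (\<integral>\<omega>. e n i \<omega> \<partial>M n) = 0 \<and> (\<integral>\<omega>. V n i \<omega> \<partial>M n) = 0 \<and>
        (\<forall>\<omega>\<in>space (M n). X n i \<omega> = \<mu> n i + V n i \<omega> \<and> Y n i \<omega> = X n i \<omega> * \<beta> + e n i \<omega>))"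

definition null_resid :: "(nat \<Rightarrow> 'w \<Rightarrow> real) \<Rightarrow> (nat \<Rightarrow> 'w \<Rightarrow> real) \<Rightarrow> real \<Rightarrow> 'w \<Rightarrow> nat \<Rightarrow> real" where
  "null_resid Y X \<beta>0 \<omega> i = Y i \<omega> - X i \<omega> * \<beta>0"

text \<open>
  In the statistics, \<open>g\<close> is the value of the estimator of \<open>\<gamma>(\<beta>\<^sub>0)\<close>; by the order of the components in
  \<^const>\<open>gamma_at\<close>, its entries 1, 4, 7 estimate \<open>\<Phi>\<^sub>1(\<beta>\<^sub>0)\<close>, \<open>\<Psi>(\<beta>\<^sub>0)\<close>, \<open>\<rho>(\<beta>\<^sub>0)\<close>.
\<close>

definition AR :: "real Matrix.mat \<Rightarrow> (nat \<Rightarrow> real) \<Rightarrow> real^7 \<Rightarrow> real" where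
  "AR Z e0 g = Q_form Z e0 e0 / sqrt (g $ 1)"

definition LM :: "real Matrix.mat \<Rightarrow> (nat \<Rightarrow> real) \<Rightarrow> (nat \<Rightarrow> real) \<Rightarrow> real^7 \<Rightarrow> real" where
  "LM Z x e0 g = Q_form Z x e0 / sqrt (g $ 4)"

definition LM_star :: "real Matrix.mat \<Rightarrow> (nat \<Rightarrow> real) \<Rightarrow> (nat \<Rightarrow> real) \<Rightarrow> real^7 \<Rightarrow> real" where
  "LM_star Z x e0 g = (LM Z x e0 g - g $ 7 * AR Z e0 g) / sqrt (1 - (g $ 7)\<^sup>2)"

definition feasible_lc_test ::
    "real \<Rightarrow> real \<Rightarrow> real \<Rightarrow> real Matrix.mat \<Rightarrow> (nat \<Rightarrow> real) \<Rightarrow> (nat \<Rightarrow> real) \<Rightarrow> real^7 \<Rightarrow> real" where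
  "feasible_lc_test \<alpha> a1 a2 Z x e0 g = of_bool
     (a1 * (AR Z e0 g)\<^sup>2 + a2 * (LM Z x e0 g)\<^sup>2 + (1 - a1 - a2) * (LM_star Z x e0 g)\<^sup>2
        \<ge> lc_crit \<alpha> a1 a2 (g $ 7))"

definition assumption2 ::
    "(nat \<Rightarrow> 'w measure) \<Rightarrow> avar \<Rightarrow> real \<Rightarrow> real set \<Rightarrow> (nat \<Rightarrow> real \<Rightarrow> 'w \<Rightarrow> real^7) \<Rightarrow> bool" where
  "assumption2 M v \<beta> B \<gamma>h \<longleftrightarrow> compact B \<and>
     (INF b0\<in>B. Phi1_at v (\<beta> - b0)) > 0 \<and> (INF b0\<in>B. Psi_at v (\<beta> - b0)) > 0 \<and> Upsilon v > 0 \<and>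
     (\<forall>b0\<in>B. little_op M (\<lambda>n \<omega>. \<gamma>h n b0 \<omega> - gamma_at v (\<beta> - b0)))"

end

theory Submission
  imports Defs "HOL-Real_Asymp.Real_Asymp"
begin

text \<open>
  Exponential tilting writes every power function as an integral over the standard bivariate normal
  law, which is invariant under orthogonal maps.

  (i) In the rotated coordinates the tests are even in each variable, so for squared means
  \<open>b \<nu>\<^sub>1\<close>, \<open>b \<nu>\<^sub>2\<close> the likelihood ratio may be replaced by its average over sign changes. Its
  derivative at \<open>b = 0\<close> is \<open>(\<nu>\<^sub>1 w\<^sub>1\<^sup>2 + \<nu>\<^sub>2 w\<^sub>2\<^sup>2 - 1) / 2\<close>, an increasing function of the test
  statistic. By the Neyman-Pearson argument, the linear combination test therefore has strictly
  larger power than any essentially different test of the same size for all small \<open>b\<close>. This is the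
  local optimality; it also yields admissibility, because a dominating test has to agree almost
  everywhere. The means that are attainable for fixed nuisance parameters may miss the direction
  \<open>(\<nu>\<^sub>1, \<nu>\<^sub>2)\<close>, but they are dense, and power is continuous.

  (ii) For invariant tests the likelihood ratio becomes \<open>cosh (m N\<^sub>2\<^sup>*)\<close> up to a factor, so the test
  rejecting for large \<open>\<bar>N\<^sub>2\<^sup>*\<bar>\<close> is most powerful and essentially unique; if \<open>a\<^sub>1 + a\<^sub>2 \<rho>\<^sup>2 > 0\<close>, the
  linear combination test also rejects for large \<open>\<bar>N\<^sub>1\<bar>\<close> and small \<open>\<bar>N\<^sub>2\<^sup>*\<bar>\<close>. For an unbiased test the
  power is minimal at the null, which makes its first moment in \<open>N\<^sub>2\<^sup>*\<close> vanish; then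
  \<open>exp (m N\<^sub>2\<^sup>*)\<close> may be compared with its chord over the acceptance interval.

  (iii) If \<open>\<Delta> \<noteq> \<Delta>\<^sub>*\<close>, the modified score statistic diverges, and its weight is at least
  \<open>1 - abar\<close>. If \<open>\<Delta> = \<Delta>\<^sub>*\<close>, the bound on \<open>a\<^sub>1\<close> makes the first summand asymptotically at least
  \<open>qt\<close>, which exceeds the critical value by upper semicontinuity of the latter in the
  correlation, uniformly over the weights.
\<close>


section \<open>Pairs of normal variables\<close>

lemma measurable_fst_borel [measurable]: "fst \<in> borel \<rightarrow>\<^sub>M (borel :: real measure)"
  by (intro borel_measurable_continuous_onI continuous_intros)

lemma measurable_snd_borel [measurable]: "snd \<in> borel \<rightarrow>\<^sub>M (borel :: real measure)"
  by (intro borel_measurable_continuous_onI continuous_intros)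

lemma sets_indep_normal_law [measurable_cong, simp]: "sets (indep_normal_law \<theta>) = sets borel"
proof -
  have "sets (indep_normal_law \<theta>) = sets (borel \<Otimes>\<^sub>M borel :: (real \<times> real) measure)"
    unfolding indep_normal_law_def normal_law_def by (rule sets_pair_measure_cong) simp_all
  then show ?thesis by (simp only: borel_prod)
qed

lemma space_indep_normal_law [simp]: "space (indep_normal_law \<theta>) = UNIV"
  using sets_eq_imp_space_eq[OF sets_indep_normal_law] by simp

lemma measurable_indep_normal_law [simp]:
  "measurable (indep_normal_law \<theta>) N = measurable borel N"
  by (rule measurable_cong_sets) simp_all

lemma prob_space_indep_normal_law: "prob_space (indep_normal_law \<theta>)"
  unfolding indep_normal_law_def normal_law_def
  by (intro prob_space_pair prob_space_normal_density) simp_all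

lemma indep_normal_law_density:
  "indep_normal_law \<theta> = density lborel
     (\<lambda>z. ennreal (normal_density (fst \<theta>) 1 (fst z) * normal_density (snd \<theta>) 1 (snd z)))"
proof -
  have "sigma_finite_measure (density lborel (\<lambda>x. ennreal (normal_density (snd \<theta>) 1 x)))"
    using prob_space_normal_density[of 1 "snd \<theta>"] prob_space_imp_sigma_finite by simp
  then have "indep_normal_law \<theta> = density (lborel \<Otimes>\<^sub>M lborel)
     (\<lambda>(x, y). ennreal (normal_density (fst \<theta>) 1 x) * ennreal (normal_density (snd \<theta>) 1 y))"
    unfolding indep_normal_law_def normal_law_def
    by (intro pair_measure_density) (simp_all add: lborel.sigma_finite_measure_axioms)
  then show ?thesis by (simp add: lborel_prod ennreal_mult case_prod_unfold)
qed

text \<open>The ratio of the densities of N(m, 1) and N(0, 1) is exp (m x - m^2 / 2). This tilt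
  moves all dependence on the means into the integrand, so that power functions become integrals
  over one fixed law.\<close>

lemma indep_normal_law_shift:
  "indep_normal_law \<theta> = density (indep_normal_law (0, 0))
     (\<lambda>z. ennreal (exp (fst \<theta> * fst z + snd \<theta> * snd z - ((fst \<theta>)\<^sup>2 + (snd \<theta>)\<^sup>2) / 2)))"
proof -
  have shift: "normal_density m 1 x = normal_density 0 1 x * exp (m * x - m\<^sup>2 / 2)" for m x :: real
    by (simp add: normal_density_def exp_add[symmetric] power2_eq_square field_simps)
  have "normal_density 0 1 (fst z) * normal_density 0 1 (snd z) *
      exp (fst \<theta> * fst z + snd \<theta> * snd z - ((fst \<theta>)\<^sup>2 + (snd \<theta>)\<^sup>2) / 2)
     = normal_density (fst \<theta>) 1 (fst z) * normal_density (snd \<theta>) 1 (snd z)" for z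
  proof -
    have "fst \<theta> * fst z + snd \<theta> * snd z - ((fst \<theta>)\<^sup>2 + (snd \<theta>)\<^sup>2) / 2
      = (fst \<theta> * fst z - (fst \<theta>)\<^sup>2 / 2) + (snd \<theta> * snd z - (snd \<theta>)\<^sup>2 / 2)" by (simp add: add_divide_distrib)
    then show ?thesis
      unfolding shift[of "fst \<theta>"] shift[of "snd \<theta>"] by (simp only: exp_add mult.assoc mult.left_commute)
  qed
  then show ?thesis
    by (simp add: indep_normal_law_density density_density_eq ennreal_mult[symmetric])
qed

text \<open>Read off from the tilt: constants are integrable under the law with means
  \<open>(a, b)\<close>, whose density is a constant multiple of this exponential.\<close>

lemma integrable_exp_linear:
  "integrable (indep_normal_law (0, 0)) (\<lambda>z. exp (a * fst z + b * snd z))"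
proof -
  interpret prob_space "indep_normal_law (a, b)" by (rule prob_space_indep_normal_law)
  have "integrable (indep_normal_law (a, b)) (\<lambda>_. exp ((a\<^sup>2 + b\<^sup>2) / 2))" by simp
  then have "integrable (indep_normal_law (0, 0))
      (\<lambda>z. exp (a * fst z + b * snd z - (a\<^sup>2 + b\<^sup>2) / 2) *\<^sub>R exp ((a\<^sup>2 + b\<^sup>2) / 2))"
    by (subst (asm) indep_normal_law_shift, subst (asm) integrable_density) simp_all
  then show ?thesis by (simp add: exp_add[symmetric])
qed

lemma integrable_exp_abs:
  "integrable (indep_normal_law (0, 0)) (\<lambda>z. exp (k * (\<bar>fst z\<bar> + \<bar>snd z\<bar>)))"
proof (rule Bochner_Integration.integrable_bound)
  show "integrable (indep_normal_law (0, 0)) (\<lambda>z. exp (k * fst z + k * snd z) +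
     exp (k * fst z + (-k) * snd z) + exp ((-k) * fst z + k * snd z) + exp ((-k) * fst z + (-k) * snd z))"
    by (intro Bochner_Integration.integrable_add integrable_exp_linear)
  \<comment> \<open>Whatever the signs of \<open>x\<close> and \<open>y\<close>, one of the four
    summands equals the left-hand side.\<close>
  have "exp (k * (\<bar>x\<bar> + \<bar>y\<bar>)) \<le> exp (k * x + k * y) +
     exp (k * x + (-k) * y) + exp ((-k) * x + k * y) + exp ((-k) * x + (-k) * y)" for x y
    by (cases "x \<ge> 0"; cases "y \<ge> 0") (simp_all add: abs_if algebra_simps add_nonneg_nonneg)
  then show "AE z in indep_normal_law (0, 0). norm (exp (k * (\<bar>fst z\<bar> + \<bar>snd z\<bar>)))
     \<le> norm (exp (k * fst z + k * snd z) +
     exp (k * fst z + (-k) * snd z) + exp ((-k) * fst z + k * snd z) + exp ((-k) * fst z + (-k) * snd z))"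
    by (intro AE_I2) (simp add: order_trans[OF _ abs_ge_self])
qed simp

text \<open>The usual envelope for the integrands below, which grow at most exponentially.\<close>

lemma integrable_exp_bound:
  fixes f :: "real \<times> real \<Rightarrow> real"
  assumes "f \<in> borel_measurable borel" "\<And>z. \<bar>f z\<bar> \<le> c * exp (k * (\<bar>fst z\<bar> + \<bar>snd z\<bar>))"
  shows "integrable (indep_normal_law (0, 0)) f"
proof (rule Bochner_Integration.integrable_bound)
  show "integrable (indep_normal_law (0, 0)) (\<lambda>z. c * exp (k * (\<bar>fst z\<bar> + \<bar>snd z\<bar>)))"
    by (intro integrable_mult_right integrable_exp_abs)
  show "AE z in indep_normal_law (0, 0). norm (f z) \<le> norm (c * exp (k * (\<bar>fst z\<bar> + \<bar>snd z\<bar>)))"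
    using assms(2) by (intro AE_I2) (simp add: order_trans[OF _ abs_ge_self])
qed (use assms(1) in simp)

lemma test_power_indep_normal:
  assumes "\<phi> \<in> borel_measurable borel"
  shows "test_power indep_normal_law \<theta> \<phi> = (\<integral>z. \<phi> z *
     exp (fst \<theta> * fst z + snd \<theta> * snd z - ((fst \<theta>)\<^sup>2 + (snd \<theta>)\<^sup>2) / 2) \<partial>indep_normal_law (0, 0))"
  unfolding test_power_def
  by (subst indep_normal_law_shift, subst integral_density) (use assms in \<open>simp_all add: mult.commute\<close>)

section \<open>Linear changes of variables and invariance under orthogonal maps\<close>

lemma nn_integral_lborel_linear_aux:
  fixes f :: "real \<times> real \<Rightarrow> ennreal" and a b c d :: real
  assumes [measurable]: "f \<in> borel_measurable borel" and "a \<noteq> 0" "a * d - b * c \<noteq> 0"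
  shows "\<bar>a * d - b * c\<bar> * (\<integral>\<^sup>+y. \<integral>\<^sup>+x. f (a * x + b * y, c * x + d * y) \<partial>lborel \<partial>lborel)
    = (\<integral>\<^sup>+z. f z \<partial>lborel)"
proof -
  \<comment> \<open>Two one-dimensional affine substitutions: first \<open>u = a x + b y\<close> at
    fixed \<open>y\<close>, then the second coordinate at fixed \<open>u\<close>. Once
    \<open>x\<close> is eliminated, \<open>y\<close> has the coefficient
    \<open>k = d - b c / a\<close> there, and the Jacobians \<open>a\<close> and \<open>k\<close>
    multiply to the determinant.\<close>
  define k where "k = (a * d - b * c) / a"
  have k: "k \<noteq> 0" using assms unfolding k_def by simp
  have 1: "\<bar>a\<bar> * (\<integral>\<^sup>+x. f (a * x + b * y, c * x + d * y) \<partial>lborel)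
      = (\<integral>\<^sup>+u. f (u, c / a * u + k * y) \<partial>lborel)" for y
  proof -
    have "c / a * (b * y + a * x) + k * y = c * x + d * y" for x
      using assms(2) unfolding k_def by (simp add: field_simps)
    then show ?thesis
      by (subst (2) nn_integral_real_affine[of _ a "b * y"]) (simp_all add: assms(2) add.commute)
  qed
  have 2: "\<bar>k\<bar> * (\<integral>\<^sup>+y. f (u, c / a * u + k * y) \<partial>lborel) = (\<integral>\<^sup>+v. f (u, v) \<partial>lborel)" for u
    by (subst (2) nn_integral_real_affine[of _ k "c / a * u"]) (simp_all add: k)
  have "\<bar>a\<bar> * (\<integral>\<^sup>+y. \<integral>\<^sup>+x. f (a * x + b * y, c * x + d * y) \<partial>lborel \<partial>lborel)
     = (\<integral>\<^sup>+y. \<integral>\<^sup>+u. f (u, c / a * u + k * y) \<partial>lborel \<partial>lborel)"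
    by (subst nn_integral_cmult[symmetric]) (simp_all add: 1)
  also have "\<dots> = (\<integral>\<^sup>+u. \<integral>\<^sup>+y. f (u, c / a * u + k * y) \<partial>lborel \<partial>lborel)"
    by (rule lborel_pair.Fubini') simp
  finally have 3: "\<bar>a\<bar> * (\<integral>\<^sup>+y. \<integral>\<^sup>+x. f (a * x + b * y, c * x + d * y) \<partial>lborel \<partial>lborel)
     = (\<integral>\<^sup>+u. \<integral>\<^sup>+y. f (u, c / a * u + k * y) \<partial>lborel \<partial>lborel)" .
  have "\<bar>k\<bar> * (\<bar>a\<bar> * (\<integral>\<^sup>+y. \<integral>\<^sup>+x. f (a * x + b * y, c * x + d * y) \<partial>lborel \<partial>lborel))
     = (\<integral>\<^sup>+u. \<integral>\<^sup>+v. f (u, v) \<partial>lborel \<partial>lborel)"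
    unfolding 3 by (subst nn_integral_cmult[symmetric], simp) (simp only: 2)
  also have "\<dots> = (\<integral>\<^sup>+z. f z \<partial>(lborel \<Otimes>\<^sub>M lborel))"
    by (rule lborel.nn_integral_fst) (simp add: lborel_prod)
  also have "ennreal \<bar>k\<bar> * (ennreal \<bar>a\<bar> * I) = ennreal \<bar>a * d - b * c\<bar> * I" for I
    using assms(2) by (simp add: k_def mult.assoc[symmetric] ennreal_mult[symmetric] abs_divide)
  finally show ?thesis by (simp add: lborel_prod)
qed

lemma nn_integral_lborel_linear:
  fixes f :: "real \<times> real \<Rightarrow> ennreal" and a b c d :: real
  assumes [measurable]: "f \<in> borel_measurable borel" and det: "a * d - b * c \<noteq> 0"
  shows "\<bar>a * d - b * c\<bar> * (\<integral>\<^sup>+z. f (a * fst z + b * snd z, c * fst z + d * snd z) \<partial>lborel)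
    = (\<integral>\<^sup>+z. f z \<partial>lborel)"
proof -
  have eq: "(\<integral>\<^sup>+z. f (a * fst z + b * snd z, c * fst z + d * snd z) \<partial>lborel)
      = (\<integral>\<^sup>+x. \<integral>\<^sup>+y. f (a * x + b * y, c * x + d * y) \<partial>lborel \<partial>lborel)"
    by (subst lborel_prod[symmetric], subst lborel.nn_integral_fst[symmetric]) simp_all
  show ?thesis
  proof (cases "a = 0")
    case False
    show ?thesis
      unfolding eq nn_integral_lborel_linear_aux[OF assms(1) False det, symmetric]
      by (subst lborel_pair.Fubini') simp_all
  next
    case True
    \<comment> \<open>With \<open>a = 0\<close> the determinant forces \<open>b\<close> to be
      nonzero, so the auxiliary lemma applies with the two variables exchanged.\<close>
    with det have "b \<noteq> 0" "b * c - a * d \<noteq> 0" by auto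
    from nn_integral_lborel_linear_aux[OF assms(1) this] show ?thesis
      unfolding eq by (simp add: add.commute abs_minus_commute)
  qed
qed

text \<open>The standard density depends on the point only through its norm. An orthogonal map
  preserves the norm and has a Jacobian of modulus 1.\<close>

lemma distr_indep_normal_orthogonal:
  fixes a b c d :: real
  assumes "a\<^sup>2 + c\<^sup>2 = 1" "b\<^sup>2 + d\<^sup>2 = 1" "a * b + c * d = 0"
  shows "distr (indep_normal_law (0, 0)) borel (\<lambda>z. (a * fst z + b * snd z, c * fst z + d * snd z))
     = indep_normal_law (0, 0)" (is "distr _ _ ?T = ?N")
proof (rule measure_eqI)
  fix A assume "A \<in> sets (distr ?N borel ?T)"
  then have [measurable]: "A \<in> sets borel" by simp
  define n where "n z = ennreal (normal_density 0 1 (fst z) * normal_density 0 1 (snd z))" for z :: "real \<times> real"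
  have [measurable]: "n \<in> borel_measurable borel" unfolding n_def by measurable
  have T [measurable]: "?T \<in> borel \<rightarrow>\<^sub>M borel" by simp
  have [measurable]: "?T -` A \<in> sets borel" by (rule measurable_sets_borel[OF T]) simp
  have N: "?N = density lborel n" unfolding n_def indep_normal_law_density by simp
  \<comment> \<open>Lagrange's identity: for orthonormal columns the squared determinant is
    1.\<close>
  have "(a * d - b * c)\<^sup>2 = (a\<^sup>2 + c\<^sup>2) * (b\<^sup>2 + d\<^sup>2) - (a * b + c * d)\<^sup>2"
    by (simp add: power2_eq_square algebra_simps)
  then have det: "\<bar>a * d - b * c\<bar> = 1" using assms by (simp add: power2_eq_1_iff abs_if) linarith
  have norm: "(a * x + b * y)\<^sup>2 + (c * x + d * y)\<^sup>2 = x\<^sup>2 + y\<^sup>2" for x y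
  proof -
    have "(a * x + b * y)\<^sup>2 + (c * x + d * y)\<^sup>2 = (a\<^sup>2 + c\<^sup>2) * x\<^sup>2 + (b\<^sup>2 + d\<^sup>2) * y\<^sup>2 + 2 * (a * b + c * d) * x * y"
      by (simp add: power2_eq_square algebra_simps)
    then show ?thesis using assms by simp
  qed
  have n: "n (?T z) = n z" for z
    using norm[of "fst z" "snd z"]
    by (simp add: n_def normal_density_def exp_add[symmetric] add_divide_distrib[symmetric] minus_add_distrib[symmetric] del: minus_add_distrib)
  have "emeasure (distr ?N borel ?T) A = emeasure ?N (?T -` A)"
    by (subst emeasure_distr) simp_all
  also have "\<dots> = (\<integral>\<^sup>+z. n z * indicator (?T -` A) z \<partial>lborel)"
    unfolding N by (subst emeasure_density) simp_all
  also have "\<dots> = (\<integral>\<^sup>+z. n (?T z) * indicator A (?T z) \<partial>lborel)"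
    by (simp only: n indicator_vimage)
  also have "\<dots> = (\<integral>\<^sup>+z. n z * indicator A z \<partial>lborel)"
  proof -
    have "a * d - b * c \<noteq> 0" using det by auto
    from nn_integral_lborel_linear[of "\<lambda>z. n z * indicator A z", OF _ this]
    show ?thesis by (simp add: det)
  qed
  also have "\<dots> = emeasure ?N A"
    unfolding N by (subst emeasure_density) simp_all
  finally show "emeasure (distr ?N borel ?T) A = emeasure ?N A" .
qed simp

lemma integral_indep_normal_orthogonal:
  fixes a b c d :: real and f :: "real \<times> real \<Rightarrow> real"
  assumes "a\<^sup>2 + c\<^sup>2 = 1" "b\<^sup>2 + d\<^sup>2 = 1" "a * b + c * d = 0"
    and [measurable]: "f \<in> borel_measurable borel"
  shows "(\<integral>z. f (a * fst z + b * snd z, c * fst z + d * snd z) \<partial>indep_normal_law (0, 0))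
     = (\<integral>z. f z \<partial>indep_normal_law (0, 0))"
  by (subst (2) distr_indep_normal_orthogonal[OF assms(1-3), symmetric], subst integral_distr) simp_all

text \<open>The Cholesky factor of the correlation matrix maps an independent pair to the correlated
  one. The mean \<theta> of the second variable becomes the mean \<open>\<theta> / s\<close> of its
  independent part, which is how the local experiment reduces to the independent one.\<close>

lemma local_law_eq_distr:
  fixes r \<theta> :: real
  assumes r: "-1 < r" "r < 1"
  defines "s \<equiv> sqrt (1 - r\<^sup>2)"
  shows "local_law r \<theta> = distr (indep_normal_law (0, \<theta> / s)) borel (\<lambda>z. (fst z, r * fst z + s * snd z))"
    (is "_ = distr ?N _ ?T")
proof (rule measure_eqI)
  have r2: "r\<^sup>2 < 1" using r by (simp add: abs_square_less_1 abs_if)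
  then have s: "s > 0" "s\<^sup>2 = 1 - r\<^sup>2" unfolding s_def by simp_all
  show "sets (local_law r \<theta>) = sets (distr ?N borel ?T)"
    by (simp add: local_law_def bivariate_normal_law_def)
  fix A assume "A \<in> sets (local_law r \<theta>)"
  then have [measurable]: "A \<in> sets borel" by (simp add: local_law_def bivariate_normal_law_def)
  define f where "f z = exp (- ((fst z)\<^sup>2 - 2 * r * fst z * (snd z - \<theta>) + (snd z - \<theta>)\<^sup>2) / (2 * s\<^sup>2))
        / (2 * pi * s)" for z :: "real \<times> real"
  have [measurable]: "f \<in> borel_measurable borel" unfolding f_def by measurable
  have T [measurable]: "?T \<in> borel \<rightarrow>\<^sub>M borel" by simp
  have [measurable]: "?T -` A \<in> sets borel" by (rule measurable_sets_borel[OF T]) simp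
  have L: "local_law r \<theta> = density lborel (\<lambda>z. ennreal (f z))"
    using r2 by (simp add: local_law_def bivariate_normal_law_def f_def case_prod_unfold s_def)
  define n where "n z = normal_density 0 1 (fst z) * normal_density (\<theta> / s) 1 (snd z)" for z :: "real \<times> real"
  have [measurable]: "n \<in> borel_measurable borel" unfolding n_def by measurable
  have N: "?N = density lborel (\<lambda>z. ennreal (n z))" unfolding n_def indep_normal_law_density by simp
  have f: "ennreal s * ennreal (f (?T z)) = ennreal (n z)" for z
  proof -
    obtain x w where z: "z = (x, w)" by fastforce
    \<comment> \<open>In the independent coordinates the exponent is a sum of squares; its factor
      \<open>s\<^sup>2\<close> cancels the denominator.\<close>
    have "x\<^sup>2 - 2 * r * x * (r * x + s * w - \<theta>) + (r * x + s * w - \<theta>)\<^sup>2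
       = (1 - r\<^sup>2) * x\<^sup>2 + (s * w - \<theta>)\<^sup>2"
      by (simp add: power2_eq_square algebra_simps)
    also have "(s * w - \<theta>)\<^sup>2 = s\<^sup>2 * (w - \<theta> / s)\<^sup>2"
      using s(1) by (simp add: power2_eq_square field_simps)
    finally have e: "x\<^sup>2 - 2 * r * x * (r * x + s * w - \<theta>) + (r * x + s * w - \<theta>)\<^sup>2
       = s\<^sup>2 * (x\<^sup>2 + (w - \<theta> / s)\<^sup>2)" by (simp only: s(2)[symmetric] distrib_left)
    have q: "- (s\<^sup>2 * t) / (2 * s\<^sup>2) = - t / 2" for t using s(1) by simp
    have "s * f (?T z) = exp (- (x\<^sup>2 + (w - \<theta> / s)\<^sup>2) / 2) / (2 * pi)"
      unfolding f_def z fst_conv snd_conv e q using s(1) by simp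
    also have "- (x\<^sup>2 + (w - \<theta> / s)\<^sup>2) / 2 = - x\<^sup>2 / 2 + - (w - \<theta> / s)\<^sup>2 / 2" by simp
    also have "exp \<dots> / (2 * pi) = n z"
      by (simp add: n_def z normal_density_def exp_add[symmetric])
    finally show ?thesis using s(1) by (subst ennreal_mult[symmetric]) (simp_all add: f_def)
  qed
  have "emeasure (distr ?N borel ?T) A = emeasure ?N (?T -` A)"
    by (subst emeasure_distr) simp_all
  also have "\<dots> = (\<integral>\<^sup>+z. ennreal (n z) * indicator (?T -` A) z \<partial>lborel)"
    unfolding N by (subst emeasure_density) simp_all
  also have "\<dots> = (\<integral>\<^sup>+z. ennreal s * (ennreal (f (?T z)) * indicator A (?T z)) \<partial>lborel)"
    by (simp only: f[symmetric] indicator_vimage mult.assoc)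
  also have "\<dots> = ennreal s * (\<integral>\<^sup>+z. ennreal (f (?T z)) * indicator A (?T z) \<partial>lborel)"
    by (rule nn_integral_cmult) simp
  also have "\<dots> = (\<integral>\<^sup>+z. ennreal (f z) * indicator A z \<partial>lborel)"
    \<comment> \<open>The instances follow the order \<open>a d b c\<close> in which the variables
      occur in the lemma; the determinant is \<open>s\<close>.\<close>
    using nn_integral_lborel_linear[of "\<lambda>z. ennreal (f z) * indicator A z" 1 s 0 r] s(1) by simp
  also have "\<dots> = emeasure (local_law r \<theta>) A"
    unfolding L by (subst emeasure_density) simp_all
  finally show "emeasure (local_law r \<theta>) A = emeasure (distr ?N borel ?T) A" by simp
qed

lemma test_power_local_law:
  assumes "-1 < r" "r < 1" and [measurable]: "\<psi> \<in> borel_measurable borel"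
  shows "test_power (local_law r) \<theta> \<psi> = test_power indep_normal_law (0, \<theta> / sqrt (1 - r\<^sup>2))
     (\<lambda>z. \<psi> (fst z, r * fst z + sqrt (1 - r\<^sup>2) * snd z))"
  unfolding test_power_def local_law_eq_distr[OF assms(1,2)] by (subst integral_distr) simp_all

section \<open>Quantiles and critical values\<close>

text \<open>The limits of the distribution function at both ends make the set under the infimum
  nonempty and bounded below; right continuity makes the infimum attained.\<close>

lemma quantile_le_iff:
  assumes "real_distribution D" "0 < p" "p < 1"
  shows "quantile D p \<le> x \<longleftrightarrow> p \<le> cdf D x"
proof -
  interpret real_distribution D by fact
  let ?S = "{x. p \<le> cdf D x}"
  have "eventually (\<lambda>x. p < cdf D x) at_top"
    using order_tendstoD(1)[OF cdf_lim_at_top_prob, of p] assms by simp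
  then obtain x0 where x0: "x0 \<in> ?S"
    by (meson eventually_happens less_imp_le mem_Collect_eq trivial_limit_at_top_linorder)
  have "eventually (\<lambda>x. cdf D x < p) at_bot"
    using order_tendstoD(2)[OF cdf_lim_at_bot, of p] assms by simp
  then obtain l where l: "cdf D l < p"
    by (meson eventually_happens trivial_limit_at_bot_linorder)
  have bdd: "bdd_below ?S"
    using l cdf_nondecreasing by (intro bdd_belowI[of _ l]) (smt (verit) mem_Collect_eq)
  have up: "y \<in> ?S" if y: "quantile D p < y" for y
  proof -
    from y obtain s where "s \<in> ?S" "s < y"
      unfolding quantile_def using cInf_less_iff[OF _ bdd] x0 by blast
    then show ?thesis using cdf_nondecreasing[of s y] by auto
  qed
  have "(cdf D \<longlongrightarrow> cdf D (quantile D p)) (at_right (quantile D p))"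
    using cdf_is_right_cont by (simp add: continuous_within)
  moreover have "eventually (\<lambda>y. p \<le> cdf D y) (at_right (quantile D p))"
    using up by (auto simp: eventually_at_filter)
  ultimately have attained: "p \<le> cdf D (quantile D p)"
    by (rule tendsto_lowerbound) simp
  show ?thesis
  proof
    assume "quantile D p \<le> x"
    then show "p \<le> cdf D x" using attained cdf_nondecreasing by (meson order_trans)
  next
    assume "p \<le> cdf D x"
    then show "quantile D p \<le> x" unfolding quantile_def by (intro cInf_lower bdd) simp
  qed
qed

text \<open>Left of the quantile the distribution function is below \<open>p\<close>, at the
  quantile it is at least \<open>p\<close>; without an atom the two bounds meet.\<close>

lemma measure_atLeast_quantile:
  assumes "real_distribution D" "0 < p" "p < 1" and atom: "measure D {quantile D p} = 0"
  shows "measure D {quantile D p..} = 1 - p"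
proof -
  interpret real_distribution D by fact
  let ?q = "quantile D p"
  have "(cdf D \<longlongrightarrow> measure D {..<?q}) (at_left ?q)" by (rule cdf_at_left)
  moreover have "eventually (\<lambda>y. cdf D y \<le> p) (at_left ?q)"
  proof -
    have "cdf D y \<le> p" if "y < ?q" for y
      using quantile_le_iff[OF assms(1-3), of y] that by linarith
    then show ?thesis by (auto simp: eventually_at_filter)
  qed
  ultimately have "measure D {..<?q} \<le> p" by (rule tendsto_upperbound) simp
  moreover have "p \<le> measure D {..<?q}"
  proof -
    have "measure D {..?q} = measure D ({..<?q} \<union> {?q})"
      by (rule arg_cong[where f="measure D"]) auto
    also have "\<dots> = measure D {..<?q} + measure D {?q}" by (rule finite_measure_Union) auto
    finally show ?thesis using quantile_le_iff[OF assms(1-3), of ?q] atom by (simp add: cdf_def2)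
  qed
  moreover have "measure D {?q..} = 1 - measure D {..<?q}"
    using prob_compl[of "{..<?q}"] by (simp add: Compl_eq_Diff_UNIV[symmetric])
  ultimately show ?thesis by simp
qed

section \<open>The critical value of the linear combination test\<close>

lemma lc_stat_measurable [measurable]: "lc_stat a1 a2 r \<in> borel_measurable borel"
  unfolding lc_stat_def by measurable

text \<open>Turns claims about critical values into claims about probabilities of sublevel sets;
  comparison of critical values and their measurability in the correlation are derived from
  it.\<close>

lemma lc_crit_le_iff:
  assumes "0 < \<alpha>" "\<alpha> < 1"
  shows "lc_crit \<alpha> a1 a2 r \<le> x \<longleftrightarrow> 1 - \<alpha> \<le> measure (indep_normal_law (0, 0)) {z. lc_stat a1 a2 r z \<le> x}"
proof -
  interpret prob_space "indep_normal_law (0, 0)" by (rule prob_space_indep_normal_law)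
  let ?D = "distr (indep_normal_law (0, 0)) borel (lc_stat a1 a2 r)"
  have "real_distribution ?D" by simp
  moreover have "cdf ?D x = measure (indep_normal_law (0, 0)) {z. lc_stat a1 a2 r z \<le> x}"
    unfolding cdf_def by (subst measure_distr) (simp_all add: vimage_def)
  ultimately show ?thesis unfolding lc_crit_def using assms by (subst quantile_le_iff) simp_all
qed

text \<open>Pointwise domination of the quadratic forms gives an inclusion of sublevel sets, so
  quantiles are compared without computing any distribution function.\<close>

lemma lc_crit_le_scaled:
  assumes "0 < \<alpha>" "\<alpha> < 1" "0 \<le> k" "\<And>z. lc_stat b1 b2 t z \<le> k * lc_stat a1 a2 r z"
  shows "lc_crit \<alpha> b1 b2 t \<le> k * lc_crit \<alpha> a1 a2 r"
proof -
  interpret prob_space "indep_normal_law (0, 0)" by (rule prob_space_indep_normal_law)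
  have "1 - \<alpha> \<le> prob {z. lc_stat a1 a2 r z \<le> lc_crit \<alpha> a1 a2 r}"
    using lc_crit_le_iff[OF assms(1,2)] by blast
  also have "\<dots> \<le> prob {z. lc_stat b1 b2 t z \<le> k * lc_crit \<alpha> a1 a2 r}"
    using order_trans[OF assms(4) mult_left_mono[OF _ assms(3)]]
    by (intro finite_measure_mono subsetI) simp_all
  finally show ?thesis using lc_crit_le_iff[OF assms(1,2)] by blast
qed

text \<open>For fixed first coordinate the statistic is a quadratic polynomial in the second one.
  Its leading coefficient is positive because \<open>1 - a1 - a2\<close> is, so each section of the
  level set is finite.\<close>

lemma AE_lc_stat_neq:
  assumes "0 \<le> a2" "a1 + a2 < 1" "-1 < r" "r < 1"
  shows "AE z in indep_normal_law (0, 0). lc_stat a1 a2 r z \<noteq> c"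
proof -
  have r2: "r\<^sup>2 < 1" using assms by (simp add: abs_square_less_1 abs_if)
  define s where "s = sqrt (1 - r\<^sup>2)"
  have lead: "a2 * s\<^sup>2 + (1 - a1 - a2) > 0"
    using assms r2 unfolding s_def by (intro add_nonneg_pos) simp_all
  have fin: "finite {y. lc_stat a1 a2 r (x, y) = c}" for x
  proof -
    let ?p = "[:a1 * x\<^sup>2 + a2 * (r * x)\<^sup>2 - c, 2 * a2 * r * s * x, a2 * s\<^sup>2 + (1 - a1 - a2):]"
    have "{y. lc_stat a1 a2 r (x, y) = c} = {y. poly ?p y = 0}"
      unfolding lc_stat_def s_def[symmetric] fst_conv snd_conv
      by (intro Collect_cong) (simp add: power2_eq_square algebra_simps)
    then show ?thesis using poly_roots_finite[of ?p] lead by simp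
  qed
  have "AE x in lborel. AE y in lborel. lc_stat a1 a2 r (x, y) \<noteq> c"
    using AE_not_in[OF finite_imp_null_set_lborel[OF fin]] by simp
  then have "AE z in lborel \<Otimes>\<^sub>M lborel. lc_stat a1 a2 r z \<noteq> c"
  proof (intro lborel_pair.AE_pair_measure)
    show "{z \<in> space (lborel \<Otimes>\<^sub>M lborel). lc_stat a1 a2 r z \<noteq> c} \<in> sets (lborel \<Otimes>\<^sub>M lborel)"
      unfolding lborel_prod by simp
  qed simp
  then have "AE z in lborel. lc_stat a1 a2 r z \<noteq> c" unfolding lborel_prod .
  then show ?thesis
    unfolding indep_normal_law_density by (subst AE_density) auto
qed

lemma lc_test_measurable [measurable]: "lc_test \<alpha> a1 a2 r \<in> borel_measurable borel"
  unfolding lc_test_def by measurable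

text \<open>Level sets being null, the nonrandomized test attains its size exactly.\<close>

lemma test_power_lc_test_null:
  assumes "0 < \<alpha>" "\<alpha> < 1" "0 \<le> a2" "a1 + a2 < 1" "-1 < r" "r < 1"
  shows "test_power indep_normal_law (0, 0) (lc_test \<alpha> a1 a2 r) = \<alpha>"
proof -
  interpret prob_space "indep_normal_law (0, 0)" by (rule prob_space_indep_normal_law)
  let ?D = "distr (indep_normal_law (0, 0)) borel (lc_stat a1 a2 r)"
  let ?q = "lc_crit \<alpha> a1 a2 r"
  have "prob {z. lc_stat a1 a2 r z = ?q} = 0"
    using AE_lc_stat_neq[OF assms(3-6), of ?q] by (subst prob_eq_0) simp_all
  then have "measure ?D {?q} = 0" by (subst measure_distr) (simp_all add: vimage_def)
  then have "measure ?D {?q..} = \<alpha>"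
    using measure_atLeast_quantile[of ?D "1 - \<alpha>"] assms by (simp add: lc_crit_def)
  then have "prob {z. ?q \<le> lc_stat a1 a2 r z} = \<alpha>"
    by (subst (asm) measure_distr) (simp_all add: vimage_def)
  moreover have "lc_test \<alpha> a1 a2 r = indicator {z. ?q \<le> lc_stat a1 a2 r z}"
    by (auto simp: lc_test_def fun_eq_iff)
  ultimately show ?thesis unfolding test_power_def by simp
qed

section \<open>Power functions\<close>

text \<open>Dominated convergence for a parameter decreasing to 0. The reduction is to sequences in
  (0, 1), hence the range of \<open>b\<close> in the bound.\<close>

lemma tendsto_integral_indep_normal:
  fixes F :: "real \<Rightarrow> real \<times> real \<Rightarrow> real"
  assumes "\<And>b. F b \<in> borel_measurable borel" "f \<in> borel_measurable borel"
    and lim: "\<And>z. ((\<lambda>b. F b z) \<longlongrightarrow> f z) (at_right 0)"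
    and bound: "\<And>b z. 0 < b \<Longrightarrow> b \<le> 1 \<Longrightarrow> \<bar>F b z\<bar> \<le> C * exp (k * (\<bar>fst z\<bar> + \<bar>snd z\<bar>))"
  shows "((\<lambda>b. \<integral>z. F b z \<partial>indep_normal_law (0, 0)) \<longlongrightarrow> (\<integral>z. f z \<partial>indep_normal_law (0, 0))) (at_right 0)"
proof (rule tendsto_at_right_sequentially[where b=1])
  fix S :: "nat \<Rightarrow> real"
  assume S: "\<And>n. 0 < S n" "\<And>n. S n < 1" "decseq S" "S \<longlonglongrightarrow> 0"
  have "S n \<noteq> 0" for n using S(1)[of n] by simp
  then have "filterlim S (at_right 0) sequentially"
    using S by (simp add: filterlim_at)
  then have "(\<lambda>n. F (S n) z) \<longlonglongrightarrow> f z" for z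
    using filterlim_compose[OF lim] by blast
  then show "(\<lambda>n. \<integral>z. F (S n) z \<partial>indep_normal_law (0, 0)) \<longlonglongrightarrow> (\<integral>z. f z \<partial>indep_normal_law (0, 0))"
    using assms(1,2) S bound
    by (intro integral_dominated_convergence[where w="\<lambda>z. C * exp (k * (\<bar>fst z\<bar> + \<bar>snd z\<bar>))"]
        integrable_mult_right integrable_exp_abs AE_I2) (simp_all add: less_imp_le)
qed simp

text \<open>Continuity of power along rays carries inequalities from a dense set of alternatives to
  all means.\<close>

lemma tendsto_test_power:
  assumes "is_test \<phi>"
  shows "((\<lambda>\<epsilon>. test_power indep_normal_law (\<theta> + \<epsilon> *\<^sub>R v) \<phi>) \<longlongrightarrow> test_power indep_normal_law \<theta> \<phi>) (at_right 0)"
proof -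
  have [measurable]: "\<phi> \<in> borel_measurable borel" and \<phi>: "\<And>z. 0 \<le> \<phi> z" "\<And>z. \<phi> z \<le> 1"
    using assms unfolding is_test_def by auto
  obtain t1 t2 v1 v2 where [simp]: "\<theta> = (t1, t2)" "v = (v1, v2)" by (metis surj_pair)
  \<comment> \<open>One rate that bounds both tilting coefficients for every \<epsilon> in (0,
    1].\<close>
  let ?k = "\<bar>t1\<bar> + \<bar>t2\<bar> + \<bar>v1\<bar> + \<bar>v2\<bar>"
  show ?thesis
    unfolding test_power_indep_normal[OF \<open>\<phi> \<in> borel_measurable borel\<close>]
  proof (rule tendsto_integral_indep_normal[where C=1 and k="?k"])
    fix \<epsilon> :: real and z :: "real \<times> real" assume \<epsilon>: "0 < \<epsilon>" "\<epsilon> \<le> 1"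
    have *: "(t + \<epsilon> * w) * x \<le> ?k * \<bar>x\<bar>" if "\<bar>t\<bar> + \<bar>w\<bar> \<le> ?k" for t w x :: real
    proof -
      have "\<bar>t + \<epsilon> * w\<bar> \<le> \<bar>t\<bar> + \<epsilon> * \<bar>w\<bar>" using \<epsilon> by (metis abs_mult abs_of_pos abs_triangle_ineq)
      also have "\<dots> \<le> \<bar>t\<bar> + \<bar>w\<bar>" using mult_right_mono[of \<epsilon> 1 "\<bar>w\<bar>"] \<epsilon> by simp
      finally have "\<bar>t + \<epsilon> * w\<bar> * \<bar>x\<bar> \<le> ?k * \<bar>x\<bar>" using that by (intro mult_right_mono) auto
      then show ?thesis by (metis abs_ge_self abs_mult order_trans)
    qed
    have "(t1 + \<epsilon> * v1) * fst z + (t2 + \<epsilon> * v2) * snd z - ((t1 + \<epsilon> * v1)\<^sup>2 + (t2 + \<epsilon> * v2)\<^sup>2) / 2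
       \<le> ?k * \<bar>fst z\<bar> + ?k * \<bar>snd z\<bar> - 0"
      using *[of t1 v1 "fst z"] *[of t2 v2 "snd z"] by (intro add_mono diff_mono) auto
    then have "\<phi> z * exp (fst (\<theta> + \<epsilon> *\<^sub>R v) * fst z + snd (\<theta> + \<epsilon> *\<^sub>R v) * snd z
          - ((fst (\<theta> + \<epsilon> *\<^sub>R v))\<^sup>2 + (snd (\<theta> + \<epsilon> *\<^sub>R v))\<^sup>2) / 2)
       \<le> 1 * exp (?k * (\<bar>fst z\<bar> + \<bar>snd z\<bar>))"
      by (intro mult_mono) (simp_all add: \<phi> distrib_left)
    then show "\<bar>\<phi> z * exp (fst (\<theta> + \<epsilon> *\<^sub>R v) * fst z + snd (\<theta> + \<epsilon> *\<^sub>R v) * snd z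
          - ((fst (\<theta> + \<epsilon> *\<^sub>R v))\<^sup>2 + (snd (\<theta> + \<epsilon> *\<^sub>R v))\<^sup>2) / 2)\<bar>
       \<le> 1 * exp (?k * (\<bar>fst z\<bar> + \<bar>snd z\<bar>))"
      using \<phi>(1) by (subst abs_of_nonneg) auto
  qed (auto intro!: tendsto_eq_intros)
qed

text \<open>The test is even in both coordinates and the standard law is invariant under sign
  changes. So the exponential may be averaged over the four sign patterns, which gives the product
  of hyperbolic cosines.\<close>

lemma test_power_symmetrized:
  fixes g :: "real \<times> real \<Rightarrow> real"
  assumes "is_test g"
  shows "test_power indep_normal_law (t1, t2) (\<lambda>w. g ((fst w)\<^sup>2, (snd w)\<^sup>2))
    = (\<integral>w. g ((fst w)\<^sup>2, (snd w)\<^sup>2) * (exp (- (t1\<^sup>2 + t2\<^sup>2) / 2) * cosh (t1 * fst w) * cosh (t2 * snd w))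
        \<partial>indep_normal_law (0, 0))"
proof -
  have g [measurable]: "g \<in> borel_measurable borel" and g01: "\<And>z. 0 \<le> g z" "\<And>z. g z \<le> 1"
    using assms unfolding is_test_def by auto
  let ?g = "\<lambda>w. g ((fst w)\<^sup>2, (snd w)\<^sup>2)"
  let ?N = "indep_normal_law (0, 0)"
  have g' [measurable]: "?g \<in> borel_measurable borel" by measurable
  define E where "E a b w = exp (a * fst w + b * snd w)" for a b and w :: "real \<times> real"
  define I where "I a b = (\<integral>w. ?g w * E a b w \<partial>?N)" for a b
  have int: "integrable ?N (\<lambda>w. ?g w * E a b w)" for a b
    unfolding E_def by (rule Bochner_Integration.integrable_bound[OF integrable_exp_linear[of a b]])
      (use g01 in \<open>auto simp: abs_mult mult_left_le_one_le\<close>)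
  have flip: "I a b = I (p * a) (q * b)" if "p\<^sup>2 = 1" "q\<^sup>2 = 1" for a b p q :: real
    using integral_indep_normal_orthogonal[of p 0 0 q "\<lambda>w. ?g w * exp (a * fst w + b * snd w)"] that
    unfolding I_def E_def by (simp add: power_mult_distrib mult.commute mult.left_commute)
  have cosh4: "cosh (t1 * fst w) * cosh (t2 * snd w)
     = (E t1 t2 w + E (- t1) t2 w + E t1 (- t2) w + E (- t1) (- t2) w) / 4" for w
    by (simp add: E_def cosh_def exp_add[symmetric] algebra_simps)
  have "(\<integral>w. ?g w * (cosh (t1 * fst w) * cosh (t2 * snd w)) \<partial>?N)
     = (I t1 t2 + I (- t1) t2 + I t1 (- t2) + I (- t1) (- t2)) / 4"
    unfolding cosh4 I_def by (simp add: distrib_left int)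
  also have "\<dots> = I t1 t2"
    using flip[of "-1" 1 t1 t2] flip[of 1 "-1" t1 t2] flip[of "-1" "-1" t1 t2] by simp
  finally have "(\<integral>w. ?g w * (cosh (t1 * fst w) * cosh (t2 * snd w)) \<partial>?N) = I t1 t2" .
  moreover have "test_power indep_normal_law (t1, t2) ?g = exp (- (t1\<^sup>2 + t2\<^sup>2) / 2) * I t1 t2"
  proof -
    have "exp (l - q / 2) = exp (- q / 2) * exp l" for l q :: real
      by (simp add: exp_add[symmetric])
    then show ?thesis
      unfolding test_power_indep_normal[OF g'] I_def E_def fst_conv snd_conv
      by (subst integral_mult_right_zero[symmetric]) (simp only: mult.left_commute)
  qed
  moreover have "(\<integral>w. ?g w * (exp (- (t1\<^sup>2 + t2\<^sup>2) / 2) * cosh (t1 * fst w) * cosh (t2 * snd w)) \<partial>?N)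
      = exp (- (t1\<^sup>2 + t2\<^sup>2) / 2) * (\<integral>w. ?g w * (cosh (t1 * fst w) * cosh (t2 * snd w)) \<partial>?N)"
    by (subst integral_mult_right_zero[symmetric]) (simp only: mult_ac)
  ultimately show ?thesis by simp
qed

section \<open>Comparison of tests near the null\<close>

text \<open>cosh is even, hence smooth as a function of the square of its argument: parametrizing by
  squared means makes the averaged likelihood differentiable at the null.\<close>

lemma tendsto_cosh_sqrt:
  fixes k :: real
  assumes "0 \<le> k"
  shows "((\<lambda>b. (cosh (sqrt (b * k)) - 1) / b) \<longlongrightarrow> k / 2) (at_right 0)"
proof (cases "k = 0")
  case False
  with assms have "k > 0" by simp
  then show ?thesis by real_asymp (simp add: powr_half_sqrt)
qed simp

text \<open>Follows from cosh t - 1 = 2 sinh (t / 2)^2 and sinh u \<le> u exp u for nonnegative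
  u.\<close>

lemma cosh_minus_one_le:
  fixes t :: real
  assumes "0 \<le> t"
  shows "cosh t - 1 \<le> t\<^sup>2 / 2 * exp t"
proof -
  have "1 - exp (- t) \<le> t" using exp_ge_add_one_self[of "- t"] by simp
  then have "exp (t / 2) * (1 - exp (- t)) \<le> exp (t / 2) * t" by (intro mult_left_mono) simp_all
  then have "sinh (t / 2) \<le> t / 2 * exp (t / 2)"
    by (simp add: sinh_def exp_add[symmetric] algebra_simps)
  moreover have "0 \<le> sinh (t / 2)" using assms by simp
  ultimately have "(sinh (t / 2))\<^sup>2 \<le> (t / 2 * exp (t / 2))\<^sup>2" by (intro power_mono)
  moreover have "cosh t - 1 = 2 * (sinh (t / 2))\<^sup>2"
    using cosh_double[of "t / 2"] cosh_square_eq[of "t / 2"] by simp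
  moreover have "(t / 2 * exp (t / 2))\<^sup>2 = t\<^sup>2 / 4 * exp t"
    by (simp add: power_mult_distrib exp_double[symmetric] power_divide)
  ultimately show ?thesis by simp
qed

lemma square_le_exp_abs: "x\<^sup>2 \<le> 2 * exp \<bar>x :: real\<bar>"
  using exp_lower_Taylor_quadratic[of "\<bar>x\<bar>"] by (simp add: field_simps)

text \<open>The factor \<open>b\<close> in the second bound compensates the division by
  \<open>b\<close> in difference quotients, so that their envelope is free of
  \<open>b\<close>.\<close>

lemma cosh_sqrt_mult_bounds:
  fixes b n x :: real
  assumes "0 \<le> b" "b \<le> 1" "0 \<le> n" "n \<le> 1"
  shows "cosh (sqrt (b * n) * x) \<le> exp \<bar>x\<bar>" "cosh (sqrt (b * n) * x) - 1 \<le> b * exp (2 * \<bar>x\<bar>)"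
proof -
  let ?t = "sqrt (b * n) * \<bar>x\<bar>"
  have c: "cosh (sqrt (b * n) * x) = cosh ?t"
    by (cases "x \<ge> 0") simp_all
  have bn: "b * n \<le> b" "b * n \<le> 1" using assms mult_left_mono[of n 1 b] by simp_all
  have t: "0 \<le> ?t" "?t \<le> \<bar>x\<bar>" using assms bn by (simp_all add: mult_left_le_one_le)
  have "exp (- ?t) \<le> exp ?t" using t(1) by (subst exp_le_cancel_iff) linarith
  then have "cosh ?t \<le> exp ?t" by (simp add: cosh_def)
  also have "\<dots> \<le> exp \<bar>x\<bar>" using t by simp
  finally show "cosh (sqrt (b * n) * x) \<le> exp \<bar>x\<bar>" unfolding c .
  have "?t\<^sup>2 / 2 * exp ?t \<le> (b * exp \<bar>x\<bar>) * exp \<bar>x\<bar>"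
  proof (intro mult_mono)
    have "?t\<^sup>2 = b * n * x\<^sup>2" using assms by (simp add: power_mult_distrib)
    also have "\<dots> \<le> b * (2 * exp \<bar>x\<bar>)" using bn assms by (intro mult_mono square_le_exp_abs) simp_all
    finally show "?t\<^sup>2 / 2 \<le> b * exp \<bar>x\<bar>" by simp
  qed (use t assms in simp_all)
  also have "\<dots> = b * exp (2 * \<bar>x\<bar>)" by (simp add: exp_add[symmetric])
  finally show "cosh (sqrt (b * n) * x) - 1 \<le> b * exp (2 * \<bar>x\<bar>)"
    using cosh_minus_one_le[OF t(1)] unfolding c by linarith
qed

text \<open>
  Likelihood ratio of the means \<open>(sqrt (b n1), sqrt (b n2))\<close> against \<open>(0, 0)\<close>, averaged over the sign
  changes of both coordinates, when \<open>n1 + n2 = 1\<close>.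
\<close>

definition sym_lik :: "real \<Rightarrow> real \<Rightarrow> real \<Rightarrow> real \<times> real \<Rightarrow> real" where
  "sym_lik n1 n2 b w = exp (- b / 2) * cosh (sqrt (b * n1) * fst w) * cosh (sqrt (b * n2) * snd w)"

lemma cosh_measurable [measurable]: "(cosh :: real \<Rightarrow> real) \<in> borel_measurable borel"
  by (intro borel_measurable_continuous_onI continuous_intros)

lemma sym_lik_measurable [measurable]: "sym_lik n1 n2 b \<in> borel_measurable borel"
  unfolding sym_lik_def by measurable

lemma sym_lik_quotient_bound:
  assumes b: "0 < b" "b \<le> 1" and n: "0 \<le> n1" "0 \<le> n2" "n1 + n2 = 1"
  shows "\<bar>(sym_lik n1 n2 b w - 1) / b\<bar> \<le> 3 * exp (2 * (\<bar>fst w\<bar> + \<bar>snd w\<bar>))"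
proof -
  obtain x y where w: "w = (x, y)" by fastforce
  define E A B where "E = exp (- b / 2)" and "A = cosh (sqrt (b * n1) * x)" and "B = cosh (sqrt (b * n2) * y)"
  have E: "\<bar>E - 1\<bar> \<le> b" using exp_ge_add_one_self[of "- b / 2"] b unfolding E_def by simp
  have A: "1 \<le> A" "A \<le> exp (2 * \<bar>x\<bar>)" "A - 1 \<le> b * exp (2 * \<bar>x\<bar>)"
    using cosh_sqrt_mult_bounds[of b n1 x] b n
    unfolding A_def by (auto intro: order_trans cosh_real_ge_1)
  have B: "1 \<le> B" "B \<le> exp (2 * \<bar>y\<bar>)" "B - 1 \<le> b * exp (2 * \<bar>y\<bar>)"
    using cosh_sqrt_mult_bounds[of b n2 y] b n
    unfolding B_def by (auto intro: order_trans cosh_real_ge_1)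
  \<comment> \<open>\<open>E * A * B - 1\<close> telescopes into three increments, each at most
    \<open>b\<close> times the envelope; hence the constant 3.\<close>
  have "sym_lik n1 n2 b w - 1 = (E - 1) * (A * B) + (A - 1) * B + (B - 1)"
    unfolding sym_lik_def w E_def A_def B_def by (simp add: algebra_simps)
  also have "\<bar>\<dots>\<bar> \<le> \<bar>E - 1\<bar> * (A * B) + (A - 1) * B + (B - 1)"
    using A B by (intro order_trans[OF abs_triangle_ineq] add_mono) (simp_all add: abs_mult)
  also have "\<dots> \<le> b * (exp (2 * \<bar>x\<bar>) * exp (2 * \<bar>y\<bar>)) + (b * exp (2 * \<bar>x\<bar>)) * exp (2 * \<bar>y\<bar>)
      + b * (exp (2 * \<bar>x\<bar>) * exp (2 * \<bar>y\<bar>))"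
  proof (intro add_mono mult_mono E A B)
    have "b * exp (2 * \<bar>y\<bar>) \<le> b * (exp (2 * \<bar>x\<bar>) * exp (2 * \<bar>y\<bar>))"
      using b by (simp add: mult_le_cancel_right1)
    then show "B - 1 \<le> b * (exp (2 * \<bar>x\<bar>) * exp (2 * \<bar>y\<bar>))" using B(3) by linarith
  qed (use A B b in auto)
  also have "\<dots> = b * (3 * exp (2 * (\<bar>x\<bar> + \<bar>y\<bar>)))"
    by (simp add: exp_add distrib_left)
  finally show ?thesis using b by (simp add: w divide_le_eq mult.commute)
qed

text \<open>The product rule at \<open>b = 0\<close>, by the same telescoping; the summand -1/2
  comes from the normalizing factor \<open>exp (- b / 2)\<close>.\<close>

lemma sym_lik_quotient_tendsto:
  assumes n: "0 \<le> n1" "0 \<le> n2" "n1 + n2 = 1"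
  shows "((\<lambda>b. (sym_lik n1 n2 b w - 1) / b) \<longlongrightarrow> (n1 * (fst w)\<^sup>2 + n2 * (snd w)\<^sup>2 - 1) / 2) (at_right 0)"
proof -
  obtain x y where w: "w = (x, y)" by fastforce
  \<comment> \<open>Evenness of cosh moves \<open>x\<close> under the root, which is the shape that
    \<open>tendsto_cosh_sqrt\<close> treats.\<close>
  have c: "cosh (sqrt (b * n) * x) = cosh (sqrt (b * (n * x\<^sup>2)))" for b n x :: real
    by (cases "x \<ge> 0") (simp_all add: mult.assoc[symmetric] real_sqrt_mult)
  have A: "((\<lambda>b. (cosh (sqrt (b * n) * x) - 1) / b) \<longlongrightarrow> n * x\<^sup>2 / 2) (at_right 0)" if "0 \<le> n" for n x :: real
    unfolding c by (rule tendsto_cosh_sqrt) (use that in simp)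
  have B: "((\<lambda>b. cosh (sqrt (b * n) * x)) \<longlongrightarrow> 1) (at_right 0)" for n x :: real
    by (auto intro!: tendsto_eq_intros)
  have E: "((\<lambda>b::real. (exp (- b / 2) - 1) / b) \<longlongrightarrow> - 1 / 2) (at_right 0)" by real_asymp
  have "((\<lambda>b. (exp (- b / 2) - 1) / b * (cosh (sqrt (b * n1) * x) * cosh (sqrt (b * n2) * y))
      + (cosh (sqrt (b * n1) * x) - 1) / b * cosh (sqrt (b * n2) * y) + (cosh (sqrt (b * n2) * y) - 1) / b)
      \<longlongrightarrow> - 1 / 2 * (1 * 1) + n1 * x\<^sup>2 / 2 * 1 + n2 * y\<^sup>2 / 2) (at_right 0)"
    by (intro tendsto_add tendsto_mult A B E n)
  moreover have "(sym_lik n1 n2 b w - 1) / b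
      = (exp (- b / 2) - 1) / b * (cosh (sqrt (b * n1) * x) * cosh (sqrt (b * n2) * y))
      + (cosh (sqrt (b * n1) * x) - 1) / b * cosh (sqrt (b * n2) * y) + (cosh (sqrt (b * n2) * y) - 1) / b" for b
    unfolding sym_lik_def w by (simp add: add_divide_distrib[symmetric] algebra_simps)
  moreover have "- 1 / 2 * (1 * 1) + n1 * x\<^sup>2 / 2 * 1 + n2 * y\<^sup>2 / 2 = (n1 * x\<^sup>2 + n2 * y\<^sup>2 - 1) / 2"
    by (simp add: diff_divide_distrib add_divide_distrib)
  ultimately show ?thesis by (simp only: w fst_conv snd_conv)
qed

text \<open>To be used with \<delta> the difference of two tests of equal size. The integral of
  \<delta> against the likelihood is 0 at \<open>b = 0\<close>, and its derivative there is half the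
  integral of \<open>\<delta> * (S - 1)\<close>. As \<delta> integrates to 0, the 1 may be replaced
  by the cutoff \<open>c\<close>; then the integrand is nonnegative and not almost everywhere 0, so
  the derivative is positive.\<close>

lemma local_comparison:
  fixes \<delta> :: "real \<times> real \<Rightarrow> real" and n1 n2 c :: real
  defines "S \<equiv> \<lambda>w. n1 * (fst w)\<^sup>2 + n2 * (snd w)\<^sup>2"
  assumes n: "0 \<le> n1" "0 \<le> n2" "n1 + n2 = 1"
    and [measurable]: "\<delta> \<in> borel_measurable borel" and \<delta>: "\<And>w. \<bar>\<delta> w\<bar> \<le> 1"
    and int0: "(\<integral>w. \<delta> w \<partial>indep_normal_law (0, 0)) = 0"
    and sign: "\<And>w. 0 \<le> \<delta> w * (S w - c)"
    and nontriv: "\<not> (AE w in indep_normal_law (0, 0). \<delta> w * (S w - c) = 0)"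
  shows "\<exists>bbar>0. \<forall>b. 0 < b \<and> b < bbar \<longrightarrow> 0 < (\<integral>w. \<delta> w * sym_lik n1 n2 b w \<partial>indep_normal_law (0, 0))"
proof -
  let ?N = "indep_normal_law (0, 0)"
  interpret prob_space ?N by (rule prob_space_indep_normal_law)
  have [measurable]: "S \<in> borel_measurable borel" unfolding S_def by measurable
  have S: "\<bar>S w\<bar> \<le> 4 * exp (1 * (\<bar>fst w\<bar> + \<bar>snd w\<bar>))" for w
  proof -
    obtain x y where w: "w = (x, y)" by fastforce
    have "\<bar>S w\<bar> = n1 * x\<^sup>2 + n2 * y\<^sup>2" using n by (simp add: S_def w)
    also have "\<dots> \<le> 1 * (2 * exp \<bar>x\<bar>) + 1 * (2 * exp \<bar>y\<bar>)"
      using n by (intro add_mono mult_mono square_le_exp_abs) simp_all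
    also have "\<dots> \<le> 2 * (exp \<bar>x\<bar> * exp \<bar>y\<bar>) + 2 * (exp \<bar>x\<bar> * exp \<bar>y\<bar>)"
      by (intro add_mono) (simp_all add: mult_le_cancel_left1 mult_le_cancel_right1)
    finally show ?thesis by (simp add: w exp_add)
  qed
  have prod_bound: "\<bar>\<delta> w * f\<bar> \<le> u" if "\<bar>f\<bar> \<le> u" for w f u
    using mult_mono[OF \<delta>[of w] that] by (simp add: abs_mult)
  have intS: "integrable ?N (\<lambda>w. \<delta> w * S w)"
    by (rule integrable_exp_bound[OF _ prod_bound[OF S]]) simp
  have int\<delta>: "integrable ?N \<delta>"
    by (rule integrable_exp_bound[where c=1 and k=0]) (use \<delta> in simp_all)
  have "((\<lambda>b. \<integral>w. \<delta> w * ((sym_lik n1 n2 b w - 1) / b) \<partial>?N) \<longlongrightarrow> (\<integral>w. \<delta> w * ((S w - 1) / 2) \<partial>?N)) (at_right 0)"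
  proof (rule tendsto_integral_indep_normal[where C=3 and k=2])
    show "((\<lambda>b. \<delta> w * ((sym_lik n1 n2 b w - 1) / b)) \<longlongrightarrow> \<delta> w * ((S w - 1) / 2)) (at_right 0)" for w
      unfolding S_def by (intro tendsto_mult tendsto_const sym_lik_quotient_tendsto n)
    show "\<bar>\<delta> w * ((sym_lik n1 n2 b w - 1) / b)\<bar> \<le> 3 * exp (2 * (\<bar>fst w\<bar> + \<bar>snd w\<bar>))" if "0 < b" "b \<le> 1" for b w
      by (intro prod_bound sym_lik_quotient_bound that n)
  qed simp_all
  moreover have "(\<integral>w. \<delta> w * ((S w - 1) / 2) \<partial>?N) > 0"
  proof -
    have "0 < (\<integral>w. \<delta> w * (S w - c) \<partial>?N)"
    proof (rule ccontr)
      assume "\<not> ?thesis"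
      moreover have "0 \<le> (\<integral>w. \<delta> w * (S w - c) \<partial>?N)" using sign by (intro integral_nonneg_AE AE_I2)
      ultimately have "(\<integral>w. \<delta> w * (S w - c) \<partial>?N) = 0" by simp
      moreover have "integrable ?N (\<lambda>w. \<delta> w * (S w - c))"
        using intS int\<delta> by (simp add: right_diff_distrib)
      ultimately have "AE w in ?N. \<delta> w * (S w - c) = 0"
        using integral_nonneg_eq_0_iff_AE[of ?N "\<lambda>w. \<delta> w * (S w - c)"] sign by simp
      with nontriv show False by simp
    qed
    then show ?thesis using intS int\<delta> int0 by (simp add: right_diff_distrib diff_divide_distrib)
  qed
  ultimately have "eventually (\<lambda>b. 0 < (\<integral>w. \<delta> w * ((sym_lik n1 n2 b w - 1) / b) \<partial>?N)) (at_right 0)"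
    by (rule order_tendstoD)
  then obtain e where e: "e > 0" "\<And>b. 0 < b \<Longrightarrow> b < e \<Longrightarrow> 0 < (\<integral>w. \<delta> w * ((sym_lik n1 n2 b w - 1) / b) \<partial>?N)"
    unfolding eventually_at_right_field by auto
  show ?thesis
  \<comment> \<open>The cap 1 is the range in which the envelope of the quotient holds.\<close>
  proof (intro exI[of _ "min e 1"] conjI allI impI)
    fix b assume b: "0 < b \<and> b < min e 1"
    have I: "integrable ?N (\<lambda>w. \<delta> w * ((sym_lik n1 n2 b w - 1) / b))"
      by (rule integrable_exp_bound[OF _ prod_bound[OF sym_lik_quotient_bound[OF _ _ n]]]) (use b in simp_all)
    have "(\<integral>w. \<delta> w + b * (\<delta> w * ((sym_lik n1 n2 b w - 1) / b)) \<partial>?N)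
        = 0 + b * (\<integral>w. \<delta> w * ((sym_lik n1 n2 b w - 1) / b) \<partial>?N)"
      using Bochner_Integration.integral_add[OF int\<delta> integrable_mult_right[OF I, of b]]
      by (simp only: int0 integral_mult_right_zero)
    moreover have "\<delta> w + b * (\<delta> w * ((sym_lik n1 n2 b w - 1) / b)) = \<delta> w * sym_lik n1 n2 b w" for w
      using b by (simp add: field_simps)
    moreover have "0 < b * (\<integral>w. \<delta> w * ((sym_lik n1 n2 b w - 1) / b) \<partial>?N)"
      using e(2)[of b] b by (intro mult_pos_pos) auto
    ultimately show "0 < (\<integral>w. \<delta> w * sym_lik n1 n2 b w \<partial>?N)" by (simp only: add_0)
  qed (use e in simp)
qed

section \<open>Weak identification\<close>

text \<open>The matrix decomposition in scalar form: orthonormal rows and columns of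
  \<open>U\<close>, eigenvalues summing to the trace, which is 1, and the statistic, being the
  quadratic form of \<open>lc_matrix\<close>, diagonal in the rotated coordinates.\<close>

lemma lc_eigen_decompD:
  assumes "lc_eigen_decomp a1 a2 r U n1 n2"
  defines "a \<equiv> U $ 1 $ 1" and "b \<equiv> U $ 2 $ 1" and "c \<equiv> U $ 1 $ 2" and "d \<equiv> U $ 2 $ 2"
  shows "a\<^sup>2 + c\<^sup>2 = 1" "b\<^sup>2 + d\<^sup>2 = 1" "a * b + c * d = 0"
    "a\<^sup>2 + b\<^sup>2 = 1" "c\<^sup>2 + d\<^sup>2 = 1" "a * c + b * d = 0"
    "0 \<le> n1" "0 \<le> n2" "n1 + n2 = 1"
    "rotate_obs U z $ 1 = a * fst z + b * snd z" "rotate_obs U z $ 2 = c * fst z + d * snd z"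
    "(vector [t1, t2] v* U) $ 1 = a * t1 + b * t2" "(vector [t1, t2] v* U) $ 2 = c * t1 + d * t2"
    "\<bar>r\<bar> < 1 \<Longrightarrow> lc_stat a1 a2 r z = n1 * (a * fst z + b * snd z)\<^sup>2 + n2 * (c * fst z + d * snd z)\<^sup>2"
proof -
  have orth: "Finite_Cartesian_Product.transpose U ** U = Finite_Cartesian_Product.mat 1" "U ** Finite_Cartesian_Product.transpose U = Finite_Cartesian_Product.mat 1"
    and n: "n2 \<le> n1" "0 \<le> n2"
    and M: "lc_matrix a1 a2 r = U ** vector [vector [n1, 0], vector [0, n2]] ** Finite_Cartesian_Product.transpose U"
    using assms(1) unfolding lc_eigen_decomp_def orthogonal_matrix_def by auto
  note ent = matrix_matrix_mult_def sum_2 Finite_Cartesian_Product.transpose_def Finite_Cartesian_Product.mat_def power2_eq_square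
  have o1: "(Finite_Cartesian_Product.transpose U ** U) $ i $ j = Finite_Cartesian_Product.mat 1 $ i $ j"
    and o2: "(U ** Finite_Cartesian_Product.transpose U) $ i $ j = Finite_Cartesian_Product.mat 1 $ i $ j" for i j
    by (simp_all only: orth)
  show rows: "a\<^sup>2 + c\<^sup>2 = 1" "b\<^sup>2 + d\<^sup>2 = 1" "a * b + c * d = 0"
    using o2[of 1 1] o2[of 2 2] o2[of 1 2] unfolding a_def b_def c_def d_def by (simp_all add: ent)
  show cols: "a\<^sup>2 + b\<^sup>2 = 1" "c\<^sup>2 + d\<^sup>2 = 1" "a * c + b * d = 0"
    using o1[of 1 1] o1[of 2 2] o1[of 1 2] unfolding a_def b_def c_def d_def by (simp_all add: ent)
  have M': "lc_matrix a1 a2 r $ i $ j = (U ** vector [vector [n1, 0], vector [0, n2]] ** Finite_Cartesian_Product.transpose U) $ i $ j" for i j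
    by (simp only: M)
  show "0 \<le> n1" "0 \<le> n2" using n by simp_all
  have m: "a1 + a2 * r\<^sup>2 = n1 * a\<^sup>2 + n2 * c\<^sup>2" "a2 * r * sqrt (1 - r\<^sup>2) = n1 * (a * b) + n2 * (c * d)"
    "1 - a1 - a2 * r\<^sup>2 = n1 * b\<^sup>2 + n2 * d\<^sup>2"
    using M'[of 1 1] M'[of 1 2] M'[of 2 2] unfolding a_def b_def c_def d_def lc_matrix_def
    by (simp_all add: ent algebra_simps)
  have "1 = n1 * (a\<^sup>2 + b\<^sup>2) + n2 * (c\<^sup>2 + d\<^sup>2)"
    using m(1,3) by (simp add: algebra_simps)
  then show "n1 + n2 = 1" by (simp add: cols)
  show "rotate_obs U z $ 1 = a * fst z + b * snd z" "rotate_obs U z $ 2 = c * fst z + d * snd z"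
    unfolding rotate_obs_def a_def b_def c_def d_def
    by (simp_all add: matrix_vector_mult_def sum_2 Finite_Cartesian_Product.transpose_def)
  show "(vector [t1, t2] v* U) $ 1 = a * t1 + b * t2" "(vector [t1, t2] v* U) $ 2 = c * t1 + d * t2"
    unfolding a_def b_def c_def d_def
    by (simp_all add: vector_matrix_mult_def sum_2)
  show "lc_stat a1 a2 r z = n1 * (a * fst z + b * snd z)\<^sup>2 + n2 * (c * fst z + d * snd z)\<^sup>2" if "\<bar>r\<bar> < 1"
  proof -
    obtain x y where z: "z = (x, y)" by fastforce
    have s2: "(sqrt (1 - r\<^sup>2))\<^sup>2 = 1 - r\<^sup>2" using that by (simp add: abs_square_le_1)
    have "lc_stat a1 a2 r z = (a1 + a2 * r\<^sup>2) * x\<^sup>2 + 2 * (a2 * r * sqrt (1 - r\<^sup>2)) * (x * y)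
        + (a2 * (sqrt (1 - r\<^sup>2))\<^sup>2 + (1 - a1 - a2)) * y\<^sup>2"
      unfolding lc_stat_def z fst_conv snd_conv by (simp only: power2_eq_square) (simp only: algebra_simps)
    also have "a2 * (sqrt (1 - r\<^sup>2))\<^sup>2 + (1 - a1 - a2) = 1 - a1 - a2 * r\<^sup>2"
      unfolding s2 by (simp add: algebra_simps)
    finally show ?thesis
      unfolding m z fst_conv snd_conv by (simp add: power2_eq_square algebra_simps)
  qed
qed

section \<open>Power in the rotated coordinates\<close>

lemma test_power_cong_AE:
  assumes [measurable]: "\<phi> \<in> borel_measurable borel" "\<psi> \<in> borel_measurable borel"
    and "AE z in indep_normal_law (0, 0). \<phi> z = \<psi> z"
  shows "test_power indep_normal_law \<theta> \<phi> = test_power indep_normal_law \<theta> \<psi>"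
  unfolding test_power_indep_normal[OF assms(1)] test_power_indep_normal[OF assms(2)]
  by (rule integral_cong_AE) (use assms(3) in auto)

text \<open>Rotating the observation rotates its mean: inner products and norms in the tilting
  exponent are preserved, and so is the reference law.\<close>

lemma test_power_rotated:
  fixes a b c d :: real
  assumes orth: "a\<^sup>2 + c\<^sup>2 = 1" "b\<^sup>2 + d\<^sup>2 = 1" "a * b + c * d = 0"
    and f [measurable]: "f \<in> borel_measurable borel"
  shows "test_power indep_normal_law (t1, t2) (\<lambda>z. f (a * fst z + b * snd z, c * fst z + d * snd z))
    = test_power indep_normal_law (a * t1 + b * t2, c * t1 + d * t2) f"
proof -
  have inner: "(a * t1 + b * t2) * (a * x + b * y) + (c * t1 + d * t2) * (c * x + d * y) = t1 * x + t2 * y" for t1 t2 x y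
  proof -
    have "(a * t1 + b * t2) * (a * x + b * y) + (c * t1 + d * t2) * (c * x + d * y)
        = (a\<^sup>2 + c\<^sup>2) * (t1 * x) + (b\<^sup>2 + d\<^sup>2) * (t2 * y) + (a * b + c * d) * (t1 * y + t2 * x)"
      by (simp add: power2_eq_square algebra_simps)
    then show ?thesis using orth by simp
  qed
  have "(\<lambda>z. f (a * fst z + b * snd z, c * fst z + d * snd z)) \<in> borel_measurable borel" by simp
  note p = test_power_indep_normal[OF this] test_power_indep_normal[OF f]
  show ?thesis
    unfolding p using inner[of t1 t2 t1 t2]
    by (subst integral_indep_normal_orthogonal[OF orth, symmetric]) (simp_all add: inner power2_eq_square)
qed

text \<open>The dichotomy behind both claims under weak identification: a test of the class either
  coincides almost everywhere with the linear combination test or is strictly worse than it for all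
  small \<open>b\<close> in the direction \<open>(n1, n2)\<close>. Strictness is what admissibility
  will need.\<close>

lemma squared_rotated_tests_local:
  assumes \<alpha>: "0 < \<alpha>" "\<alpha> < 1" and w: "0 \<le> a2" "a1 + a2 < 1" and r: "-1 < r" "r < 1"
    and U: "lc_eigen_decomp a1 a2 r U n1 n2" and \<phi>: "\<phi> \<in> squared_rotated_tests \<alpha> U"
  shows "lc_test \<alpha> a1 a2 r \<in> squared_rotated_tests \<alpha> U"
    and "is_test \<phi>"
    and "(AE z in indep_normal_law (0, 0). \<phi> z = lc_test \<alpha> a1 a2 r z) \<or>
      (\<exists>bbar>0. \<forall>b t1 t2. 0 < b \<and> b < bbar \<and>
         ((vector [t1, t2] v* U) $ 1)\<^sup>2 = b * n1 \<and> ((vector [t1, t2] v* U) $ 2)\<^sup>2 = b * n2 \<longrightarrow>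
         test_power indep_normal_law (t1, t2) \<phi> < test_power indep_normal_law (t1, t2) (lc_test \<alpha> a1 a2 r))"
proof -
  define a b c d where "a = U $ 1 $ 1" and "b = U $ 2 $ 1" and "c = U $ 1 $ 2" and "d = U $ 2 $ 2"
  note D = lc_eigen_decompD[OF U, folded a_def b_def c_def d_def]
  define T where "T z = (a * fst z + b * snd z, c * fst z + d * snd z)" for z :: "real \<times> real"
  have T [measurable]: "T \<in> borel \<rightarrow>\<^sub>M borel" unfolding T_def by simp
  define q where "q = lc_crit \<alpha> a1 a2 r"
  \<comment> \<open>\<open>g0\<close> exhibits the linear combination test as a function of the
    squared rotated coordinates.\<close>
  define g0 :: "real \<times> real \<Rightarrow> real" where "g0 u = of_bool (q \<le> n1 * fst u + n2 * snd u)" for u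
  have g0 [measurable]: "g0 \<in> borel_measurable borel" unfolding g0_def by measurable
  have g0_test: "is_test g0" unfolding is_test_def using g0 by (simp add: g0_def)
  have stat: "lc_stat a1 a2 r z = n1 * (fst (T z))\<^sup>2 + n2 * (snd (T z))\<^sup>2" for z
    using D(14) r by (simp add: T_def)
  have lc: "lc_test \<alpha> a1 a2 r = (\<lambda>z. g0 ((rotate_obs U z $ 1)\<^sup>2, (rotate_obs U z $ 2)\<^sup>2))"
    unfolding lc_test_def g0_def D(10,11) fun_eq_iff stat q_def by (simp add: T_def)
  have size: "test_power indep_normal_law (0, 0) (lc_test \<alpha> a1 a2 r) = \<alpha>"
    using test_power_lc_test_null \<alpha> w r by blast
  then show "lc_test \<alpha> a1 a2 r \<in> squared_rotated_tests \<alpha> U"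
    unfolding squared_rotated_tests_def has_size_def using g0_test lc by auto
  obtain g where g_test: "is_test g" and \<phi>g: "\<phi> = (\<lambda>z. g ((rotate_obs U z $ 1)\<^sup>2, (rotate_obs U z $ 2)\<^sup>2))"
    and size_\<phi>: "test_power indep_normal_law (0, 0) \<phi> = \<alpha>"
    using \<phi> unfolding squared_rotated_tests_def has_size_def by auto
  have g [measurable]: "g \<in> borel_measurable borel" and g01: "\<And>u. 0 \<le> g u" "\<And>u. g u \<le> 1"
    using g_test unfolding is_test_def by auto
  define sq :: "real \<times> real \<Rightarrow> real \<times> real" where "sq w = ((fst w)\<^sup>2, (snd w)\<^sup>2)" for w
  have sq [measurable]: "sq \<in> borel \<rightarrow>\<^sub>M borel" unfolding sq_def by simp
  have \<phi>T: "\<phi> = (\<lambda>z. g (sq (T z)))" unfolding \<phi>g D(10,11) T_def sq_def by simp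
  have lcT: "lc_test \<alpha> a1 a2 r = (\<lambda>z. g0 (sq (T z)))" unfolding lc D(10,11) T_def sq_def by simp
  show is_test_\<phi>: "is_test \<phi>" unfolding is_test_def \<phi>T using g01 by simp
  \<comment> \<open>Power depends on the means only through their squared rotated coordinates, so
    the whole family of means with the given squares is described by \<open>e\<close> alone.\<close>
  have power: "test_power indep_normal_law (t1, t2) (\<lambda>z. f (sq (T z)))
      = (\<integral>w. f (sq w) * sym_lik n1 n2 e w \<partial>indep_normal_law (0, 0))"
    if "is_test f" "(a * t1 + b * t2)\<^sup>2 = e * n1" "(c * t1 + d * t2)\<^sup>2 = e * n2" for f t1 t2 e
  proof -
    have [measurable]: "f \<in> borel_measurable borel" using that(1) unfolding is_test_def by simp
    have abs_cosh: "cosh (s * x) = cosh (\<bar>s\<bar> * x)" for s x :: real by (cases "s \<ge> 0") simp_all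
    have "\<bar>a * t1 + b * t2\<bar> = sqrt (e * n1)" "\<bar>c * t1 + d * t2\<bar> = sqrt (e * n2)"
      using that(2,3) by (simp_all flip: that(2,3))
    then have ch: "cosh ((a * t1 + b * t2) * x) = cosh (sqrt (e * n1) * x)"
        "cosh ((c * t1 + d * t2) * x) = cosh (sqrt (e * n2) * x)" for x
      using abs_cosh[of "a * t1 + b * t2"] abs_cosh[of "c * t1 + d * t2"] by simp_all
    have e: "(a * t1 + b * t2)\<^sup>2 + (c * t1 + d * t2)\<^sup>2 = e"
      unfolding that(2,3) distrib_left[symmetric] D(9) by simp
    have "test_power indep_normal_law (t1, t2) (\<lambda>z. f (sq (T z)))
        = test_power indep_normal_law (a * t1 + b * t2, c * t1 + d * t2) (\<lambda>w. f (sq w))"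
      unfolding T_def by (rule test_power_rotated[OF D(1-3)]) simp
    then show ?thesis
      unfolding sq_def test_power_symmetrized[OF that(1)] e ch sym_lik_def by simp
  qed
  have null: "(\<integral>w. f (sq w) \<partial>indep_normal_law (0, 0)) = test_power indep_normal_law (0, 0) (\<lambda>z. f (sq (T z)))"
    if "is_test f" for f
    using power[OF that, of 0 0 0] by (simp add: sym_lik_def)
  interpret prob_space "indep_normal_law (0, 0)" by (rule prob_space_indep_normal_law)
  have int: "integrable (indep_normal_law (0, 0)) (\<lambda>w. f (sq w) * sym_lik n1 n2 e w)"
    if "is_test f" "0 \<le> e" "e \<le> 1" for f e
  proof (rule integrable_exp_bound[where c=1 and k=1])
    fix w :: "real \<times> real"
    have "\<bar>sym_lik n1 n2 e w\<bar> \<le> 1 * exp \<bar>fst w\<bar> * exp \<bar>snd w\<bar>"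
      unfolding sym_lik_def abs_mult using that D(7-9)
      by (intro mult_mono) (auto intro!: cosh_sqrt_mult_bounds simp: abs_mult)
    moreover have "0 \<le> f (sq w)" "f (sq w) \<le> 1" using that(1) unfolding is_test_def by blast+
    then have "\<bar>f (sq w)\<bar> \<le> 1" by simp
    ultimately have "\<bar>f (sq w)\<bar> * \<bar>sym_lik n1 n2 e w\<bar> \<le> 1 * (1 * exp \<bar>fst w\<bar> * exp \<bar>snd w\<bar>)"
      by (intro mult_mono) auto
    then show "\<bar>f (sq w) * sym_lik n1 n2 e w\<bar> \<le> 1 * exp (1 * (\<bar>fst w\<bar> + \<bar>snd w\<bar>))"
      by (simp add: abs_mult exp_add)
    have [measurable]: "f \<in> borel_measurable borel" using that(1) unfolding is_test_def by simp
    show "(\<lambda>w. f (sq w) * sym_lik n1 n2 e w) \<in> borel_measurable borel" by measurable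
  qed
  define \<delta> where "\<delta> w = g0 (sq w) - g (sq w)" for w
  have \<delta> [measurable]: "\<delta> \<in> borel_measurable borel" unfolding \<delta>_def by simp
  let ?S = "\<lambda>w. n1 * (fst w)\<^sup>2 + n2 * (snd w)\<^sup>2"
  show "(AE z in indep_normal_law (0, 0). \<phi> z = lc_test \<alpha> a1 a2 r z) \<or>
      (\<exists>bbar>0. \<forall>b t1 t2. 0 < b \<and> b < bbar \<and>
         ((vector [t1, t2] v* U) $ 1)\<^sup>2 = b * n1 \<and> ((vector [t1, t2] v* U) $ 2)\<^sup>2 = b * n2 \<longrightarrow>
         test_power indep_normal_law (t1, t2) \<phi> < test_power indep_normal_law (t1, t2) (lc_test \<alpha> a1 a2 r))"
  proof (cases "AE w in indep_normal_law (0, 0). \<delta> w * (?S w - q) = 0")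
    case True
    \<comment> \<open>The orthogonal map carries the null set back to the original coordinates. The
      boundary of the rejection region is null as well, so the difference of the two tests itself
      vanishes almost everywhere.\<close>
    then have "AE w in distr (indep_normal_law (0, 0)) borel T. \<delta> w * (?S w - q) = 0"
      unfolding T_def distr_indep_normal_orthogonal[OF D(1-3)] .
    then have "AE z in indep_normal_law (0, 0). \<delta> (T z) * (?S (T z) - q) = 0"
      by (subst (asm) AE_distr_iff) simp_all
    moreover have "AE z in indep_normal_law (0, 0). lc_stat a1 a2 r z \<noteq> q"
      by (rule AE_lc_stat_neq) (use w r in auto)
    ultimately have "AE z in indep_normal_law (0, 0). \<phi> z = lc_test \<alpha> a1 a2 r z"
      by eventually_elim (simp add: stat \<phi>T lcT \<delta>_def)
    then show ?thesis ..
  next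
    case False
    have "\<exists>bbar>0. \<forall>b. 0 < b \<and> b < bbar \<longrightarrow> 0 < (\<integral>w. \<delta> w * sym_lik n1 n2 b w \<partial>indep_normal_law (0, 0))"
    proof (rule local_comparison[OF D(7-9) \<delta> _ _ _ False])
      show "\<bar>\<delta> w\<bar> \<le> 1" for w
        using g01[of "sq w"] by (simp add: \<delta>_def g0_def abs_if)
      show "0 \<le> \<delta> w * (?S w - q)" for w
        using g01[of "sq w"] by (auto simp: \<delta>_def g0_def sq_def intro!: mult_nonneg_nonpos)
      show "(\<integral>w. \<delta> w \<partial>indep_normal_law (0, 0)) = 0"
        using int[OF g_test, of 0] int[OF g0_test, of 0] null[OF g_test] null[OF g0_test] size size_\<phi>
        unfolding \<delta>_def lcT \<phi>T by (simp add: sym_lik_def)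
    qed
    then obtain e where e: "e > 0" "\<And>b. 0 < b \<Longrightarrow> b < e \<Longrightarrow> 0 < (\<integral>w. \<delta> w * sym_lik n1 n2 b w \<partial>indep_normal_law (0, 0))"
      by auto
    have "test_power indep_normal_law (t1, t2) \<phi> < test_power indep_normal_law (t1, t2) (lc_test \<alpha> a1 a2 r)"
      if "0 < f" "f < min e 1" "(a * t1 + b * t2)\<^sup>2 = f * n1" "(c * t1 + d * t2)\<^sup>2 = f * n2" for f t1 t2
    proof -
      have "0 < (\<integral>w. \<delta> w * sym_lik n1 n2 f w \<partial>indep_normal_law (0, 0))" using e that by simp
      also have "\<dots> = (\<integral>w. g0 (sq w) * sym_lik n1 n2 f w \<partial>indep_normal_law (0, 0))
          - (\<integral>w. g (sq w) * sym_lik n1 n2 f w \<partial>indep_normal_law (0, 0))"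
        unfolding \<delta>_def left_diff_distrib
        by (rule Bochner_Integration.integral_diff) (use int g_test g0_test that in auto)
      finally show ?thesis
        unfolding \<phi>T lcT power[OF g_test that(3,4)] power[OF g0_test that(3,4)] by simp
    qed
    then show ?thesis
      unfolding D(12,13) using e(1) by (intro disjI2 exI[of _ "min e 1"]) auto
  qed
qed

text \<open>A test that is nowhere worse on \<open>H\<close> is nowhere worse at all, by density and
  continuity. If it is better somewhere, it cannot agree almost everywhere with the linear
  combination test, so the dichotomy makes it strictly worse close to the null in the direction
  \<open>(n1, n2)\<close>. That direction need not meet \<open>H\<close>.\<close>

lemma admissible_within_dense:
  assumes \<alpha>: "0 < \<alpha>" "\<alpha> < 1" and w: "0 \<le> a2" "a1 + a2 < 1" and r: "-1 < r" "r < 1"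
    and U: "lc_eigen_decomp a1 a2 r U n1 n2"
    and dense: "\<And>\<theta>. \<exists>v. eventually (\<lambda>\<epsilon>. \<theta> + \<epsilon> *\<^sub>R v \<in> H) (at_right 0)"
  shows "admissible_within indep_normal_law H (squared_rotated_tests \<alpha> U) (lc_test \<alpha> a1 a2 r)"
proof -
  define a b c d where "a = U $ 1 $ 1" and "b = U $ 2 $ 1" and "c = U $ 1 $ 2" and "d = U $ 2 $ 2"
  note D = lc_eigen_decompD[OF U, folded a_def b_def c_def d_def]
  let ?lc = "lc_test \<alpha> a1 a2 r"
  have False if \<psi>: "\<psi> \<in> squared_rotated_tests \<alpha> U"
    and ge: "\<And>\<theta>. \<theta> \<in> H \<Longrightarrow> test_power indep_normal_law \<theta> ?lc \<le> test_power indep_normal_law \<theta> \<psi>"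
    and gt: "\<theta>0 \<in> H" "test_power indep_normal_law \<theta>0 ?lc < test_power indep_normal_law \<theta>0 \<psi>" for \<psi> \<theta>0
  proof -
    note L = squared_rotated_tests_local[OF \<alpha> w r U]
    have lc_test: "is_test ?lc" by (simp add: is_test_def lc_test_def[abs_def])
    have ge_all: "test_power indep_normal_law \<theta> ?lc \<le> test_power indep_normal_law \<theta> \<psi>" for \<theta>
    proof -
      obtain v where "eventually (\<lambda>\<epsilon>. \<theta> + \<epsilon> *\<^sub>R v \<in> H) (at_right 0)" using dense by blast
      then have "eventually (\<lambda>\<epsilon>. test_power indep_normal_law (\<theta> + \<epsilon> *\<^sub>R v) ?lc
          \<le> test_power indep_normal_law (\<theta> + \<epsilon> *\<^sub>R v) \<psi>) (at_right 0)"
        by eventually_elim (rule ge)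
      then show ?thesis
        using tendsto_le[OF _ tendsto_test_power[OF L(2)[OF \<psi>]] tendsto_test_power[OF lc_test]] by simp
    qed
    have "\<not> (AE z in indep_normal_law (0, 0). \<psi> z = ?lc z)"
      using test_power_cong_AE[of \<psi> ?lc \<theta>0] gt(2) L(2)[OF \<psi>] by (auto simp: is_test_def)
    then obtain e where e: "e > 0" "\<And>f t1 t2. 0 < f \<and> f < e \<and> (a * t1 + b * t2)\<^sup>2 = f * n1 \<and> (c * t1 + d * t2)\<^sup>2 = f * n2 \<Longrightarrow>
         test_power indep_normal_law (t1, t2) \<psi> < test_power indep_normal_law (t1, t2) ?lc"
      using L(3)[OF \<psi>] unfolding D(12,13) by blast
    define s1 s2 where "s1 = sqrt (e / 2 * n1)" and "s2 = sqrt (e / 2 * n2)"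
    \<comment> \<open>Applying \<open>U\<close> to \<open>(s1, s2)\<close> gives means whose rotated
      coordinates are exactly \<open>s1\<close> and \<open>s2\<close>; they realize the value
      \<open>e / 2\<close> of the scale.\<close>
    have "a * (a * s1 + c * s2) + b * (b * s1 + d * s2) = (a\<^sup>2 + b\<^sup>2) * s1 + (a * c + b * d) * s2"
      "c * (a * s1 + c * s2) + d * (b * s1 + d * s2) = (a * c + b * d) * s1 + (c\<^sup>2 + d\<^sup>2) * s2"
      by (simp_all add: power2_eq_square algebra_simps)
    then have "test_power indep_normal_law (a * s1 + c * s2, b * s1 + d * s2) \<psi>
        < test_power indep_normal_law (a * s1 + c * s2, b * s1 + d * s2) ?lc"
      using e(1) D(4-8) by (intro e(2)[of "e / 2"]) (simp add: s1_def s2_def)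
    with ge_all show False by (meson linorder_not_le)
  qed
  moreover have "?lc \<in> squared_rotated_tests \<alpha> U"
  proof -
    \<comment> \<open>The constant test supplies the member of the class that the dichotomy lemma
      takes as an argument.\<close>
    have "(\<lambda>_. \<alpha>) \<in> squared_rotated_tests \<alpha> U"
      using \<alpha> prob_space.prob_space[OF prob_space_indep_normal_law[of "(0, 0)"]]
      by (auto simp: squared_rotated_tests_def has_size_def test_power_def is_test_def intro!: exI[of _ "\<lambda>_. \<alpha>"])
    from squared_rotated_tests_local(1)[OF \<alpha> w r U this] show ?thesis .
  qed
  ultimately show ?thesis unfolding admissible_within_def by blast
qed

text \<open>The combination \<open>r t1 + s t2\<close> is the mean of the score statistic,
  \<open>D C / sqrt q\<close>, while \<open>t1 = D\<^sup>2 C / sqrt p\<close>. Their ratio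
  determines \<open>D\<close>, and then \<open>C\<close> follows. Only the two lines on which one of
  these means vanishes are left out.\<close>

lemma weak_mean_surj:
  assumes "0 < p" "0 < q" "\<bar>r\<bar> < 1" "t1 \<noteq> 0" "r * t1 + sqrt (1 - r\<^sup>2) * t2 \<noteq> 0"
  shows "\<exists>D C. (t1, t2) = weak_mean p q r D C"
proof -
  define s where "s = sqrt (1 - r\<^sup>2)"
  have s: "s > 0" using assms(3) by (simp add: s_def abs_square_less_1)
  define L where "L = r * t1 + s * t2"
  define D where "D = t1 * sqrt p / (L * sqrt q)"
  define C where "C = L * sqrt q / D"
  have nz: "L \<noteq> 0" "sqrt p \<noteq> 0" "sqrt q \<noteq> 0" using assms by (simp_all add: L_def s_def)
  then have D: "D \<noteq> 0" using assms by (simp add: D_def)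
  have 1: "D\<^sup>2 * C / sqrt p = t1"
    using nz D unfolding C_def by (simp add: power2_eq_square) (simp add: D_def)
  have "(D / sqrt q - r * D\<^sup>2 / sqrt p) * C / s = (D * C / sqrt q - r * (D\<^sup>2 * C / sqrt p)) / s"
    by (simp add: left_diff_distrib)
  also have "D * C / sqrt q = L" using nz D by (simp add: C_def)
  also have "(L - r * (D\<^sup>2 * C / sqrt p)) / s = t2" unfolding 1 L_def using s by simp
  finally show ?thesis using 1 unfolding weak_mean_def s_def by metis
qed

lemma eventually_add_nonzero_at_right: "eventually (\<lambda>\<epsilon>. x + \<epsilon> \<noteq> 0) (at_right (0 :: real))"
proof (cases "x < 0")
  case True
  then show ?thesis unfolding eventually_at_right_field by (intro exI[of _ "- x"]) auto
next
  case False
  then show ?thesis unfolding eventually_at_right_field by (intro exI[of _ 1]) auto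
qed

lemma weak_mean_dense:
  assumes "0 < p" "0 < q" "\<bar>r\<bar> < 1"
  shows "\<exists>v. eventually (\<lambda>\<epsilon>. \<theta> + \<epsilon> *\<^sub>R v \<in>
    {\<theta>. (fst \<theta> \<noteq> 0 \<or> snd \<theta> \<noteq> 0) \<and> (\<exists>D C. \<theta> = weak_mean p q r D C)}) (at_right 0)"
proof -
  obtain t1 t2 where \<theta>: "\<theta> = (t1, t2)" by fastforce
  define s where "s = sqrt (1 - r\<^sup>2)"
  have s: "s > 0" using assms(3) by (simp add: s_def abs_square_less_1)
  \<comment> \<open>The direction is chosen so that \<open>t1\<close> and
    \<open>r * t1 + s * t2\<close> both grow by exactly \<epsilon>, hence both are nonzero for small
    \<epsilon>.\<close>
  have "eventually (\<lambda>\<epsilon>. \<theta> + \<epsilon> *\<^sub>R (1, (1 - r) / s) \<in>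
    {\<theta>. (fst \<theta> \<noteq> 0 \<or> snd \<theta> \<noteq> 0) \<and> (\<exists>D C. \<theta> = weak_mean p q r D C)}) (at_right 0)"
    using eventually_add_nonzero_at_right[of t1] eventually_add_nonzero_at_right[of "r * t1 + s * t2"]
  proof eventually_elim
    case (elim \<epsilon>)
    have "r * (t1 + \<epsilon>) + s * (t2 + \<epsilon> * ((1 - r) / s)) = r * t1 + s * t2 + \<epsilon>"
      using s by (simp add: field_simps)
    with elim have "\<exists>D C. (t1 + \<epsilon>, t2 + \<epsilon> * ((1 - r) / s)) = weak_mean p q r D C"
      by (intro weak_mean_surj assms) (simp_all add: s_def)
    with elim show ?case by (simp add: \<theta>)
  qed
  then show ?thesis by blast
qed

text \<open>Changing the set of alternatives changes both what "nowhere worse" and what "better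
  somewhere" mean, so the two admissibility claims are not formal consequences of each
  other.\<close>

lemma weak_identification:
  assumes \<alpha>: "0 < \<alpha>" "\<alpha> < 1" and "abar < 1" and a: "(a1, a2) \<in> weight_set abar"
    and r: "-1 < r" "r < 1" and pq: "0 < p" "0 < q"
    and U: "lc_eigen_decomp a1 a2 r U n1 n2"
  shows "admissible_within indep_normal_law {\<theta>. fst \<theta> \<noteq> 0 \<or> snd \<theta> \<noteq> 0}
      (squared_rotated_tests \<alpha> U) (lc_test \<alpha> a1 a2 r)"
    and "admissible_within indep_normal_law
      {\<theta>. (fst \<theta> \<noteq> 0 \<or> snd \<theta> \<noteq> 0) \<and> (\<exists>D C. \<theta> = weak_mean p q r D C)}
      (squared_rotated_tests \<alpha> U) (lc_test \<alpha> a1 a2 r)"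
    and "\<forall>\<phi>\<in>squared_rotated_tests \<alpha> U. \<exists>bbar>0. \<forall>b t1 t2.
       0 < b \<and> b < bbar \<and>
       ((vector [t1, t2] v* U) $ 1)\<^sup>2 = b * n1 \<and> ((vector [t1, t2] v* U) $ 2)\<^sup>2 = b * n2 \<longrightarrow>
       test_power indep_normal_law (t1, t2) \<phi> \<le> test_power indep_normal_law (t1, t2) (lc_test \<alpha> a1 a2 r)"
proof -
  have w: "0 \<le> a2" "a1 + a2 < 1" using a \<open>abar < 1\<close> by (auto simp: weight_set_def)
  have r': "\<bar>r\<bar> < 1" using r by simp
  show "admissible_within indep_normal_law
      {\<theta>. (fst \<theta> \<noteq> 0 \<or> snd \<theta> \<noteq> 0) \<and> (\<exists>D C. \<theta> = weak_mean p q r D C)}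
      (squared_rotated_tests \<alpha> U) (lc_test \<alpha> a1 a2 r)"
    by (rule admissible_within_dense[OF \<alpha> w r U weak_mean_dense[OF pq r']])
  have "\<exists>v. eventually (\<lambda>\<epsilon>. \<theta> + \<epsilon> *\<^sub>R v \<in> {\<theta>. fst \<theta> \<noteq> 0 \<or> snd \<theta> \<noteq> 0}) (at_right 0)" for \<theta> :: "real \<times> real"
    using weak_mean_dense[OF pq r', of \<theta>] by (auto elim!: eventually_mono)
  then show "admissible_within indep_normal_law {\<theta>. fst \<theta> \<noteq> 0 \<or> snd \<theta> \<noteq> 0}
      (squared_rotated_tests \<alpha> U) (lc_test \<alpha> a1 a2 r)"
    by (rule admissible_within_dense[OF \<alpha> w r U])
  show "\<forall>\<phi>\<in>squared_rotated_tests \<alpha> U. \<exists>bbar>0. \<forall>b t1 t2.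
       0 < b \<and> b < bbar \<and>
       ((vector [t1, t2] v* U) $ 1)\<^sup>2 = b * n1 \<and> ((vector [t1, t2] v* U) $ 2)\<^sup>2 = b * n2 \<longrightarrow>
       test_power indep_normal_law (t1, t2) \<phi> \<le> test_power indep_normal_law (t1, t2) (lc_test \<alpha> a1 a2 r)"
  proof
    fix \<phi> assume \<phi>: "\<phi> \<in> squared_rotated_tests \<alpha> U"
    note L = squared_rotated_tests_local[OF \<alpha> w r U \<phi>]
    have "\<phi> \<in> borel_measurable borel" using L(2) by (simp add: is_test_def)
    note eq = test_power_cong_AE[OF this lc_test_measurable]
    from L(3) show "\<exists>bbar>0. \<forall>b t1 t2. 0 < b \<and> b < bbar \<and>
       ((vector [t1, t2] v* U) $ 1)\<^sup>2 = b * n1 \<and> ((vector [t1, t2] v* U) $ 2)\<^sup>2 = b * n2 \<longrightarrow>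
       test_power indep_normal_law (t1, t2) \<phi> \<le> test_power indep_normal_law (t1, t2) (lc_test \<alpha> a1 a2 r)"
    proof
      assume "AE z in indep_normal_law (0, 0). \<phi> z = lc_test \<alpha> a1 a2 r z"
      from eq[OF this] show ?thesis by (intro exI[of _ 1]) simp
    next
      assume "\<exists>bbar>0. \<forall>b t1 t2. 0 < b \<and> b < bbar \<and>
         ((vector [t1, t2] v* U) $ 1)\<^sup>2 = b * n1 \<and> ((vector [t1, t2] v* U) $ 2)\<^sup>2 = b * n2 \<longrightarrow>
         test_power indep_normal_law (t1, t2) \<phi> < test_power indep_normal_law (t1, t2) (lc_test \<alpha> a1 a2 r)"
      then show ?thesis by (elim ex_forward conj_forward all_forward imp_forward) (simp_all add: less_imp_le)
    qed
  qed
qed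

section \<open>Local alternatives under strong identification\<close>

text \<open>Integrate the nonnegative product in the sign hypothesis;
  \<open>\<kappa> \<ge> 0\<close> absorbs the difference in levels. The second part is uniqueness,
  as a nonnegative integrand with integral 0 vanishes almost everywhere. \<open>L\<close> may change
  sign, which the unbiased case exploits.\<close>

lemma neyman_pearson_compare:
  fixes \<phi> \<psi> L :: "real \<times> real \<Rightarrow> real"
  assumes "is_test \<phi>" "is_test \<psi>" and [measurable]: "L \<in> borel_measurable borel"
    and L: "\<And>z. \<bar>L z\<bar> \<le> C * exp (k * (\<bar>fst z\<bar> + \<bar>snd z\<bar>))"
    and \<kappa>: "0 \<le> \<kappa>" and sign: "\<And>z. 0 \<le> (\<phi> z - \<psi> z) * (L z - \<kappa>)"
    and level: "(\<integral>z. \<psi> z \<partial>indep_normal_law (0, 0)) \<le> (\<integral>z. \<phi> z \<partial>indep_normal_law (0, 0))"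
  shows "(\<integral>z. \<psi> z * L z \<partial>indep_normal_law (0, 0)) \<le> (\<integral>z. \<phi> z * L z \<partial>indep_normal_law (0, 0))"
    and "(\<integral>z. \<phi> z * L z \<partial>indep_normal_law (0, 0)) \<le> (\<integral>z. \<psi> z * L z \<partial>indep_normal_law (0, 0)) \<Longrightarrow>
      AE z in indep_normal_law (0, 0). (\<phi> z - \<psi> z) * (L z - \<kappa>) = 0"
proof -
  let ?N = "indep_normal_law (0, 0)"
  have int: "integrable ?N f" "integrable ?N (\<lambda>z. f z * L z)" if "is_test f" for f
  proof -
    have [measurable]: "f \<in> borel_measurable borel" and f: "0 \<le> f z" "f z \<le> 1" for z
      using that unfolding is_test_def by blast+
    show "integrable ?N f" by (rule integrable_exp_bound[where c=1 and k=0]) (use f in simp_all)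
    have "\<bar>f z * L z\<bar> \<le> C * exp (k * (\<bar>fst z\<bar> + \<bar>snd z\<bar>))" for z
      using mult_mono[of "\<bar>f z\<bar>" 1 "\<bar>L z\<bar>" "C * exp (k * (\<bar>fst z\<bar> + \<bar>snd z\<bar>))"] f[of z] L[of z]
      by (simp add: abs_mult)
    then show "integrable ?N (\<lambda>z. f z * L z)" by (intro integrable_exp_bound) simp_all
  qed
  have eq: "(\<phi> z - \<psi> z) * (L z - \<kappa>) = (\<phi> z * L z - \<psi> z * L z) - \<kappa> * (\<phi> z - \<psi> z)" for z
    by (simp add: algebra_simps)
  have I: "integrable ?N (\<lambda>z. (\<phi> z - \<psi> z) * (L z - \<kappa>))"
    unfolding eq using int[OF assms(1)] int[OF assms(2)] by (intro Bochner_Integration.integrable_diff integrable_mult_right)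
  have E: "(\<integral>z. (\<phi> z - \<psi> z) * (L z - \<kappa>) \<partial>?N) = (\<integral>z. \<phi> z * L z \<partial>?N) - (\<integral>z. \<psi> z * L z \<partial>?N)
      - \<kappa> * ((\<integral>z. \<phi> z \<partial>?N) - (\<integral>z. \<psi> z \<partial>?N))"
    unfolding eq using int[OF assms(1)] int[OF assms(2)] by simp
  have nonneg: "0 \<le> (\<integral>z. (\<phi> z - \<psi> z) * (L z - \<kappa>) \<partial>?N)" by (intro integral_nonneg_AE AE_I2 sign)
  have \<kappa>': "0 \<le> \<kappa> * ((\<integral>z. \<phi> z \<partial>?N) - (\<integral>z. \<psi> z \<partial>?N))" using \<kappa> level by simp
  show "(\<integral>z. \<psi> z * L z \<partial>?N) \<le> (\<integral>z. \<phi> z * L z \<partial>?N)" using nonneg \<kappa>' E by linarith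
  assume "(\<integral>z. \<phi> z * L z \<partial>?N) \<le> (\<integral>z. \<psi> z * L z \<partial>?N)"
  then have "(\<integral>z. (\<phi> z - \<psi> z) * (L z - \<kappa>) \<partial>?N) = 0" using nonneg \<kappa>' E by linarith
  then show "AE z in ?N. (\<phi> z - \<psi> z) * (L z - \<kappa>) = 0"
    using integral_nonneg_eq_0_iff_AE[OF I AE_I2[OF sign]] by simp
qed

text \<open>With first mean 0 the likelihood involves \<open>snd z\<close> only, and invariance
  under a joint sign change replaces the exponential by its even part.\<close>

lemma test_power_sign_invariant:
  fixes \<phi> :: "real \<times> real \<Rightarrow> real"
  assumes \<phi>: "is_test \<phi>" and inv: "\<And>z. \<phi> (- z) = \<phi> z"
  shows "test_power indep_normal_law (0, m) \<phi>
    = (\<integral>z. \<phi> z * (exp (- m\<^sup>2 / 2) * cosh (m * snd z)) \<partial>indep_normal_law (0, 0))"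
proof -
  let ?N = "indep_normal_law (0, 0)"
  have [measurable]: "\<phi> \<in> borel_measurable borel" and \<phi>01: "\<And>z. 0 \<le> \<phi> z" "\<And>z. \<phi> z \<le> 1"
    using \<phi> unfolding is_test_def by auto
  define I where "I a = (\<integral>z. \<phi> z * exp (a * snd z) \<partial>?N)" for a
  have int: "integrable ?N (\<lambda>z. \<phi> z * exp (a * snd z))" for a
    by (rule Bochner_Integration.integrable_bound[OF integrable_exp_linear[of 0 a]])
      (use \<phi>01 in \<open>auto simp: abs_mult mult_left_le_one_le\<close>)
  have "(\<integral>z. \<phi> (- fst z, - snd z) * exp (m * (- snd z)) \<partial>?N) = I m"
    using integral_indep_normal_orthogonal[of "-1" 0 0 "-1" "\<lambda>z. \<phi> z * exp (m * snd z)"] by (simp add: I_def)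
  moreover have "\<phi> (- fst z, - snd z) = \<phi> z" for z using inv[of z] by (cases z) simp
  ultimately have flip: "I (- m) = I m" by (simp add: I_def)
  have "(\<integral>z. \<phi> z * cosh (m * snd z) \<partial>?N) = (\<integral>z. (\<phi> z * exp (m * snd z) + \<phi> z * exp (- m * snd z)) / 2 \<partial>?N)"
    by (simp add: cosh_def distrib_left add_divide_distrib)
  also have "\<dots> = (I m + I (- m)) / 2"
    unfolding I_def by (subst integral_divide_zero, subst Bochner_Integration.integral_add[OF int int]) simp
  finally have *: "(\<integral>z. \<phi> z * cosh (m * snd z) \<partial>?N) = I m" unfolding flip by simp
  have "exp (l - q / 2) = exp (- q / 2) * exp l" for l q :: real by (simp add: exp_add[symmetric])
  then have "test_power indep_normal_law (0, m) \<phi> = exp (- m\<^sup>2 / 2) * I m"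
    unfolding test_power_indep_normal[OF \<open>\<phi> \<in> _\<close>] I_def
    by (subst integral_mult_right_zero[symmetric]) (simp add: mult.left_commute)
  also have "\<dots> = (\<integral>z. exp (- m\<^sup>2 / 2) * (\<phi> z * cosh (m * snd z)) \<partial>?N)"
    unfolding *[symmetric] by simp
  finally show ?thesis by (simp add: mult.left_commute)
qed

lemma test_power_null: "test_power indep_normal_law (0, 0) \<phi> = (\<integral>z. \<phi> z \<partial>indep_normal_law (0, 0))"
  by (simp add: test_power_def)

section \<open>Monotonicity and convexity of cosh and exp\<close>

lemma cosh_mono_abs:
  fixes x y :: real
  shows "\<bar>x\<bar> \<le> \<bar>y\<bar> \<Longrightarrow> cosh x \<le> cosh y" "\<bar>x\<bar> < \<bar>y\<bar> \<Longrightarrow> cosh x < cosh y"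
  using cosh_real_nonneg_le_iff[of "\<bar>x\<bar>" "\<bar>y\<bar>"] cosh_real_nonneg_less_iff[of "\<bar>x\<bar>" "\<bar>y\<bar>"] by simp_all

lemma cosh_le_exp_abs: "cosh (x :: real) \<le> exp \<bar>x\<bar>"
proof -
  have "exp (- \<bar>x\<bar>) \<le> exp \<bar>x\<bar>" by simp
  then have "cosh \<bar>x\<bar> \<le> exp \<bar>x\<bar>" by (simp add: cosh_def)
  then show ?thesis by simp
qed

text \<open>The chord of \<open>exp (m y)\<close> through \<open>y = \<plusminus> d\<close>.\<close>

lemma exp_chord:
  fixes m d y :: real
  assumes d: "d > 0"
  defines "l \<equiv> cosh (m * d) + y * (sinh (m * d) / d)"
  shows "\<bar>y\<bar> \<le> d \<Longrightarrow> exp (m * y) \<le> l" "d \<le> \<bar>y\<bar> \<Longrightarrow> l \<le> exp (m * y)"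
proof -
  have conv: "exp ((1 - t) * u + t * v) \<le> (1 - t) * exp u + t * exp v" if "0 \<le> t" "t \<le> 1" for t u v :: real
    using convex_onD[OF exp_convex that, of u v] by simp
  have l: "l = ((d - y) * exp (- (m * d)) + (d + y) * exp (m * d)) / (2 * d)"
    unfolding l_def cosh_def sinh_def using d by (simp add: field_simps)
  show "exp (m * y) \<le> l" if "\<bar>y\<bar> \<le> d"
  proof -
    define t where "t = (d + y) / (2 * d)"
    have t: "0 \<le> t" "t \<le> 1" "1 - t = (d - y) / (2 * d)" using that d by (auto simp: t_def field_simps)
    have "(1 - t) * (- (m * d)) + t * (m * d) = m * y" unfolding t(3) t_def using d by (simp add: field_simps)
    then have "exp (m * y) \<le> (1 - t) * exp (- (m * d)) + t * exp (m * d)" using conv[OF t(1,2)] by metis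
    also have "\<dots> = l" unfolding l t(3) t_def using d by (simp add: field_simps)
    finally show ?thesis .
  qed
  have right: "((d - y) * exp (- (m * d)) + (d + y) * exp (m * d)) / (2 * d) \<le> exp (m * y)" if "d \<le> y" for m y
  proof -
    \<comment> \<open>Outside the interval the roles change: \<open>d\<close> is the convex
      combination of \<open>-d\<close> and \<open>y\<close> with this weight, so convexity bounds
      the exponential at \<open>y\<close> from below.\<close>
    define t where "t = 2 * d / (d + y)"
    have t: "0 \<le> t" "t \<le> 1" and tt: "t * (d + y) = 2 * d" using that d by (auto simp: t_def field_simps)
    have "(1 - t) * (- (m * d)) + t * (m * y) = m * (t * (d + y)) - m * d" by (simp add: algebra_simps)
    also have "\<dots> = m * d" unfolding tt by simp
    finally have "exp (m * d) \<le> (1 - t) * exp (- (m * d)) + t * exp (m * y)" using conv[OF t(1,2)] by metis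
    then have "(d + y) * exp (m * d) \<le> (d + y) * ((1 - t) * exp (- (m * d)) + t * exp (m * y))"
      using d that by (intro mult_left_mono) simp_all
    also have "\<dots> = (d + y - t * (d + y)) * exp (- (m * d)) + (t * (d + y)) * exp (m * y)"
      by (simp add: algebra_simps)
    also have "\<dots> = (y - d) * exp (- (m * d)) + 2 * d * exp (m * y)" unfolding tt by simp
    finally show ?thesis using d by (simp add: field_simps)
  qed
  show "l \<le> exp (m * y)" if "d \<le> \<bar>y\<bar>"
  proof (cases "y \<ge> 0")
    case True
    then show ?thesis unfolding l using right[of y m] that by simp
  next
    case False
    \<comment> \<open>Reflecting \<open>y\<close> together with \<open>m\<close> leaves the chord
      and \<open>m * y\<close> unchanged.\<close>
    then have "((d - (- y)) * exp (- ((- m) * d)) + (d + (- y)) * exp ((- m) * d)) / (2 * d) \<le> exp ((- m) * (- y))"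
      using that by (intro right) simp
    then show ?thesis unfolding l by (simp add: add.commute)
  qed
qed

text \<open>The power at means \<open>(0, m)\<close> is minimal at \<open>m = 0\<close>, where its
  derivative is this moment. One-sided difference quotients in the two directions
  \<open>e = 1\<close> and \<open>e = -1\<close> give the two inequalities.\<close>

lemma unbiased_first_moment:
  fixes \<psi> :: "real \<times> real \<Rightarrow> real"
  assumes \<psi>: "is_test \<psi>"
    and ge: "\<And>m. m \<noteq> 0 \<Longrightarrow> test_power indep_normal_law (0, 0) \<psi> \<le> test_power indep_normal_law (0, m) \<psi>"
  shows "(\<integral>z. \<psi> z * snd z \<partial>indep_normal_law (0, 0)) = 0"
proof -
  let ?N = "indep_normal_law (0, 0)"
  have M [measurable]: "\<psi> \<in> borel_measurable borel" and \<psi>01: "\<And>z. 0 \<le> \<psi> z" "\<And>z. \<psi> z \<le> 1"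
    using \<psi> unfolding is_test_def by auto
  have int: "integrable ?N \<psi>" by (rule integrable_exp_bound[where c=1 and k=0]) (use \<psi>01 in simp_all)
  have "0 \<le> (\<integral>z. \<psi> z * (e * snd z) \<partial>?N)" if e: "e\<^sup>2 = 1" for e :: real
  proof (rule tendsto_lowerbound)
    have ae: "\<bar>e\<bar> = 1" using e by (simp add: abs_square_eq_1)
    show "((\<lambda>b. \<integral>z. \<psi> z * ((exp (b * (e * snd z) - b\<^sup>2 / 2) - 1) / b) \<partial>?N) \<longlongrightarrow>
        (\<integral>z. \<psi> z * (e * snd z) \<partial>?N)) (at_right 0)"
    \<comment> \<open>The envelope rests on \<open>\<bar>exp w - 1\<bar> \<le> \<bar>w\<bar> * exp
      \<bar>w\<bar>\<close>, whose first factor yields \<open>b\<close>; its constant and rate come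
      from squaring \<open>exp (\<bar>snd z\<bar> + 1)\<close>.\<close>
    proof (rule tendsto_integral_indep_normal[where C="exp 2" and k=2])
      have "((\<lambda>b. (exp (b * c - b\<^sup>2 / 2) - 1) / b) \<longlongrightarrow> c) (at_right 0)" for c :: real
      proof -
        have "((\<lambda>b. exp (b * c - b\<^sup>2 / 2)) has_real_derivative c) (at 0)"
          by (auto intro!: derivative_eq_intros)
        then have "((\<lambda>b. (exp (b * c - b\<^sup>2 / 2) - 1) / b) \<longlongrightarrow> c) (at 0)"
          by (simp add: has_field_derivative_iff)
        then show ?thesis by (rule tendsto_within_subset) simp
      qed
      then show "((\<lambda>b. \<psi> z * ((exp (b * (e * snd z) - b\<^sup>2 / 2) - 1) / b)) \<longlongrightarrow> \<psi> z * (e * snd z)) (at_right 0)" for z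
        by (intro tendsto_mult tendsto_const)
      show "\<bar>\<psi> z * ((exp (b * (e * snd z) - b\<^sup>2 / 2) - 1) / b)\<bar> \<le> exp 2 * exp (2 * (\<bar>fst z\<bar> + \<bar>snd z\<bar>))"
        if b: "0 < b" "b \<le> 1" for b z
      proof -
        define w where "w = b * (e * snd z) - b\<^sup>2 / 2"
        have "\<bar>w\<bar> \<le> \<bar>b * (e * snd z)\<bar> + b\<^sup>2 / 2"
          using abs_triangle_ineq4[of "b * (e * snd z)" "b\<^sup>2 / 2"] by (simp add: w_def)
        also have "\<dots> \<le> b * \<bar>snd z\<bar> + b * 1"
          using b ae mult_left_mono[of b 1 b] by (intro add_mono) (simp_all add: abs_mult power2_eq_square)
        finally have w: "\<bar>w\<bar> \<le> b * (\<bar>snd z\<bar> + 1)" by (simp add: distrib_left)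
        also have "\<dots> \<le> \<bar>snd z\<bar> + 1" using b by (simp add: mult_left_le_one_le)
        finally have w1: "\<bar>w\<bar> \<le> \<bar>snd z\<bar> + 1" .
        have "exp w - 1 \<le> \<bar>w\<bar> * exp \<bar>w\<bar>"
        proof -
          have "1 - exp (- w) \<le> w" using exp_ge_add_one_self[of "- w"] by simp
          then have "exp w * (1 - exp (- w)) \<le> exp w * w" by (intro mult_left_mono) simp_all
          also have "exp w * w \<le> exp \<bar>w\<bar> * \<bar>w\<bar>" by (intro order_trans[OF mult_left_mono[OF abs_ge_self] mult_right_mono]) simp_all
          finally show ?thesis by (simp add: right_diff_distrib exp_add[symmetric] mult.commute)
        qed
        moreover have "1 - exp w \<le> \<bar>w\<bar> * exp \<bar>w\<bar>"
        proof -
          have "1 - exp w \<le> \<bar>w\<bar> * 1" using exp_ge_add_one_self[of w] by linarith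
          also have "\<dots> \<le> \<bar>w\<bar> * exp \<bar>w\<bar>" by (intro mult_left_mono) simp_all
          finally show ?thesis .
        qed
        ultimately have "\<bar>exp w - 1\<bar> \<le> \<bar>w\<bar> * exp \<bar>w\<bar>" by (simp add: abs_le_iff)
        also have "\<dots> \<le> (b * (\<bar>snd z\<bar> + 1)) * exp (\<bar>snd z\<bar> + 1)"
          using w w1 b by (intro mult_mono) simp_all
        also have "\<dots> \<le> (b * exp (\<bar>snd z\<bar> + 1)) * exp (\<bar>snd z\<bar> + 1)"
          using b exp_ge_add_one_self[of "\<bar>snd z\<bar> + 1"] by (intro mult_right_mono mult_left_mono) linarith+
        also have "\<dots> = b * (exp 2 * exp (2 * \<bar>snd z\<bar>))" by (simp add: exp_add[symmetric])
        also have "\<dots> \<le> b * (exp 2 * exp (2 * (\<bar>fst z\<bar> + \<bar>snd z\<bar>)))" using b by simp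
        finally have "\<bar>(exp w - 1) / b\<bar> \<le> exp 2 * exp (2 * (\<bar>fst z\<bar> + \<bar>snd z\<bar>))"
          using b by (simp add: divide_le_eq mult.commute)
        then have "\<bar>\<psi> z\<bar> * \<bar>(exp w - 1) / b\<bar> \<le> 1 * (exp 2 * exp (2 * (\<bar>fst z\<bar> + \<bar>snd z\<bar>)))"
          using \<psi>01[of z] by (intro mult_mono) simp_all
        then show ?thesis by (simp add: w_def abs_mult)
      qed
    qed simp_all
    have "0 \<le> (\<integral>z. \<psi> z * ((exp (b * (e * snd z) - b\<^sup>2 / 2) - 1) / b) \<partial>?N)" if b: "0 < b" for b
    proof -
      have intb: "integrable ?N (\<lambda>z. \<psi> z * exp (b * (e * snd z) - b\<^sup>2 / 2))"
      proof (rule integrable_exp_bound[where c=1 and k=b])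
        fix z :: "real \<times> real"
        have "b * (e * snd z) \<le> b * (\<bar>fst z\<bar> + \<bar>snd z\<bar>)"
          using b ae by (intro mult_left_mono) (auto intro: order_trans[OF abs_ge_self] simp: abs_mult)
        then have "b * (e * snd z) - b\<^sup>2 / 2 \<le> b * (\<bar>fst z\<bar> + \<bar>snd z\<bar>)" by (simp add: diff_le_eq add_increasing2)
        then have "\<psi> z * exp (b * (e * snd z) - b\<^sup>2 / 2) \<le> 1 * exp (b * (\<bar>fst z\<bar> + \<bar>snd z\<bar>))"
          using \<psi>01 by (intro mult_mono) simp_all
        then show "\<bar>\<psi> z * exp (b * (e * snd z) - b\<^sup>2 / 2)\<bar> \<le> 1 * exp (b * (\<bar>fst z\<bar> + \<bar>snd z\<bar>))"
          using \<psi>01 by (simp add: abs_mult)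
      qed simp
      have "b * e \<noteq> 0" using b e by auto
      from ge[OF this] have "(\<integral>z. \<psi> z \<partial>?N) \<le> (\<integral>z. \<psi> z * exp (b * (e * snd z) - b\<^sup>2 / 2) \<partial>?N)"
        unfolding test_power_null unfolding test_power_indep_normal[OF M]
        by (simp add: power_mult_distrib e mult.assoc)
      then have "0 \<le> (\<integral>z. (\<psi> z * exp (b * (e * snd z) - b\<^sup>2 / 2) - \<psi> z) / b \<partial>?N)"
        using b int intb by simp
      then show ?thesis by (simp add: right_diff_distrib diff_divide_distrib)
    qed
    then show "eventually (\<lambda>b. 0 \<le> (\<integral>z. \<psi> z * ((exp (b * (e * snd z) - b\<^sup>2 / 2) - 1) / b) \<partial>?N)) (at_right 0)"
      by (auto simp: eventually_at_filter)
  qed simp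
  from this[of 1] this[of "-1"] show ?thesis by simp
qed

text \<open>With a nonpositive critical value the test would always reject and have size 1.\<close>

lemma lc_crit_pos:
  assumes "0 < \<alpha>" "\<alpha> < 1" "0 \<le> a1" "0 \<le> a2" "a1 + a2 < 1" "-1 < r" "r < 1"
  shows "0 < lc_crit \<alpha> a1 a2 r"
proof (rule ccontr)
  interpret prob_space "indep_normal_law (0, 0)" by (rule prob_space_indep_normal_law)
  assume "\<not> ?thesis"
  moreover have "0 \<le> lc_stat a1 a2 r z" for z using assms unfolding lc_stat_def by simp
  ultimately have "lc_crit \<alpha> a1 a2 r \<le> lc_stat a1 a2 r z" for z by (meson linorder_not_le order_trans less_imp_le)
  then have "lc_test \<alpha> a1 a2 r = (\<lambda>_. 1)" unfolding lc_test_def by auto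
  then have "test_power indep_normal_law (0, 0) (lc_test \<alpha> a1 a2 r) = 1"
    using prob_space by (simp add: test_power_def)
  with test_power_lc_test_null[of \<alpha> a2 a1 r] assms show False by simp
qed

text \<open>If \<open>r = 0\<close>, the score statistic and the modified one coincide, so
  \<open>a2\<close> only splits one weight into two.\<close>

lemma lc_stat_weightless:
  assumes "a1 = 0" "a2 * r = 0"
  shows "lc_stat a1 a2 r z = (snd z)\<^sup>2"
  using assms by (auto simp: lc_stat_def algebra_simps)

lemma open_AE_lborel_empty:
  fixes S :: "'a::euclidean_space set"
  assumes "open S" "AE x in lborel. x \<notin> S"
  shows "S = {}"
proof (rule ccontr)
  assume "S \<noteq> {}"
  then have "\<not> negligible S" using open_not_negligible assms(1) by blast
  moreover have "S \<in> null_sets lborel"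
    using assms AE_iff_null_sets[of S lborel] by simp
  ultimately show False by (simp add: negligible_iff_null_sets null_sets_completionI)
qed

section \<open>The local experiment in standardized coordinates\<close>

lemma local_lc_test_standardized:
  assumes "-1 < r" "r < 1"
  shows "local_lc_test \<alpha> a1 a2 r (fst z, r * fst z + sqrt (1 - r\<^sup>2) * snd z) = lc_test \<alpha> a1 a2 r z"
proof -
  have "r\<^sup>2 < 1" using assms by (simp add: abs_square_less_1 abs_if)
  then show ?thesis by (simp add: local_lc_test_def)
qed

lemma local_lc_test_measurable [measurable]: "local_lc_test \<alpha> a1 a2 r \<in> borel_measurable borel"
  unfolding local_lc_test_def by measurable

lemma is_test_local_lc_test: "is_test (local_lc_test \<alpha> a1 a2 r)"
  unfolding is_test_def using local_lc_test_measurable by (simp add: local_lc_test_def lc_test_def)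

lemma is_test_lc_test: "is_test (lc_test \<alpha> a1 a2 r)"
  unfolding is_test_def using lc_test_measurable by (simp add: lc_test_def)

lemma test_power_local_lc_test:
  assumes "-1 < r" "r < 1"
  shows "test_power (local_law r) \<theta> (local_lc_test \<alpha> a1 a2 r)
    = test_power indep_normal_law (0, \<theta> / sqrt (1 - r\<^sup>2)) (lc_test \<alpha> a1 a2 r)"
  by (simp add: test_power_local_law[OF assms] local_lc_test_standardized[OF assms])

lemma sign_invariant_local_lc_test: "sign_invariant (local_lc_test \<alpha> a1 a2 r)"
proof -
  have "lc_stat a1 a2 r (- x, - y) = lc_stat a1 a2 r (x, y)" for x y
  proof -
    have "r * - x + sqrt (1 - r\<^sup>2) * - y = - (r * x + sqrt (1 - r\<^sup>2) * y)" by simp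
    then show ?thesis unfolding lc_stat_def fst_conv snd_conv by (simp only: power2_minus)
  qed
  moreover have "(- y - r * - x) / s = - ((y - r * x) / s)" for x y s :: real
    by (simp add: minus_divide_left)
  ultimately show ?thesis
    unfolding sign_invariant_def local_lc_test_def lc_test_def fst_conv snd_conv by (simp only: simp_thms)
qed

lemma standardized_test:
  fixes \<psi> :: "real \<times> real \<Rightarrow> real"
  assumes "is_test \<psi>"
  shows "is_test (\<lambda>z. \<psi> (fst z, r * fst z + s * snd z))"
proof -
  have [measurable]: "\<psi> \<in> borel_measurable borel" and "\<And>z. 0 \<le> \<psi> z" "\<And>z. \<psi> z \<le> 1"
    using assms unfolding is_test_def by blast+
  moreover have "(\<lambda>z. \<psi> (fst z, r * fst z + s * snd z)) \<in> borel_measurable borel" by measurable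
  ultimately show ?thesis unfolding is_test_def by blast
qed

text \<open>Here the test rejects for large \<open>\<bar>snd z\<bar>\<close>, equivalently for large
  averaged likelihood, since cosh increases with the modulus. The cutoff is the likelihood at the
  boundary point \<open>(0, sqrt c)\<close>, \<open>c\<close> the critical value. The equality case
  is kept for the converse direction.\<close>

lemma lc_test_le_invariant:
  fixes \<psi> :: "real \<times> real \<Rightarrow> real"
  assumes \<alpha>: "0 < \<alpha>" "\<alpha> < 1" and r: "-1 < r" "r < 1" and w: "a1 = 0" "a2 * r = 0" "0 \<le> a2" "a2 < 1"
    and \<psi>: "is_test \<psi>" and inv: "\<And>z. \<psi> (- z) = \<psi> z"
    and level: "test_power indep_normal_law (0, 0) \<psi> \<le> \<alpha>"
  defines "L \<equiv> \<lambda>m z :: real \<times> real. exp (- m\<^sup>2 / 2) * cosh (m * snd z)"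
  shows "test_power indep_normal_law (0, m) \<psi> \<le> test_power indep_normal_law (0, m) (lc_test \<alpha> a1 a2 r)"
    and "test_power indep_normal_law (0, m) (lc_test \<alpha> a1 a2 r) \<le> test_power indep_normal_law (0, m) \<psi> \<Longrightarrow>
      AE z in indep_normal_law (0, 0). (lc_test \<alpha> a1 a2 r z - \<psi> z) * (L m z - L m (0, sqrt (lc_crit \<alpha> a1 a2 r))) = 0"
proof -
  let ?\<phi> = "lc_test \<alpha> a1 a2 r" and ?c = "lc_crit \<alpha> a1 a2 r"
  have c: "0 < ?c" by (rule lc_crit_pos) (use \<alpha> r w in auto)
  have stat: "lc_stat a1 a2 r z = (snd z)\<^sup>2" for z by (rule lc_stat_weightless[OF w(1,2)])
  have \<phi>: "is_test ?\<phi>" by (rule is_test_lc_test)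
  have inv\<phi>: "?\<phi> (- z) = ?\<phi> z" for z by (simp add: lc_test_def stat)
  have LM: "L m \<in> borel_measurable borel" unfolding L_def by measurable
  have Lb: "\<bar>L m z\<bar> \<le> 1 * exp (\<bar>m\<bar> * (\<bar>fst z\<bar> + \<bar>snd z\<bar>))" for z
  proof -
    have "cosh (m * snd z) \<le> exp (\<bar>m\<bar> * \<bar>snd z\<bar>)" using cosh_le_exp_abs[of "m * snd z"] by (simp add: abs_mult)
    also have "\<dots> \<le> exp (\<bar>m\<bar> * (\<bar>fst z\<bar> + \<bar>snd z\<bar>))" by (simp add: mult_left_mono)
    finally have "exp (- m\<^sup>2 / 2) * cosh (m * snd z) \<le> 1 * exp (\<bar>m\<bar> * (\<bar>fst z\<bar> + \<bar>snd z\<bar>))"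
      by (intro mult_mono) simp_all
    then show ?thesis by (simp add: L_def abs_mult)
  qed
  have sign: "0 \<le> (?\<phi> z - \<psi> z) * (L m z - L m (0, sqrt ?c))" for z
  proof (cases "?c \<le> (snd z)\<^sup>2")
    case True
    then have "sqrt ?c \<le> \<bar>snd z\<bar>" by (metis real_sqrt_abs real_sqrt_le_iff)
    then have "cosh (m * sqrt ?c) \<le> cosh (m * snd z)"
      using c by (intro cosh_mono_abs) (simp add: abs_mult mult_left_mono)
    then have "L m (0, sqrt ?c) \<le> L m z" by (simp add: L_def)
    moreover have "?\<phi> z = 1" using True by (simp add: lc_test_def stat)
    moreover have "\<psi> z \<le> 1" using \<psi> unfolding is_test_def by blast
    ultimately show ?thesis by simp
  next
    case False
    then have "(snd z)\<^sup>2 \<le> ?c" by simp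
    then have "\<bar>snd z\<bar> \<le> sqrt ?c" by (metis real_sqrt_abs real_sqrt_le_iff)
    then have "cosh (m * snd z) \<le> cosh (m * sqrt ?c)"
      using c by (intro cosh_mono_abs) (simp add: abs_mult mult_left_mono)
    then have "L m z \<le> L m (0, sqrt ?c)" by (simp add: L_def)
    moreover have "?\<phi> z = 0" using False by (simp add: lc_test_def stat)
    moreover have "0 \<le> \<psi> z" using \<psi> unfolding is_test_def by blast
    ultimately show ?thesis by (simp add: mult_nonneg_nonpos)
  qed
  have "test_power indep_normal_law (0, 0) ?\<phi> = \<alpha>"
    by (rule test_power_lc_test_null) (use \<alpha> r w in auto)
  then have le: "(\<integral>z. \<psi> z \<partial>indep_normal_law (0, 0)) \<le> (\<integral>z. ?\<phi> z \<partial>indep_normal_law (0, 0))"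
    using level by (simp add: test_power_null)
  have "0 \<le> L m (0, sqrt ?c)" by (simp add: L_def)
  note np = neyman_pearson_compare[OF \<phi> \<psi> LM Lb this sign le]
  show "test_power indep_normal_law (0, m) \<psi> \<le> test_power indep_normal_law (0, m) ?\<phi>"
    using np(1) unfolding test_power_sign_invariant[OF \<psi> inv] test_power_sign_invariant[OF \<phi> inv\<phi>] L_def .
  show "AE z in indep_normal_law (0, 0). (?\<phi> z - \<psi> z) * (L m z - L m (0, sqrt ?c)) = 0"
    if "test_power indep_normal_law (0, m) ?\<phi> \<le> test_power indep_normal_law (0, m) \<psi>"
    using np(2) that unfolding test_power_sign_invariant[OF \<psi> inv] test_power_sign_invariant[OF \<phi> inv\<phi>] L_def .
qed

text \<open>Unbiasedness makes the first moment in \<open>snd z\<close> vanish, so a multiple of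
  \<open>snd z\<close> can be subtracted from the likelihood without changing either power. With the
  slope of the chord over the acceptance interval, the modified likelihood lies above its cutoff
  outside that interval and below it inside.\<close>

lemma lc_test_le_unbiased:
  fixes \<psi> :: "real \<times> real \<Rightarrow> real"
  assumes \<alpha>: "0 < \<alpha>" "\<alpha> < 1" and r: "-1 < r" "r < 1" and w: "a1 = 0" "a2 * r = 0" "0 \<le> a2" "a2 < 1"
    and \<psi>: "is_test \<psi>" and level: "test_power indep_normal_law (0, 0) \<psi> \<le> \<alpha>"
    and unbiased: "\<And>m. m \<noteq> 0 \<Longrightarrow> \<alpha> \<le> test_power indep_normal_law (0, m) \<psi>"
  shows "test_power indep_normal_law (0, m) \<psi> \<le> test_power indep_normal_law (0, m) (lc_test \<alpha> a1 a2 r)"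
proof -
  let ?\<phi> = "lc_test \<alpha> a1 a2 r" and ?N = "indep_normal_law (0, 0)"
  define e where "e = sqrt (lc_crit \<alpha> a1 a2 r)"
  have c: "0 < lc_crit \<alpha> a1 a2 r" by (rule lc_crit_pos) (use \<alpha> r w in auto)
  then have e: "0 < e" by (simp add: e_def)
  have stat: "lc_stat a1 a2 r z = (snd z)\<^sup>2" for z by (rule lc_stat_weightless[OF w(1,2)])
  have phi: "?\<phi> z = of_bool (e \<le> \<bar>snd z\<bar>)" for z
  proof -
    have "lc_crit \<alpha> a1 a2 r \<le> (snd z)\<^sup>2 \<longleftrightarrow> e \<le> \<bar>snd z\<bar>"
      unfolding e_def by (metis real_sqrt_abs real_sqrt_le_iff)
    then show ?thesis by (simp add: lc_test_def stat)
  qed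
  have \<phi>: "is_test ?\<phi>" by (rule is_test_lc_test)
  have inv\<phi>: "?\<phi> (- z) = ?\<phi> z" for z by (simp add: lc_test_def stat)
  have size: "test_power indep_normal_law (0, 0) ?\<phi> = \<alpha>"
    by (rule test_power_lc_test_null) (use \<alpha> r w in auto)
  define E where "E = exp (- m\<^sup>2 / 2)"
  \<comment> \<open>The slope of the chord, scaled by the normalizing factor
    \<open>E\<close>.\<close>
  define k where "k = E * (sinh (m * e) / e)"
  define K where "K z = E * exp (m * snd z)" for z :: "real \<times> real"
  define L where "L z = K z - k * snd z" for z
  have [measurable]: "K \<in> borel_measurable borel" unfolding K_def by measurable
  have LM [measurable]: "L \<in> borel_measurable borel" unfolding L_def by measurable
  have E: "0 \<le> E" "E \<le> 1" by (simp_all add: E_def)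
  have Kb: "\<bar>K z\<bar> \<le> 1 * exp (\<bar>m\<bar> * (\<bar>fst z\<bar> + \<bar>snd z\<bar>))" for z
  proof -
    have "m * snd z \<le> \<bar>m\<bar> * \<bar>snd z\<bar>" by (metis abs_ge_self abs_mult)
    also have "\<dots> \<le> \<bar>m\<bar> * (\<bar>fst z\<bar> + \<bar>snd z\<bar>)" by (simp add: mult_left_mono)
    finally have "E * exp (m * snd z) \<le> 1 * exp (\<bar>m\<bar> * (\<bar>fst z\<bar> + \<bar>snd z\<bar>))"
      using E by (intro mult_mono) simp_all
    then show ?thesis using E by (simp add: K_def abs_mult)
  qed
  have snd_b: "\<bar>snd z\<bar> \<le> 1 * exp (1 * (\<bar>fst z\<bar> + \<bar>snd z\<bar>))" for z :: "real \<times> real"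
    using exp_ge_add_one_self[of "\<bar>fst z\<bar> + \<bar>snd z\<bar>"] abs_ge_zero[of "fst z"] unfolding mult_1 by linarith
  have Lb: "\<bar>L z\<bar> \<le> (1 + \<bar>k\<bar>) * exp ((\<bar>m\<bar> + 1) * (\<bar>fst z\<bar> + \<bar>snd z\<bar>))" for z
  proof -
    define u where "u = \<bar>fst z\<bar> + \<bar>snd z\<bar>"
    have u: "0 \<le> u" by (simp add: u_def)
    have "\<bar>L z\<bar> \<le> \<bar>K z\<bar> + \<bar>k\<bar> * \<bar>snd z\<bar>"
      unfolding L_def using abs_triangle_ineq4[of "K z" "k * snd z"] by (simp add: abs_mult)
    also have "\<dots> \<le> 1 * exp (\<bar>m\<bar> * u) + \<bar>k\<bar> * (1 * exp (1 * u))"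
      unfolding u_def by (intro add_mono Kb mult_left_mono snd_b) simp
    also have "\<dots> \<le> 1 * exp ((\<bar>m\<bar> + 1) * u) + \<bar>k\<bar> * (1 * exp ((\<bar>m\<bar> + 1) * u))"
      using u by (intro add_mono mult_left_mono) (simp_all add: distrib_right)
    finally show ?thesis unfolding u_def[symmetric] by (simp add: distrib_right)
  qed
  have moment: "(\<integral>z. f z * snd z \<partial>?N) = 0 \<and> (\<integral>z. f z * L z \<partial>?N) = test_power indep_normal_law (0, m) f"
    if f: "is_test f" and ge: "\<And>m. m \<noteq> 0 \<Longrightarrow> test_power indep_normal_law (0, 0) f \<le> test_power indep_normal_law (0, m) f" for f
  proof -
    have fM [measurable]: "f \<in> borel_measurable borel" and f01: "\<And>z. 0 \<le> f z" "\<And>z. f z \<le> 1"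
      using f unfolding is_test_def by blast+
    have bd: "\<bar>f z * g\<bar> \<le> u" if "\<bar>g\<bar> \<le> u" for z g u
      using mult_mono[of "\<bar>f z\<bar>" 1 "\<bar>g\<bar>" u] f01[of z] that by (simp add: abs_mult)
    have 1: "integrable ?N (\<lambda>z. f z * K z)" by (rule integrable_exp_bound[OF _ bd[OF Kb]]) simp
    have 2: "integrable ?N (\<lambda>z. f z * snd z)" by (rule integrable_exp_bound[OF _ bd[OF snd_b]]) simp
    have 3: "(\<integral>z. f z * snd z \<partial>?N) = 0" by (rule unbiased_first_moment[OF f ge])
    have "(\<integral>z. f z * L z \<partial>?N) = (\<integral>z. f z * K z - k * (f z * snd z) \<partial>?N)"
      by (simp add: L_def algebra_simps)
    also have "\<dots> = (\<integral>z. f z * K z \<partial>?N) - k * (\<integral>z. f z * snd z \<partial>?N)"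
      using 1 2 by simp
    also have "(\<integral>z. f z * K z \<partial>?N) = test_power indep_normal_law (0, m) f"
      unfolding test_power_indep_normal[OF fM] K_def E_def by (simp add: exp_add[symmetric])
    finally show ?thesis using 3 by simp
  qed
  have M\<psi>: "(\<integral>z. \<psi> z * L z \<partial>?N) = test_power indep_normal_law (0, m) \<psi>"
    by (rule moment[OF \<psi>, THEN conjunct2]) (use level unbiased in force)
  \<comment> \<open>Beating the constant test shows that the linear combination test is itself
    unbiased, so that its first moment vanishes too.\<close>
  have const: "is_test (\<lambda>_. \<alpha>)" using \<alpha> by (simp add: is_test_def)
  have power_const: "test_power indep_normal_law \<theta> (\<lambda>_. \<alpha>) = \<alpha>" for \<theta>
    using prob_space.prob_space[OF prob_space_indep_normal_law[of \<theta>]] by (simp add: test_power_def)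
  have M\<phi>: "(\<integral>z. ?\<phi> z * L z \<partial>?N) = test_power indep_normal_law (0, m) ?\<phi>"
    by (rule moment[OF \<phi>, THEN conjunct2])
      (use lc_test_le_invariant(1)[OF \<alpha> r w const] in \<open>simp add: power_const size\<close>)
  have chord: "L z - E * cosh (m * e) = E * (exp (m * snd z) - (cosh (m * e) + snd z * (sinh (m * e) / e)))" for z
    by (simp add: L_def K_def k_def algebra_simps)
  have sign: "0 \<le> (?\<phi> z - \<psi> z) * (L z - E * cosh (m * e))" for z
  proof (cases "e \<le> \<bar>snd z\<bar>")
    case True
    then have "0 \<le> L z - E * cosh (m * e)"
      unfolding chord using exp_chord(2)[OF e, of "snd z" m] E by simp
    moreover have "\<psi> z \<le> 1" using \<psi> unfolding is_test_def by blast
    then have "\<psi> z \<le> ?\<phi> z" using True by (simp add: phi)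
    ultimately show ?thesis by simp
  next
    case False
    then have "L z - E * cosh (m * e) \<le> 0"
      unfolding chord using exp_chord(1)[OF e, of "snd z" m] E by (intro mult_nonneg_nonpos) simp_all
    moreover have "0 \<le> \<psi> z" using \<psi> unfolding is_test_def by blast
    then have "?\<phi> z \<le> \<psi> z" using False by (simp add: phi)
    ultimately show ?thesis by (intro mult_nonpos_nonpos) simp_all
  qed
  have "0 \<le> E * cosh (m * e)" using E by simp
  from neyman_pearson_compare(1)[OF \<phi> \<psi> LM Lb this sign]
  show ?thesis unfolding M\<psi> M\<phi> using level size by (simp add: test_power_null)
qed

text \<open>One alternative and one competitor suffice: at mean 1 the test with weights 0 is most
  powerful, and the equality case forces almost everywhere agreement with it off its boundary. A
  positive coefficient of the squared first coordinate contradicts this on an open set.\<close>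

lemma UMP_invariant_imp_weightless:
  assumes \<alpha>: "0 < \<alpha>" "\<alpha> < 1" and r: "-1 < r" "r < 1" and w: "0 \<le> a1" "0 \<le> a2" "a1 + a2 < 1"
    and le: "test_power indep_normal_law (0, 1) (lc_test \<alpha> 0 0 r) \<le> test_power indep_normal_law (0, 1) (lc_test \<alpha> a1 a2 r)"
  shows "a1 = 0 \<and> a2 * r = 0"
proof (rule ccontr)
  assume neg: "\<not> ?thesis"
  \<comment> \<open>\<open>a1 + a2 * r\<^sup>2\<close> is the coefficient of the squared first
    coordinate in the statistic.\<close>
  then have A: "0 < a1 + a2 * r\<^sup>2"
    using w by (smt (verit) mult_eq_0_iff mult_nonneg_nonneg power2_eq_square zero_le_square)
  let ?\<psi> = "lc_test \<alpha> a1 a2 r" and ?c = "lc_crit \<alpha> a1 a2 r" and ?d = "lc_crit \<alpha> 0 0 r"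
  define L where "L z = exp (- 1\<^sup>2 / 2) * cosh (1 * snd z)" for z :: "real \<times> real"
  have inv: "?\<psi> (- z) = ?\<psi> z" for z
  proof -
    have "lc_stat a1 a2 r (- z) = lc_stat a1 a2 r z"
    proof -
      have "r * - fst z + sqrt (1 - r\<^sup>2) * - snd z = - (r * fst z + sqrt (1 - r\<^sup>2) * snd z)" by simp
      then show ?thesis unfolding lc_stat_def fst_uminus snd_uminus by (simp only: power2_minus)
    qed
    then show ?thesis by (simp add: lc_test_def)
  qed
  have "test_power indep_normal_law (0, 0) ?\<psi> \<le> \<alpha>" using test_power_lc_test_null \<alpha> w r by simp
  from lc_test_le_invariant(2)[OF \<alpha> r _ _ _ _ is_test_lc_test inv this, of 0 0 1] le
  have ae: "AE z in indep_normal_law (0, 0). (lc_test \<alpha> 0 0 r z - ?\<psi> z) * (L z - L (0, sqrt ?d)) = 0"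
    by (simp add: L_def)
  have c0: "0 < ?d" by (rule lc_crit_pos) (use \<alpha> r in auto)
  \<comment> \<open>On \<open>S\<close> the competitor accepts and the given test rejects; the
    inequalities are strict to make \<open>S\<close> open, so that it is empty as soon as it is
    null.\<close>
  define S where "S = {z. (snd z)\<^sup>2 < ?d \<and> ?c < lc_stat a1 a2 r z}"
  have "open S"
    unfolding S_def lc_stat_def by (intro open_Collect_conj open_Collect_less continuous_intros)
  moreover have "AE z in lborel. z \<notin> S"
  proof -
    have "AE z in indep_normal_law (0, 0). z \<notin> S"
      using ae
    proof eventually_elim
      case (elim z)
      show ?case
      proof
        assume "z \<in> S"
        then have z: "(snd z)\<^sup>2 < ?d" "?c < lc_stat a1 a2 r z" by (simp_all add: S_def)
        then have "lc_test \<alpha> 0 0 r z = 0" "?\<psi> z = 1"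
          by (simp_all add: lc_test_def lc_stat_weightless)
        moreover have "\<bar>snd z\<bar> < sqrt ?d" using z(1) by (metis real_sqrt_abs real_sqrt_less_iff)
        then have "cosh (snd z) < cosh (sqrt ?d)" using c0 by (intro cosh_mono_abs) simp
        then have "L z < L (0, sqrt ?d)" by (simp add: L_def)
        ultimately show False using elim by simp
      qed
    qed
    then show ?thesis
      unfolding indep_normal_law_density by (subst (asm) AE_density) (simp_all add: normal_density_pos)
  qed
  ultimately have "S = {}" by (rule open_AE_lborel_empty)
  \<comment> \<open>On the axis \<open>snd z = 0\<close> the statistic is its coefficient times the
    squared first coordinate, and this point lifts it above \<open>?c\<close>.\<close>
  moreover have "(sqrt (\<bar>?c\<bar> / (a1 + a2 * r\<^sup>2) + 1), 0) \<in> S"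
  proof -
    let ?x = "sqrt (\<bar>?c\<bar> / (a1 + a2 * r\<^sup>2) + 1)"
    have "lc_stat a1 a2 r (?x, 0) = (a1 + a2 * r\<^sup>2) * ?x\<^sup>2"
      by (simp add: lc_stat_def power_mult_distrib distrib_right del: real_sqrt_pow2_iff real_sqrt_pow2)
    also have "?x\<^sup>2 = \<bar>?c\<bar> / (a1 + a2 * r\<^sup>2) + 1" using A by (intro real_sqrt_pow2) simp
    also have "(a1 + a2 * r\<^sup>2) * (\<bar>?c\<bar> / (a1 + a2 * r\<^sup>2) + 1) = \<bar>?c\<bar> + (a1 + a2 * r\<^sup>2)"
      using A by (simp add: distrib_left)
    finally have "?c < lc_stat a1 a2 r (?x, 0)" using A by linarith
    then show ?thesis using c0 by (simp add: S_def)
  qed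
  ultimately show False by blast
qed

lemma local_alternatives:
  assumes \<alpha>: "0 < \<alpha>" "\<alpha> < 1" and "abar < 1" and a: "(a1, a2) \<in> weight_set abar"
    and r: "-1 < r" "r < 1" and p: "0 < p" and H1: "H1 = {\<theta>. \<theta> \<noteq> 0 \<and> (\<exists>Dt C. \<theta> = Dt * C / sqrt p)}"
  shows "UMP_within (local_law r) H1
       {\<phi>. is_test \<phi> \<and> has_level (local_law r) {0} \<alpha> \<phi> \<and> sign_invariant \<phi>}
       (local_lc_test \<alpha> a1 a2 r) \<longleftrightarrow> a1 = 0 \<and> a2 * r = 0"
    and "a1 = 0 \<and> a2 * r = 0 \<Longrightarrow> UMP_within (local_law r) H1
       {\<phi>. is_test \<phi> \<and> unbiased_test (local_law r) {0} H1 \<alpha> \<phi>} (local_lc_test \<alpha> a1 a2 r)"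
proof -
  have w: "0 \<le> a1" "0 \<le> a2" "a1 + a2 < 1" using a \<open>abar < 1\<close> by (auto simp: weight_set_def)
  define s where "s = sqrt (1 - r\<^sup>2)"
  have "r\<^sup>2 < 1" using r by (simp add: abs_square_less_1 abs_if)
  then have s: "0 < s" by (simp add: s_def)
  \<comment> \<open>Every nonzero \<theta> is attained, for instance with
    \<open>C = 1\<close>.\<close>
  have H1': "H1 = {\<theta>. \<theta> \<noteq> 0}"
  proof -
    have "\<theta> = (\<theta> * sqrt p) * 1 / sqrt p" for \<theta> using p by simp
    then show ?thesis unfolding H1 by blast
  qed
  let ?std = "\<lambda>\<psi> z. \<psi> (fst z, r * fst z + s * snd z) :: real"
  have power: "test_power (local_law r) \<theta> \<psi> = test_power indep_normal_law (0, \<theta> / s) (?std \<psi>)" if "is_test \<psi>" for \<psi> \<theta>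
    unfolding s_def by (rule test_power_local_law[OF r]) (use that in \<open>simp add: is_test_def\<close>)
  have power_lc: "test_power (local_law r) \<theta> (local_lc_test \<alpha> b1 b2 r)
      = test_power indep_normal_law (0, \<theta> / s) (lc_test \<alpha> b1 b2 r)" for b1 b2 \<theta>
    unfolding s_def by (rule test_power_local_lc_test[OF r])
  have size: "test_power indep_normal_law (0, 0) (lc_test \<alpha> b1 b2 r) = \<alpha>" if "0 \<le> b2" "b1 + b2 < 1" for b1 b2
    by (rule test_power_lc_test_null) (use \<alpha> r that in auto)
  let ?T = "{\<phi>. is_test \<phi> \<and> has_level (local_law r) {0} \<alpha> \<phi> \<and> sign_invariant \<phi>}"
  have lc_in: "local_lc_test \<alpha> b1 b2 r \<in> ?T" if "0 \<le> b2" "b1 + b2 < 1" for b1 b2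
    using size[OF that] by (simp add: is_test_local_lc_test has_level_def power_lc sign_invariant_local_lc_test)
  have invariant: "test_power (local_law r) \<theta> \<psi> \<le> test_power (local_law r) \<theta> (local_lc_test \<alpha> a1 a2 r)"
    if "a1 = 0" "a2 * r = 0" "\<psi> \<in> ?T" for \<psi> \<theta>
  proof -
    have \<psi>: "is_test \<psi>" "test_power (local_law r) 0 \<psi> \<le> \<alpha>" "sign_invariant \<psi>"
      using that(3) by (simp_all add: has_level_def)
    have "?std \<psi> (- z) = ?std \<psi> z" for z
    proof -
      have "(fst (- z), r * fst (- z) + s * snd (- z)) = (- fst z, - (r * fst z + s * snd z))" by simp
      then show ?thesis using \<psi>(3) unfolding sign_invariant_def by metis
    qed
    moreover have "test_power indep_normal_law (0, 0) (?std \<psi>) \<le> \<alpha>" using \<psi>(2) power[OF \<psi>(1), of 0] by simp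
    ultimately show ?thesis
      unfolding power[OF \<psi>(1)] power_lc
      using lc_test_le_invariant(1)[OF \<alpha> r that(1,2) _ _ standardized_test[OF \<psi>(1)]] w by simp
  qed
  show "UMP_within (local_law r) H1 ?T (local_lc_test \<alpha> a1 a2 r) \<longleftrightarrow> a1 = 0 \<and> a2 * r = 0"
  proof
    assume "UMP_within (local_law r) H1 ?T (local_lc_test \<alpha> a1 a2 r)"
    moreover have "local_lc_test \<alpha> 0 0 r \<in> ?T" by (rule lc_in) simp_all
    \<comment> \<open>The alternative \<open>\<theta> = s\<close> has standardized mean 1.\<close>
    moreover have "s \<in> H1" using s by (simp add: H1')
    ultimately have "test_power (local_law r) s (local_lc_test \<alpha> 0 0 r) \<le> test_power (local_law r) s (local_lc_test \<alpha> a1 a2 r)"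
      unfolding UMP_within_def by blast
    then show "a1 = 0 \<and> a2 * r = 0"
      unfolding power_lc using s by (intro UMP_invariant_imp_weightless[OF \<alpha> r w]) simp
  next
    assume "a1 = 0 \<and> a2 * r = 0"
    then show "UMP_within (local_law r) H1 ?T (local_lc_test \<alpha> a1 a2 r)"
      unfolding UMP_within_def using invariant lc_in w by blast
  qed
  assume z: "a1 = 0 \<and> a2 * r = 0"
  show "UMP_within (local_law r) H1
       {\<phi>. is_test \<phi> \<and> unbiased_test (local_law r) {0} H1 \<alpha> \<phi>} (local_lc_test \<alpha> a1 a2 r)"
    unfolding UMP_within_def
  proof (intro conjI ballI)
    \<comment> \<open>Optimality among invariant tests, applied to the constant test, gives
      unbiasedness of the linear combination test.\<close>
    have const: "(\<lambda>_. \<alpha>) \<in> ?T" and power_const: "test_power (local_law r) \<theta> (\<lambda>_. \<alpha>) = \<alpha>" for \<theta>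
    proof -
      have t: "is_test (\<lambda>_. \<alpha>)" using \<alpha> by (simp add: is_test_def)
      show p: "test_power (local_law r) \<theta> (\<lambda>_. \<alpha>) = \<alpha>" for \<theta>
        unfolding power[OF t] using prob_space.prob_space[OF prob_space_indep_normal_law[of "(0, \<theta> / s)"]]
        by (simp add: test_power_def)
      then show "(\<lambda>_. \<alpha>) \<in> ?T" using t by (simp add: has_level_def sign_invariant_def)
    qed
    show "local_lc_test \<alpha> a1 a2 r \<in> {\<phi>. is_test \<phi> \<and> unbiased_test (local_law r) {0} H1 \<alpha> \<phi>}"
      using lc_in[OF w(2,3)] invariant[OF _ _ const] z by (simp add: unbiased_test_def power_const)
    fix \<psi> \<theta> assume \<psi>: "\<psi> \<in> {\<phi>. is_test \<phi> \<and> unbiased_test (local_law r) {0} H1 \<alpha> \<phi>}"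
    then have t: "is_test \<psi>" and lev: "test_power (local_law r) 0 \<psi> \<le> \<alpha>"
      and unb: "\<And>\<theta>. \<theta> \<noteq> 0 \<Longrightarrow> \<alpha> \<le> test_power (local_law r) \<theta> \<psi>"
      by (auto simp: unbiased_test_def has_level_def H1')
    show "test_power (local_law r) \<theta> \<psi> \<le> test_power (local_law r) \<theta> (local_lc_test \<alpha> a1 a2 r)"
      unfolding power[OF t] power_lc
    proof (rule lc_test_le_unbiased[OF \<alpha> r _ _ w(2) _ standardized_test[OF t]])
      show "test_power indep_normal_law (0, 0) (?std \<psi>) \<le> \<alpha>" using lev power[OF t, of 0] by simp
      show "\<alpha> \<le> test_power indep_normal_law (0, m) (?std \<psi>)" if "m \<noteq> 0" for m
        using unb[of "m * s"] power[OF t, of "m * s"] s that by simp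
    qed (use z w in auto)
  qed
qed

section \<open>Fixed alternatives under strong identification\<close>

text \<open>The feasible test evaluates the critical value at an estimated correlation. Its sublevel
  sets are described by measures of sections, which are measurable by Fubini.\<close>

lemma lc_crit_measurable:
  assumes "0 < \<alpha>" "\<alpha> < 1"
  shows "lc_crit \<alpha> a1 a2 \<in> borel_measurable borel"
proof (subst borel_measurable_iff_le, intro allI)
  interpret prob_space "indep_normal_law (0, 0)" by (rule prob_space_indep_normal_law)
  fix x :: real
  have [measurable]: "(\<lambda>p. lc_stat a1 a2 (fst p) (snd p)) \<in> borel_measurable (borel \<Otimes>\<^sub>M indep_normal_law (0, 0))"
    unfolding lc_stat_def by measurable
  have "{p \<in> space (borel \<Otimes>\<^sub>M indep_normal_law (0, 0)). lc_stat a1 a2 (fst p) (snd p) \<le> x}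
      \<in> sets (borel \<Otimes>\<^sub>M indep_normal_law (0, 0))"
    by measurable
  from measurable_emeasure_Pair[OF this]
  have "(\<lambda>r. emeasure (indep_normal_law (0, 0)) {z. lc_stat a1 a2 r z \<le> x}) \<in> borel_measurable borel"
    by (simp add: space_pair_measure vimage_def)
  then have [measurable]: "(\<lambda>r. prob {z. lc_stat a1 a2 r z \<le> x}) \<in> borel_measurable borel"
    unfolding measure_def by measurable
  show "{r \<in> space borel. lc_crit \<alpha> a1 a2 r \<le> x} \<in> sets borel"
    unfolding lc_crit_le_iff[OF assms] by measurable
qed

text \<open>By Cauchy-Schwarz each of the three squares is at most the sum of squares, and the
  statistic is their convex combination.\<close>

lemma lc_stat_le_sum_squares:
  assumes "0 \<le> a1" "0 \<le> a2" "a1 + a2 \<le> 1" "\<bar>r\<bar> < 1"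
  shows "lc_stat a1 a2 r z \<le> (fst z)\<^sup>2 + (snd z)\<^sup>2"
proof -
  define s where "s = sqrt (1 - r\<^sup>2)"
  have s: "s\<^sup>2 = 1 - r\<^sup>2" using assms(4) by (simp add: s_def abs_square_le_1)
  obtain x y where z: "z = (x, y)" by fastforce
  have "(r * x + s * y)\<^sup>2 = (r\<^sup>2 + s\<^sup>2) * (x\<^sup>2 + y\<^sup>2) - (r * y - s * x)\<^sup>2"
    by (simp add: power2_eq_square algebra_simps)
  then have "(r * x + s * y)\<^sup>2 \<le> x\<^sup>2 + y\<^sup>2" by (simp add: s)
  then have "lc_stat a1 a2 r z \<le> a1 * (x\<^sup>2 + y\<^sup>2) + a2 * (x\<^sup>2 + y\<^sup>2) + (1 - a1 - a2) * (x\<^sup>2 + y\<^sup>2)"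
    unfolding lc_stat_def z s_def[symmetric] fst_conv snd_conv using assms by (intro add_mono mult_left_mono) simp_all
  also have "\<dots> = x\<^sup>2 + y\<^sup>2" by (simp add: algebra_simps)
  finally show ?thesis by (simp add: z)
qed

text \<open>With weights \<open>1 / 2\<close>, 0 and correlation 0 the statistic is half the sum of
  squares, so the bound is the chi-square quantile with two degrees of freedom.\<close>

lemma lc_crit_bounded:
  assumes "0 < \<alpha>" "\<alpha> < 1" "0 \<le> a1" "0 \<le> a2" "a1 + a2 \<le> 1" "\<bar>r\<bar> < 1"
  shows "lc_crit \<alpha> a1 a2 r \<le> 2 * lc_crit \<alpha> (1 / 2) 0 0"
proof (rule lc_crit_le_scaled[OF assms(1,2)])
  show "lc_stat a1 a2 r z \<le> 2 * lc_stat (1 / 2) 0 0 z" for z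
    using lc_stat_le_sum_squares[OF assms(3-6), of z] by (simp add: lc_stat_def)
qed simp

lemma lc_crit_le_max:
  assumes "0 < \<alpha>" "\<alpha> < 1" "abar < 1" "(a1, a2) \<in> weight_set abar" "\<bar>r\<bar> < 1"
  shows "lc_crit \<alpha> a1 a2 r \<le> lc_crit_max abar \<alpha> r"
proof -
  have "bdd_above ((\<lambda>p. case p of (a1, a2) \<Rightarrow> lc_crit \<alpha> a1 a2 r) ` weight_set abar)"
    using assms(3) lc_crit_bounded[OF assms(1,2) _ _ _ assms(5)]
    by (intro bdd_aboveI2[where M="2 * lc_crit \<alpha> (1 / 2) 0 0"]) (auto simp: weight_set_def)
  from cSUP_upper[OF assms(4) this] show ?thesis unfolding lc_crit_max_def by simp
qed

text \<open>
  If \<open>r \<noteq> 0\<close>, then \<open>t x + sqrt (1 - t\<^sup>2) y\<close> is close to \<open>r x + sqrt (1 - r\<^sup>2) y\<close> up to a factor near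
  1 and a small multiple of \<open>y\<close>; the latter is absorbed by the weight \<open>1 - a1 - a2 \<ge> 1 - abar\<close>. So the
  quadratic forms compare multiplicatively and uniformly in the weights, and so do their quantiles.
\<close>

lemma lc_crit_upper_semicontinuous:
  assumes \<alpha>: "0 < \<alpha>" "\<alpha> < 1" and "abar < 1" and r: "\<bar>r\<bar> < 1" "r \<noteq> 0" and "0 < \<eta>"
  shows "eventually (\<lambda>t. \<forall>(a1, a2)\<in>weight_set abar. lc_crit \<alpha> a1 a2 t \<le> (1 + \<eta>) * lc_crit \<alpha> a1 a2 r) (nhds r)"
proof -
  \<comment> \<open>Half of the slack is spent in Young's inequality; the rest is for the factor
    \<open>(t / r)\<^sup>2\<close>.\<close>
  define \<kappa> where "\<kappa> = \<eta> / 2"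
  have \<kappa>: "0 < \<kappa>" using \<open>0 < \<eta>\<close> by (simp add: \<kappa>_def)
  define s where "s t = sqrt (1 - t\<^sup>2)" for t :: real
  \<comment> \<open>The coefficient of \<open>y\<close> that remains after \<open>t / r\<close>
    times the form at \<open>r\<close> is split off; it vanishes at \<open>t = r\<close>.\<close>
  define q where "q t = s t - t / r * s r" for t
  have "((\<lambda>t. (1 + \<kappa>) * (t / r)\<^sup>2) \<longlongrightarrow> (1 + \<kappa>) * (r / r)\<^sup>2) (nhds r)"
    using r(2) by (intro tendsto_intros filterlim_ident) simp_all
  then have 1: "eventually (\<lambda>t. (1 + \<kappa>) * (t / r)\<^sup>2 < 1 + \<eta>) (nhds r)"
    by (rule order_tendstoD) (use r(2) \<open>0 < \<eta>\<close> in \<open>simp add: \<kappa>_def\<close>)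
  have "((\<lambda>t. (1 + 1 / \<kappa>) * (q t)\<^sup>2) \<longlongrightarrow> (1 + 1 / \<kappa>) * (sqrt (1 - r\<^sup>2) - r / r * s r)\<^sup>2) (nhds r)"
    unfolding q_def s_def using r(2) by (intro tendsto_intros filterlim_ident) simp_all
  then have 2: "eventually (\<lambda>t. (1 + 1 / \<kappa>) * (q t)\<^sup>2 < \<eta> * (1 - abar)) (nhds r)"
    by (rule order_tendstoD) (use r(2) \<open>0 < \<eta>\<close> \<open>abar < 1\<close> in \<open>simp add: s_def\<close>)
  show ?thesis
    using 1 2
  proof eventually_elim
    case (elim t)
    have young: "(u + w)\<^sup>2 \<le> (1 + \<kappa>) * u\<^sup>2 + (1 + 1 / \<kappa>) * w\<^sup>2" for u w :: real
    proof -
      have "0 \<le> (sqrt \<kappa> * u - w / sqrt \<kappa>)\<^sup>2" by simp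
      also have "\<dots> = \<kappa> * u\<^sup>2 - 2 * u * w + w\<^sup>2 / \<kappa>"
        using \<kappa> by (simp add: power2_diff power_mult_distrib power_divide)
      finally show ?thesis by (simp add: power2_sum algebra_simps)
    qed
    have form: "(t * x + s t * y)\<^sup>2 \<le> (1 + \<eta>) * (r * x + s r * y)\<^sup>2 + \<eta> * (1 - abar) * y\<^sup>2" for x y
    proof -
      have "t * x + s t * y = t / r * (r * x + s r * y) + q t * y"
        using r(2) by (simp add: q_def field_simps)
      then have "(t * x + s t * y)\<^sup>2 \<le> (1 + \<kappa>) * (t / r * (r * x + s r * y))\<^sup>2 + (1 + 1 / \<kappa>) * (q t * y)\<^sup>2"
        using young by metis
      also have "\<dots> = ((1 + \<kappa>) * (t / r)\<^sup>2) * (r * x + s r * y)\<^sup>2 + ((1 + 1 / \<kappa>) * (q t)\<^sup>2) * y\<^sup>2"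
        by (simp only: power_mult_distrib mult.assoc)
      also have "\<dots> \<le> (1 + \<eta>) * (r * x + s r * y)\<^sup>2 + \<eta> * (1 - abar) * y\<^sup>2"
        using elim by (intro add_mono mult_right_mono) simp_all
      finally show ?thesis .
    qed
    show ?case
    proof clarify
      fix a1 a2 assume "(a1, a2) \<in> weight_set abar"
      then have a: "0 \<le> a1" "0 \<le> a2" "a2 \<le> 1" "a1 + a2 \<le> abar" by (auto simp: weight_set_def)
      show "lc_crit \<alpha> a1 a2 t \<le> (1 + \<eta>) * lc_crit \<alpha> a1 a2 r"
      proof (rule lc_crit_le_scaled[OF \<alpha>])
        fix z :: "real \<times> real"
        obtain x y where z: "z = (x, y)" by fastforce
        have "a2 * (t * x + s t * y)\<^sup>2 \<le> a2 * ((1 + \<eta>) * (r * x + s r * y)\<^sup>2) + a2 * (\<eta> * (1 - abar) * y\<^sup>2)"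
          using mult_left_mono[OF form a(2)] by (simp add: distrib_left)
        \<comment> \<open>Here \<open>a2 \<le> 1\<close>, and \<open>1 - abar\<close> is at most the
          weight of \<open>y\<^sup>2\<close>.\<close>
        also have "a2 * (\<eta> * (1 - abar) * y\<^sup>2) \<le> 1 * (\<eta> * (1 - a1 - a2) * y\<^sup>2)"
          using a \<open>0 < \<eta>\<close> \<open>abar < 1\<close> by (intro mult_mono) simp_all
        finally have "a2 * (t * x + s t * y)\<^sup>2 \<le> (1 + \<eta>) * (a2 * (r * x + s r * y)\<^sup>2) + \<eta> * ((1 - a1 - a2) * y\<^sup>2)"
          by (simp add: mult.left_commute mult.assoc)
        moreover have "0 \<le> \<eta> * (a1 * x\<^sup>2)" using a \<open>0 < \<eta>\<close> by simp
        ultimately show "lc_stat a1 a2 t z \<le> (1 + \<eta>) * lc_stat a1 a2 r z"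
          unfolding lc_stat_def z s_def[symmetric] fst_conv snd_conv by (simp add: distrib_left distrib_right)
      qed (use \<open>0 < \<eta>\<close> in simp)
    qed
  qed
qed

text \<open>The feasible statistic as a deterministic function of two quadratic forms and three
  variance parameters, so that rejection can be established before probability enters.\<close>

definition stat_form :: "real \<Rightarrow> real \<Rightarrow> real \<Rightarrow> real \<Rightarrow> real \<Rightarrow> real \<Rightarrow> real \<Rightarrow> real" where
  "stat_form a1 a2 qe qx p q r = a1 * (qe / sqrt p)\<^sup>2 + a2 * (qx / sqrt q)\<^sup>2
     + (1 - a1 - a2) * ((qx / sqrt q - r * (qe / sqrt p)) / sqrt (1 - r\<^sup>2))\<^sup>2"

text \<open>Away from \<open>\<Delta> = \<Delta>\<^sub>*\<close> the mean of the modified score statistic diverges.\<close>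

lemma stat_form_ge_generic:
  assumes \<alpha>: "0 < \<alpha>" "\<alpha> < 1" and abar: "abar < 1" and pos: "0 < p" "0 < q" and r: "\<bar>r\<bar> < 1"
    and L: "D / sqrt q - r * D\<^sup>2 / sqrt p \<noteq> 0" and B: "0 \<le> B"
  shows "\<exists>c0. eventually (\<lambda>g. \<forall>C qe qx a1 a2. c0 \<le> \<bar>C\<bar> \<and> \<bar>qe - D\<^sup>2 * C\<bar> \<le> B \<and> \<bar>qx - D * C\<bar> \<le> B \<and>
      (a1, a2) \<in> weight_set abar \<longrightarrow>
      lc_crit \<alpha> a1 a2 (snd (snd g)) \<le> stat_form a1 a2 qe qx (fst g) (fst (snd g)) (snd (snd g))) (nhds (p, q, r))"
proof -
  define l where "l = \<bar>D / sqrt q - r * D\<^sup>2 / sqrt p\<bar>"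
  have l: "0 < l" using L by (simp add: l_def)
  \<comment> \<open>A bound on all critical values, uniform in the weights and the
    correlation.\<close>
  define Q where "Q = 2 * lc_crit \<alpha> (1 / 2) 0 0"
  have Q: "0 < Q" unfolding Q_def using lc_crit_pos[of \<alpha> "1/2" 0 0] \<alpha> by simp
  \<comment> \<open>\<open>k\<close> bounds the error in the numerator of the modified score, whose
    drift per unit of \<open>C\<close> exceeds \<open>l / 2\<close> in modulus near the limit.
    \<open>c0\<close> leaves a numerator whose square, weighted by \<open>1 - abar\<close>, reaches
    \<open>Q\<close>.\<close>
  define k where "k = B / sqrt (q / 2) + B / sqrt (p / 2)"
  define c0 where "c0 = (k + sqrt (Q / (1 - abar))) / (l / 2)"
  have lim: "((\<lambda>g. fst g) \<longlongrightarrow> p) (nhds (p, q, r))" "((\<lambda>g. fst (snd g)) \<longlongrightarrow> q) (nhds (p, q, r))"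
    "((\<lambda>g. snd (snd g)) \<longlongrightarrow> r) (nhds (p, q, r))"
    by (auto intro!: tendsto_eq_intros filterlim_ident)
  have e1: "eventually (\<lambda>g. p / 2 < fst g) (nhds (p, q, r))" by (rule order_tendstoD[OF lim(1)]) (use pos in simp)
  have e2: "eventually (\<lambda>g. q / 2 < fst (snd g)) (nhds (p, q, r))" by (rule order_tendstoD[OF lim(2)]) (use pos in simp)
  have e3: "eventually (\<lambda>g. \<bar>snd (snd g)\<bar> < 1) (nhds (p, q, r))"
    by (rule order_tendstoD[OF tendsto_rabs[OF lim(3)]]) (rule r)
  have "((\<lambda>g. \<bar>D / sqrt (fst (snd g)) - snd (snd g) * D\<^sup>2 / sqrt (fst g)\<bar>) \<longlongrightarrow> l) (nhds (p, q, r))"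
    unfolding l_def using pos by (intro tendsto_intros lim) simp_all
  then have e4: "eventually (\<lambda>g. l / 2 < \<bar>D / sqrt (fst (snd g)) - snd (snd g) * D\<^sup>2 / sqrt (fst g)\<bar>) (nhds (p, q, r))"
    by (rule order_tendstoD) (use l in simp)
  have "eventually (\<lambda>g. \<forall>C qe qx a1 a2. c0 \<le> \<bar>C\<bar> \<and> \<bar>qe - D\<^sup>2 * C\<bar> \<le> B \<and> \<bar>qx - D * C\<bar> \<le> B \<and>
      (a1, a2) \<in> weight_set abar \<longrightarrow>
      lc_crit \<alpha> a1 a2 (snd (snd g)) \<le> stat_form a1 a2 qe qx (fst g) (fst (snd g)) (snd (snd g))) (nhds (p, q, r))"
    using e1 e2 e3 e4
  proof eventually_elim
    case (elim g)
    obtain x1 x4 x7 where g: "g = (x1, x4, x7)" by (metis surj_pair)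
    have x: "p / 2 < x1" "q / 2 < x4" "\<bar>x7\<bar> < 1" "l / 2 < \<bar>D / sqrt x4 - x7 * D\<^sup>2 / sqrt x1\<bar>"
      using elim by (simp_all add: g)
    show ?case
      unfolding g fst_conv snd_conv
    proof (intro allI impI, elim conjE)
      fix C qe qx a1 a2
      assume C: "c0 \<le> \<bar>C\<bar>" and qe: "\<bar>qe - D\<^sup>2 * C\<bar> \<le> B" and qx: "\<bar>qx - D * C\<bar> \<le> B" and "(a1, a2) \<in> weight_set abar"
      then have a: "0 \<le> a1" "0 \<le> a2" "a1 + a2 \<le> abar" by (auto simp: weight_set_def)
      define num where "num = qx / sqrt x4 - x7 * (qe / sqrt x1)"
      have err1: "\<bar>(qx - D * C) / sqrt x4\<bar> \<le> B / sqrt (q / 2)"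
        unfolding abs_divide using qx x pos by (intro frac_le) simp_all
      have "\<bar>(qe - D\<^sup>2 * C) / sqrt x1\<bar> \<le> B / sqrt (p / 2)"
        unfolding abs_divide using qe x pos by (intro frac_le) simp_all
      then have err2: "\<bar>x7 * ((qe - D\<^sup>2 * C) / sqrt x1)\<bar> \<le> B / sqrt (p / 2)"
        using x(3) unfolding abs_mult by (smt (verit) abs_ge_zero mult_left_le_one_le)
      have "C * (D / sqrt x4 - x7 * D\<^sup>2 / sqrt x1)
          = num - (qx - D * C) / sqrt x4 + x7 * ((qe - D\<^sup>2 * C) / sqrt x1)"
        by (simp add: num_def diff_divide_distrib right_diff_distrib mult_ac)
      moreover have "\<bar>u - e1 + e2\<bar> \<le> \<bar>u\<bar> + (b1 + b2)" if "\<bar>e1\<bar> \<le> b1" "\<bar>e2\<bar> \<le> b2" for u e1 e2 b1 b2 :: real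
        using that by linarith
      ultimately have "\<bar>C * (D / sqrt x4 - x7 * D\<^sup>2 / sqrt x1)\<bar> \<le> \<bar>num\<bar> + k"
        using err1 err2 unfolding k_def by metis
      moreover have "c0 * (l / 2) \<le> \<bar>C\<bar> * \<bar>D / sqrt x4 - x7 * D\<^sup>2 / sqrt x1\<bar>"
        using C x(4) l by (intro mult_mono) simp_all
      moreover have "c0 * (l / 2) = k + sqrt (Q / (1 - abar))" using l by (simp add: c0_def)
      ultimately have "sqrt (Q / (1 - abar)) \<le> \<bar>num\<bar>" by (simp add: abs_mult)
      then have "(sqrt (Q / (1 - abar)))\<^sup>2 \<le> \<bar>num\<bar>\<^sup>2" using Q abar by (intro power_mono) simp_all
      then have num: "Q / (1 - abar) \<le> num\<^sup>2" using Q abar by simp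
      have x7: "0 < 1 - x7\<^sup>2" "1 - x7\<^sup>2 \<le> 1" using x(3) by (simp_all add: abs_square_less_1)
      have "num\<^sup>2 * (1 - x7\<^sup>2) \<le> num\<^sup>2" using x7 by (intro mult_left_le) simp_all
      then have "num\<^sup>2 \<le> num\<^sup>2 / (1 - x7\<^sup>2)" using x7(1) by (simp add: le_divide_eq)
      also have "\<dots> = (num / sqrt (1 - x7\<^sup>2))\<^sup>2" using x7 by (simp add: power_divide)
      finally have "Q / (1 - abar) \<le> (num / sqrt (1 - x7\<^sup>2))\<^sup>2" using num by linarith
      then have "(1 - abar) * (Q / (1 - abar)) \<le> (1 - a1 - a2) * (num / sqrt (1 - x7\<^sup>2))\<^sup>2"
        using a abar Q by (intro mult_mono) simp_all
      then have "Q \<le> stat_form a1 a2 qe qx x1 x4 x7"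
        unfolding stat_form_def num_def[symmetric] using abar a by (simp add: add_nonneg_nonneg)
          (smt (verit) mult_nonneg_nonneg zero_le_power2 zero_le_divide_iff)
      moreover have "lc_crit \<alpha> a1 a2 x7 \<le> Q"
        unfolding Q_def using a abar x(3) \<alpha> by (intro lc_crit_bounded) simp_all
      ultimately show "lc_crit \<alpha> a1 a2 x7 \<le> stat_form a1 a2 qe qx x1 x4 x7" by simp
    qed
  qed
  then show ?thesis by blast
qed

text \<open>At \<open>\<Delta> = \<Delta>\<^sub>*\<close> the power comes from the first statistic alone, through the lower bound on its weight.\<close>

lemma stat_form_ge_critical:
  assumes \<alpha>: "0 < \<alpha>" "\<alpha> < 1" and abar: "0 \<le> abar" "abar < 1" and pos: "0 < p" "0 < q" and r: "\<bar>r\<bar> < 1" "r \<noteq> 0"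
    and D: "D \<noteq> 0" and B: "0 \<le> B" and qt: "lc_crit_max abar \<alpha> r < qt"
  shows "\<exists>c0. eventually (\<lambda>g. \<forall>C qe qx a1 a2. c0 \<le> \<bar>C\<bar> \<and> \<bar>qe - D\<^sup>2 * C\<bar> \<le> B \<and>
      qt * p / (C\<^sup>2 * D ^ 4) \<le> a1 \<and> (a1, a2) \<in> weight_set abar \<longrightarrow>
      lc_crit \<alpha> a1 a2 (snd (snd g)) \<le> stat_form a1 a2 qe qx (fst g) (fst (snd g)) (snd (snd g))) (nhds (p, q, r))"
proof -
  let ?M = "lc_crit_max abar \<alpha> r"
  have "(0, 0) \<in> weight_set abar" using abar by (simp add: weight_set_def)
  then have "lc_crit \<alpha> 0 0 r \<le> ?M" using lc_crit_le_max \<alpha> abar(2) r(1) by blast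
  moreover have "0 < lc_crit \<alpha> 0 0 r" using lc_crit_pos[of \<alpha> 0 0 r] \<alpha> r by simp
  ultimately have M: "0 < ?M" by simp
  \<comment> \<open>The gap between the maximal critical value and \<open>qt\<close> is shared: up
    to \<open>m\<close> for the estimated correlation, from \<open>m\<close> to \<open>m'\<close>
    for the error in \<open>qe\<close>, and from \<open>m'\<close> to \<open>qt\<close> for the
    estimate of \<open>p\<close>.\<close>
  define m where "m = (?M + qt) / 2"
  define m' where "m' = (m + qt) / 2"
  have "?M < m" "m < qt" using qt by (simp_all add: m_def)
  moreover from this have "m < m'" "m' < qt" by (simp_all add: m'_def)
  ultimately have m: "?M < m" "0 < m" "m < m'" "0 < m'" "m' < qt" using M by linarith+
  define \<eta> where "\<eta> = (m - ?M) / ?M"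
  have \<eta>: "0 < \<eta>" "(1 + \<eta>) * ?M = m" using M m by (simp_all add: \<eta>_def distrib_right)
  \<comment> \<open>The admissible relative error of \<open>qe\<close>; \<open>c0\<close> is large
    enough to enforce it, and its summand 1 keeps \<open>C\<close> away from 0.\<close>
  define w where "w = 1 - sqrt (m / m')"
  have w: "0 < w" using m by (simp add: w_def)
  define c0 where "c0 = B / (D\<^sup>2 * w) + 1"
  have c0: "0 < c0" unfolding c0_def using B D w by (intro add_nonneg_pos divide_nonneg_nonneg) simp_all
  have lim: "((\<lambda>g. fst g) \<longlongrightarrow> p) (nhds (p, q, r))" "((\<lambda>g. snd (snd g)) \<longlongrightarrow> r) (nhds (p, q, r))"
    by (auto intro!: tendsto_eq_intros filterlim_ident)
  have e1: "eventually (\<lambda>g. 0 < fst g) (nhds (p, q, r))" by (rule order_tendstoD[OF lim(1)]) (use pos in simp)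
  have "((\<lambda>g. qt * p / fst g) \<longlongrightarrow> qt * p / p) (nhds (p, q, r))" using pos by (intro tendsto_intros lim) simp
  then have e2: "eventually (\<lambda>g. m' < qt * p / fst g) (nhds (p, q, r))"
    by (rule order_tendstoD) (use pos m in simp)
  have e3: "eventually (\<lambda>g. \<forall>(a1, a2)\<in>weight_set abar.
      lc_crit \<alpha> a1 a2 (snd (snd g)) \<le> (1 + \<eta>) * lc_crit \<alpha> a1 a2 r) (nhds (p, q, r))"
    by (rule eventually_compose_filterlim[OF lc_crit_upper_semicontinuous[OF \<alpha> abar(2) r \<eta>(1)] lim(2)])
  have "eventually (\<lambda>g. \<forall>C qe qx a1 a2. c0 \<le> \<bar>C\<bar> \<and> \<bar>qe - D\<^sup>2 * C\<bar> \<le> B \<and>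
      qt * p / (C\<^sup>2 * D ^ 4) \<le> a1 \<and> (a1, a2) \<in> weight_set abar \<longrightarrow>
      lc_crit \<alpha> a1 a2 (snd (snd g)) \<le> stat_form a1 a2 qe qx (fst g) (fst (snd g)) (snd (snd g))) (nhds (p, q, r))"
    using e1 e2 e3
  proof eventually_elim
    case (elim g)
    obtain x1 x4 x7 where g: "g = (x1, x4, x7)" by (metis surj_pair)
    have x: "0 < x1" "m' < qt * p / x1" using elim by (simp_all add: g)
    show ?case
      unfolding g fst_conv snd_conv
    proof (intro allI impI, elim conjE)
      fix C qe qx a1 a2
      assume C: "c0 \<le> \<bar>C\<bar>" and qe: "\<bar>qe - D\<^sup>2 * C\<bar> \<le> B" and a1: "qt * p / (C\<^sup>2 * D ^ 4) \<le> a1"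
        and aw: "(a1, a2) \<in> weight_set abar"
      have a: "0 \<le> a1" "0 \<le> a2" "a1 + a2 \<le> abar" using aw by (auto simp: weight_set_def)
      have C0: "C \<noteq> 0" using C c0 by auto
      define y where "y = qe / (D\<^sup>2 * C)"
      have "y - 1 = (qe - D\<^sup>2 * C) / (D\<^sup>2 * C)" using C0 D by (simp add: y_def field_simps)
      then have "\<bar>y - 1\<bar> = \<bar>qe - D\<^sup>2 * C\<bar> / (D\<^sup>2 * \<bar>C\<bar>)" by (simp add: abs_divide abs_mult)
      also have "\<dots> \<le> w"
      proof -
        have "B / (D\<^sup>2 * w) \<le> \<bar>C\<bar>" using C by (simp add: c0_def)
        then have "B \<le> w * (D\<^sup>2 * \<bar>C\<bar>)" using D w by (simp add: divide_le_eq mult_ac)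
        then show ?thesis using qe C0 D by (simp add: divide_le_eq)
      qed
      finally have "sqrt (m / m') \<le> y" unfolding w_def by linarith
      then have "(sqrt (m / m'))\<^sup>2 \<le> y\<^sup>2" using m by (intro power_mono) simp_all
      then have y: "m / m' \<le> y\<^sup>2" using m by simp
      have "m = m' * (m / m')" using m by simp
      also have "\<dots> \<le> (qt * p / x1) * y\<^sup>2" using x y m by (intro mult_mono) simp_all
      \<comment> \<open>The unknown \<open>C\<close> cancels: the lower bound on the weight decays
        exactly as fast as the squared statistic grows.\<close>
      also have "\<dots> = qt * p / (C\<^sup>2 * D ^ 4) * (qe / sqrt x1)\<^sup>2"
        using x(1) C0 D by (simp add: y_def power_divide power_mult_distrib field_simps)
      also have "\<dots> \<le> a1 * (qe / sqrt x1)\<^sup>2" by (intro mult_right_mono a1) simp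
      also have "\<dots> \<le> stat_form a1 a2 qe qx x1 x4 x7"
      proof -
        have "0 \<le> a2 * (qx / sqrt x4)\<^sup>2"
          "0 \<le> (1 - a1 - a2) * ((qx / sqrt x4 - x7 * (qe / sqrt x1)) / sqrt (1 - x7\<^sup>2))\<^sup>2"
          using a abar by (intro mult_nonneg_nonneg; simp)+
        then show ?thesis unfolding stat_form_def by linarith
      qed
      finally have "m \<le> stat_form a1 a2 qe qx x1 x4 x7" .
      moreover have "lc_crit \<alpha> a1 a2 x7 \<le> m"
      proof -
        have "lc_crit \<alpha> a1 a2 x7 \<le> (1 + \<eta>) * lc_crit \<alpha> a1 a2 r" using elim(3) aw by (auto simp: g)
        also have "\<dots> \<le> (1 + \<eta>) * ?M"
          using lc_crit_le_max[OF \<alpha> abar(2) aw r(1)] \<eta>(1) by (intro mult_left_mono) simp_all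
        finally show ?thesis by (simp add: \<eta>(2))
      qed
      ultimately show "lc_crit \<alpha> a1 a2 x7 \<le> stat_form a1 a2 qe qx x1 x4 x7" by simp
    qed
  qed
  then show ?thesis by blast
qed

section \<open>From deterministic rejection to convergence in probability\<close>

lemma feasible_lc_test_eq:
  "feasible_lc_test \<alpha> a1 a2 Z x e0 g
    = of_bool (lc_crit \<alpha> a1 a2 (g $ 7) \<le> stat_form a1 a2 (Q_form Z e0 e0) (Q_form Z x e0) (g $ 1) (g $ 4) (g $ 7))"
  unfolding feasible_lc_test_def stat_form_def AR_def LM_def LM_star_def ..

lemma measurable_stat_form_reject:
  assumes [measurable]: "c \<in> borel_measurable M" "qe \<in> borel_measurable M" "qx \<in> borel_measurable M"
    "p \<in> borel_measurable M" "q \<in> borel_measurable M" "r \<in> borel_measurable M"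
  shows "(\<lambda>\<omega>. of_bool (c \<omega> \<le> stat_form a1 a2 (qe \<omega>) (qx \<omega>) (p \<omega>) (q \<omega>) (r \<omega>)) :: real) \<in> borel_measurable M"
proof -
  have "(\<lambda>\<omega>. stat_form a1 a2 (qe \<omega>) (qx \<omega>) (p \<omega>) (q \<omega>) (r \<omega>)) \<in> borel_measurable M"
    unfolding stat_form_def by measurable
  then show ?thesis by measurable
qed

lemma gamma_at_nth:
  "gamma_at v D $ 1 = Phi1_at v D" "gamma_at v D $ 4 = Psi_at v D" "gamma_at v D $ 7 = rho_at v D"
  unfolding gamma_at_def vector_def by (simp_all add: fun_upd_apply)

text \<open>Compactness bounds the values from below, which makes the infimum an actual lower
  bound.\<close>

lemma INF_pos_imp_pos:
  fixes f :: "real \<Rightarrow> real"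
  assumes "compact B" "continuous_on B f" "(INF b\<in>B. f b) > 0" "x \<in> B"
  shows "0 < f x"
proof -
  have "bdd_below (f ` B)"
    using compact_continuous_image[OF assms(2,1)] by (intro bounded_imp_bdd_below compact_imp_bounded)
  from cINF_lower[OF this assms(4)] assms(3) show ?thesis by simp
qed

lemma measurable_vec_nth_borel [measurable]: "(\<lambda>g :: real^'n. g $ i) \<in> borel_measurable borel"
  by (intro borel_measurable_continuous_onI continuous_intros)

text \<open>Reduces the limit to a deterministic claim: the event on which \<open>X\<close> is
  bounded and \<open>G\<close> is small has probability close to 1, and on it \<open>T\<close> is
  eventually 1.\<close>

lemma conv_in_prob_indicator:
  fixes T :: "nat \<Rightarrow> 'w \<Rightarrow> real" and X :: "nat \<Rightarrow> 'w \<Rightarrow> 'b :: real_normed_vector" and G :: "nat \<Rightarrow> 'w \<Rightarrow> 'c :: real_normed_vector"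
  assumes prob: "\<And>n. prob_space (M n)" and meas: "\<And>n. T n \<in> borel_measurable (M n)"
    and X: "big_Op M X" and G: "little_op M G"
    and accept: "\<And>B. \<exists>\<delta>>0. \<forall>\<^sub>F n in sequentially. \<forall>\<omega>\<in>space (M n). norm (X n \<omega>) \<le> B \<and> norm (G n \<omega>) \<le> \<delta> \<longrightarrow> T n \<omega> = 1"
  shows "conv_in_prob M T 1"
  unfolding conv_in_prob_def little_op_def
proof (intro conjI allI impI)
  show "(\<lambda>\<omega>. T n \<omega> - 1) \<in> borel_measurable (M n)" for n using meas[of n] by measurable
  fix \<epsilon> :: real assume \<epsilon>: "0 < \<epsilon>"
  show "(\<lambda>n. measure (M n) {\<omega> \<in> space (M n). \<epsilon> < norm (T n \<omega> - 1)}) \<longlonglongrightarrow> 0"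
  proof (rule tendstoI)
    fix e :: real assume e: "0 < e"
    have XM: "X n \<in> borel_measurable (M n)" and GM: "G n \<in> borel_measurable (M n)" for n
      using X G unfolding big_Op_def little_op_def by auto
    obtain B where B: "\<forall>\<^sub>F n in sequentially. measure (M n) {\<omega> \<in> space (M n). B < norm (X n \<omega>)} \<le> e / 3"
      using X e unfolding big_Op_def by (meson divide_pos_pos zero_less_numeral)
    obtain \<delta> where \<delta>: "0 < \<delta>" and acc: "\<forall>\<^sub>F n in sequentially. \<forall>\<omega>\<in>space (M n).
        norm (X n \<omega>) \<le> B \<and> norm (G n \<omega>) \<le> \<delta> \<longrightarrow> T n \<omega> = 1"
      using accept by blast
    have "(\<lambda>n. measure (M n) {\<omega> \<in> space (M n). \<delta> < norm (G n \<omega>)}) \<longlonglongrightarrow> 0"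
      using G \<delta> unfolding little_op_def by blast
    then have "\<forall>\<^sub>F n in sequentially. measure (M n) {\<omega> \<in> space (M n). \<delta> < norm (G n \<omega>)} < e / 3"
      by (rule order_tendstoD) (use e in simp)
    with B acc show "\<forall>\<^sub>F n in sequentially. dist (measure (M n) {\<omega> \<in> space (M n). \<epsilon> < norm (T n \<omega> - 1)}) 0 < e"
    proof eventually_elim
      case (elim n)
      interpret prob_space "M n" by (rule prob)
      note [measurable] = XM[of n] GM[of n]
      let ?E1 = "{\<omega> \<in> space (M n). B < norm (X n \<omega>)}" and ?E2 = "{\<omega> \<in> space (M n). \<delta> < norm (G n \<omega>)}"
      have "{\<omega> \<in> space (M n). \<epsilon> < norm (T n \<omega> - 1)} \<subseteq> ?E1 \<union> ?E2"
      proof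
        fix \<omega> assume \<omega>: "\<omega> \<in> {\<omega> \<in> space (M n). \<epsilon> < norm (T n \<omega> - 1)}"
        then have "T n \<omega> \<noteq> 1" using \<epsilon> by auto
        then show "\<omega> \<in> ?E1 \<union> ?E2" using \<omega> elim(2) by (auto simp: not_le[symmetric])
      qed
      then have "prob {\<omega> \<in> space (M n). \<epsilon> < norm (T n \<omega> - 1)} \<le> prob (?E1 \<union> ?E2)"
        by (intro finite_measure_mono) simp_all
      also have "\<dots> \<le> prob ?E1 + prob ?E2" by (intro measure_Un_le) simp_all
      also have "\<dots> < e" using elim(1,3) e by linarith
      finally show ?case by simp
    qed
  qed
qed

lemma strong_identification_fixed_alternatives:
  fixes v :: avar and M :: "nat \<Rightarrow> 'w measure" and X Y :: "nat \<Rightarrow> nat \<Rightarrow> 'w \<Rightarrow> real"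
    and \<gamma>h :: "nat \<Rightarrow> real \<Rightarrow> 'w \<Rightarrow> real^7"
  assumes \<alpha>: "0 < \<alpha>" "\<alpha> < 1" and abar: "abar < 1" and \<Delta>: "\<Delta> = \<beta> - \<beta>0"
    and prob: "\<And>n. prob_space (M n)"
    and A2: "assumption2 M v \<beta> B \<gamma>h" and \<beta>0: "\<beta>0 \<in> B"
    and r: "-1 < rho_at v \<Delta>" "rho_at v \<Delta> < 1"
    and bounded: "big_Op M (\<lambda>n \<omega>. let x = (\<lambda>i. X n i \<omega>); e0 = null_resid (Y n) (X n) \<beta>0 \<omega> in
       (Q_form (Z n) e0 e0 - \<Delta>\<^sup>2 * \<C> n, Q_form (Z n) x e0 - \<Delta> * \<C> n, Q_form (Z n) x x - \<C> n))"
    and diverge: "filterlim (\<lambda>n. \<bar>\<C> n\<bar>) at_top sequentially" and \<Delta>0: "\<Delta> \<noteq> 0"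
    and qt: "qt > lc_crit_max abar \<alpha> (rho_at v \<Delta>)"
    and weights: "\<forall>\<^sub>F n in sequentially. 1 \<ge> a1n n \<and>
        a1n n \<ge> qt * Phi1_at v \<Delta> / ((\<C> n)\<^sup>2 * (Delta_star v \<Delta>)^4) \<and> (a1n n, a2n n) \<in> weight_set abar"
  shows "conv_in_prob M (\<lambda>n \<omega>. feasible_lc_test \<alpha> (a1n n) (a2n n) (Z n) (\<lambda>i. X n i \<omega>)
                 (null_resid (Y n) (X n) \<beta>0 \<omega>) (\<gamma>h n \<beta>0 \<omega>)) 1"
proof -
  define p q \<rho> where "p = Phi1_at v \<Delta>" and "q = Psi_at v \<Delta>" and "\<rho> = rho_at v \<Delta>"
  have comp: "compact B" using A2 by (simp add: assumption2_def)
  have p: "0 < p"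
    unfolding p_def \<Delta> using A2 \<beta>0 unfolding assumption2_def
    by (intro INF_pos_imp_pos[OF comp, of "\<lambda>b. Phi1_at v (\<beta> - b)"]) (auto simp: Phi1_at_def intro!: continuous_intros)
  have q: "0 < q"
    unfolding q_def \<Delta> using A2 \<beta>0 unfolding assumption2_def
    by (intro INF_pos_imp_pos[OF comp, of "\<lambda>b. Psi_at v (\<beta> - b)"]) (auto simp: Psi_at_def intro!: continuous_intros)
  have \<rho>: "\<bar>\<rho>\<bar> < 1" using r by (simp add: \<rho>_def)
  \<comment> \<open>The weights lie in the weight set for some \<open>n\<close>, so that set is
    nonempty.\<close>
  have abar0: "0 \<le> abar"
    using eventually_happens[OF weights] by (auto simp: weight_set_def)
  define G where "G n \<omega> = \<gamma>h n \<beta>0 \<omega> - gamma_at v \<Delta>" for n \<omega>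
  have G: "little_op M G" using A2 \<beta>0 unfolding assumption2_def G_def \<Delta> by auto
  define Qe where "Qe n \<omega> = Q_form (Z n) (null_resid (Y n) (X n) \<beta>0 \<omega>) (null_resid (Y n) (X n) \<beta>0 \<omega>)" for n \<omega>
  define Qx where "Qx n \<omega> = Q_form (Z n) (\<lambda>i. X n i \<omega>) (null_resid (Y n) (X n) \<beta>0 \<omega>)" for n \<omega>
  define W where "W n \<omega> = (Qe n \<omega> - \<Delta>\<^sup>2 * \<C> n, Qx n \<omega> - \<Delta> * \<C> n, Q_form (Z n) (\<lambda>i. X n i \<omega>) (\<lambda>i. X n i \<omega>) - \<C> n)" for n \<omega>
  have W: "big_Op M W" using bounded unfolding W_def Qe_def Qx_def Let_def .
  have norm_W: "\<bar>Qe n \<omega> - \<Delta>\<^sup>2 * \<C> n\<bar> \<le> norm (W n \<omega>)" "\<bar>Qx n \<omega> - \<Delta> * \<C> n\<bar> \<le> norm (W n \<omega>)" for n \<omega>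
  proof -
    have "\<bar>a\<bar> \<le> norm (a, b, c)" "\<bar>b\<bar> \<le> norm (a, b, c)" for a b c :: real
      using norm_fst_le[of a "(b, c)"] norm_snd_le[of "(b, c)" a] norm_fst_le[of b c] unfolding real_norm_def by linarith+
    then show "\<bar>Qe n \<omega> - \<Delta>\<^sup>2 * \<C> n\<bar> \<le> norm (W n \<omega>)" "\<bar>Qx n \<omega> - \<Delta> * \<C> n\<bar> \<le> norm (W n \<omega>)"
      unfolding W_def by blast+
  qed
  have reject: "\<exists>c0. eventually (\<lambda>g. \<forall>C qe qx a1 a2. c0 \<le> \<bar>C\<bar> \<and> \<bar>qe - \<Delta>\<^sup>2 * C\<bar> \<le> b \<and> \<bar>qx - \<Delta> * C\<bar> \<le> b \<and>
      qt * p / (C\<^sup>2 * (Delta_star v \<Delta>) ^ 4) \<le> a1 \<and> (a1, a2) \<in> weight_set abar \<longrightarrow>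
      lc_crit \<alpha> a1 a2 (snd (snd g)) \<le> stat_form a1 a2 qe qx (fst g) (fst (snd g)) (snd (snd g))) (nhds (p, q, \<rho>))"
    if b: "0 \<le> b" for b
  proof (cases "\<Delta> / sqrt q - \<rho> * \<Delta>\<^sup>2 / sqrt p = 0")
    case False
    from stat_form_ge_generic[OF \<alpha> abar p q \<rho> this b] show ?thesis
      by (elim ex_forward eventually_mono) blast
  next
    case True
    \<comment> \<open>A vanishing drift of the modified score means that \<Delta> equals
      \<open>Delta_star v \<Delta>\<close>, so the bound on the first weight is stated in terms of
      \<Delta> itself.\<close>
    then have eq: "sqrt p = \<rho> * \<Delta> * sqrt q"
      using \<Delta>0 p q by (simp add: field_simps power2_eq_square)
    then have \<rho>0: "\<rho> \<noteq> 0" using p by auto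
    have "Delta_star v \<Delta> = \<Delta>"
      unfolding Delta_star_def p_def[symmetric] q_def[symmetric] \<rho>_def[symmetric] eq using q \<rho>0 by simp
    with stat_form_ge_critical[OF \<alpha> abar0 abar p q \<rho> \<rho>0 \<Delta>0 b qt[folded \<rho>_def]] show ?thesis
      by (elim ex_forward eventually_mono) auto
  qed
  show ?thesis
  proof (rule conv_in_prob_indicator[OF prob _ W G])
    fix n
    have WM: "W n \<in> borel_measurable (M n)" and GM: "G n \<in> borel_measurable (M n)"
      using W G unfolding big_Op_def little_op_def by auto
    have f: "(fst :: real \<times> real \<times> real \<Rightarrow> real) \<in> borel_measurable borel"
      "(\<lambda>w :: real \<times> real \<times> real. fst (snd w)) \<in> borel_measurable borel"
      by (intro borel_measurable_continuous_onI continuous_intros)+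
    \<comment> \<open>Measurability of the quadratic forms is recovered from the bounded vector
      \<open>W\<close>, since \<open>big_Op\<close> includes it.\<close>
    have "Qe n = (\<lambda>\<omega>. fst (W n \<omega>) + \<Delta>\<^sup>2 * \<C> n)" "Qx n = (\<lambda>\<omega>. fst (snd (W n \<omega>)) + \<Delta> * \<C> n)"
      by (simp_all add: W_def fun_eq_iff)
    moreover have "(\<lambda>\<omega>. fst (W n \<omega>)) \<in> borel_measurable (M n)" "(\<lambda>\<omega>. fst (snd (W n \<omega>))) \<in> borel_measurable (M n)"
      using measurable_compose[OF WM f(1)] measurable_compose[OF WM f(2)] by simp_all
    ultimately have Q: "Qe n \<in> borel_measurable (M n)" "Qx n \<in> borel_measurable (M n)" by simp_all
    have "\<gamma>h n \<beta>0 = (\<lambda>\<omega>. G n \<omega> + gamma_at v \<Delta>)" by (simp add: G_def fun_eq_iff)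
    then have gM: "\<gamma>h n \<beta>0 \<in> borel_measurable (M n)" using GM by simp
    have gi: "(\<lambda>\<omega>. \<gamma>h n \<beta>0 \<omega> $ i) \<in> borel_measurable (M n)" for i
      by (rule measurable_compose[OF gM measurable_vec_nth_borel])
    have crit: "(\<lambda>\<omega>. lc_crit \<alpha> (a1n n) (a2n n) (\<gamma>h n \<beta>0 \<omega> $ 7)) \<in> borel_measurable (M n)"
      by (rule measurable_compose[OF gi lc_crit_measurable[OF \<alpha>]])
    show "(\<lambda>\<omega>. feasible_lc_test \<alpha> (a1n n) (a2n n) (Z n) (\<lambda>i. X n i \<omega>)
                 (null_resid (Y n) (X n) \<beta>0 \<omega>) (\<gamma>h n \<beta>0 \<omega>)) \<in> borel_measurable (M n)"
      unfolding feasible_lc_test_eq Qe_def[symmetric] Qx_def[symmetric]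
      by (intro measurable_stat_form_reject crit Q gi)
  next
    fix b :: real
    obtain c0 where c0: "eventually (\<lambda>g. \<forall>C qe qx a1 a2. c0 \<le> \<bar>C\<bar> \<and> \<bar>qe - \<Delta>\<^sup>2 * C\<bar> \<le> \<bar>b\<bar> \<and> \<bar>qx - \<Delta> * C\<bar> \<le> \<bar>b\<bar> \<and>
      qt * p / (C\<^sup>2 * (Delta_star v \<Delta>) ^ 4) \<le> a1 \<and> (a1, a2) \<in> weight_set abar \<longrightarrow>
      lc_crit \<alpha> a1 a2 (snd (snd g)) \<le> stat_form a1 a2 qe qx (fst g) (fst (snd g)) (snd (snd g))) (nhds (p, q, \<rho>))"
      using reject[of "\<bar>b\<bar>"] by auto
    have "((\<lambda>g. (g $ 1, g $ 4, g $ 7)) \<longlongrightarrow> (gamma_at v \<Delta> $ 1, gamma_at v \<Delta> $ 4, gamma_at v \<Delta> $ 7)) (nhds (gamma_at v \<Delta>))"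
      by (intro tendsto_intros filterlim_ident)
    then have "((\<lambda>g. (g $ 1, g $ 4, g $ 7)) \<longlongrightarrow> (p, q, \<rho>)) (nhds (gamma_at v \<Delta>))"
      by (simp add: gamma_at_nth p_def q_def \<rho>_def)
    from eventually_compose_filterlim[OF c0 this]
    obtain \<delta> where \<delta>: "0 < \<delta>" and rej: "\<And>g C qe qx a1 a2. dist g (gamma_at v \<Delta>) < \<delta> \<Longrightarrow> c0 \<le> \<bar>C\<bar> \<Longrightarrow>
       \<bar>qe - \<Delta>\<^sup>2 * C\<bar> \<le> \<bar>b\<bar> \<Longrightarrow> \<bar>qx - \<Delta> * C\<bar> \<le> \<bar>b\<bar> \<Longrightarrow>
       qt * p / (C\<^sup>2 * (Delta_star v \<Delta>) ^ 4) \<le> a1 \<Longrightarrow> (a1, a2) \<in> weight_set abar \<Longrightarrow>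
       lc_crit \<alpha> a1 a2 (g $ 7) \<le> stat_form a1 a2 qe qx (g $ 1) (g $ 4) (g $ 7)"
      unfolding eventually_nhds_metric by auto
    have "\<forall>\<^sub>F n in sequentially. c0 \<le> \<bar>\<C> n\<bar>" using diverge by (simp add: filterlim_at_top)
    \<comment> \<open>Half the radius turns the open ball into the closed bound on the norm.\<close>
    with weights have "\<forall>\<^sub>F n in sequentially. \<forall>\<omega>\<in>space (M n). norm (W n \<omega>) \<le> b \<and> norm (G n \<omega>) \<le> \<delta> / 2 \<longrightarrow>
        feasible_lc_test \<alpha> (a1n n) (a2n n) (Z n) (\<lambda>i. X n i \<omega>)
                 (null_resid (Y n) (X n) \<beta>0 \<omega>) (\<gamma>h n \<beta>0 \<omega>) = 1"
    proof eventually_elim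
      case (elim n)
      show ?case
      proof (intro ballI impI, elim conjE)
        fix \<omega> assume n: "norm (W n \<omega>) \<le> b" "norm (G n \<omega>) \<le> \<delta> / 2"
        have "dist (\<gamma>h n \<beta>0 \<omega>) (gamma_at v \<Delta>) < \<delta>" using n(2) \<delta> by (simp add: dist_norm G_def)
        moreover have "\<bar>Qe n \<omega> - \<Delta>\<^sup>2 * \<C> n\<bar> \<le> \<bar>b\<bar>" "\<bar>Qx n \<omega> - \<Delta> * \<C> n\<bar> \<le> \<bar>b\<bar>"
          using norm_W[of n \<omega>] n(1) by linarith+
        ultimately show "feasible_lc_test \<alpha> (a1n n) (a2n n) (Z n) (\<lambda>i. X n i \<omega>)
                 (null_resid (Y n) (X n) \<beta>0 \<omega>) (\<gamma>h n \<beta>0 \<omega>) = 1"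
          unfolding feasible_lc_test_eq Qe_def[symmetric] Qx_def[symmetric]
          using rej elim by (simp add: p_def)
      qed
    qed
    then show "\<exists>\<delta>>0. \<forall>\<^sub>F n in sequentially. \<forall>\<omega>\<in>space (M n). norm (W n \<omega>) \<le> b \<and> norm (G n \<omega>) \<le> \<delta> \<longrightarrow>
        feasible_lc_test \<alpha> (a1n n) (a2n n) (Z n) (\<lambda>i. X n i \<omega>)
                 (null_resid (Y n) (X n) \<beta>0 \<omega>) (\<gamma>h n \<beta>0 \<omega>) = 1"
      using \<delta> by (intro exI[of _ "\<delta> / 2"]) simp
  qed
qed

section \<open>The three regimes combined\<close>

theorem theorem2p1:
  fixes \<alpha> abar \<beta> \<beta>0 \<Delta> :: real
    and v :: avar
    and M :: "nat \<Rightarrow> 'w measure"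
    and K :: "nat \<Rightarrow> nat"
    and Z :: "nat \<Rightarrow> real Matrix.mat"
    and \<mu> :: "nat \<Rightarrow> nat \<Rightarrow> real"
    and Y X e V :: "nat \<Rightarrow> nat \<Rightarrow> 'w \<Rightarrow> real"
    and B :: "real set"
    and \<gamma>h :: "nat \<Rightarrow> real \<Rightarrow> 'w \<Rightarrow> real^7"
    and \<C> d a1n a2n :: "nat \<Rightarrow> real"
    and Ct qt :: real
  assumes "0 < \<alpha>" "\<alpha> < 1" "abar < 1" "\<Delta> = \<beta> - \<beta>0"
  shows
   "\<comment> \<open>(i) weak identification, fixed alternatives\<close>
    (Phi1_at v \<Delta> > 0 \<and> Psi_at v \<Delta> > 0 \<and> -1 < rho_at v \<Delta> \<and> rho_at v \<Delta> < 1 \<longrightarrow>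
      (\<forall>a1 a2 U \<nu>1 \<nu>2.
        (a1, a2) \<in> weight_set abar \<and> lc_eigen_decomp a1 a2 (rho_at v \<Delta>) U \<nu>1 \<nu>2 \<longrightarrow>
          admissible_within indep_normal_law
            {\<theta>. fst \<theta> \<noteq> 0 \<or> snd \<theta> \<noteq> 0}
            (squared_rotated_tests \<alpha> U) (lc_test \<alpha> a1 a2 (rho_at v \<Delta>)) \<and>
          admissible_within indep_normal_law
            {\<theta>. (fst \<theta> \<noteq> 0 \<or> snd \<theta> \<noteq> 0) \<and>
                (\<exists>D C. \<theta> = weak_mean (Phi1_at v \<Delta>) (Psi_at v \<Delta>) (rho_at v \<Delta>) D C)}
            (squared_rotated_tests \<alpha> U) (lc_test \<alpha> a1 a2 (rho_at v \<Delta>)) \<and>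
          (\<forall>\<phi>\<in>squared_rotated_tests \<alpha> U. \<exists>bbar>0. \<forall>b \<theta>1 \<theta>2.
             0 < b \<and> b < bbar \<and>
             ((vector [\<theta>1, \<theta>2] v* U) $ 1)\<^sup>2 = b * \<nu>1 \<and> ((vector [\<theta>1, \<theta>2] v* U) $ 2)\<^sup>2 = b * \<nu>2 \<longrightarrow>
             test_power indep_normal_law (\<theta>1, \<theta>2) \<phi>
               \<le> test_power indep_normal_law (\<theta>1, \<theta>2) (lc_test \<alpha> a1 a2 (rho_at v \<Delta>)))))
    \<and>
    \<comment> \<open>(ii) strong identification, local alternatives\<close>
    (Phi1 v > 0 \<and> Psi v > 0 \<and> -1 < rho v \<and> rho v < 1 \<longrightarrow>
      (\<forall>a1 a2 H1.
        (a1, a2) \<in> weight_set abar \<and>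
        H1 = {\<theta>. \<theta> \<noteq> 0 \<and> (\<exists>Dt C. \<theta> = Dt * C / sqrt (Psi v))} \<longrightarrow>
          (UMP_within (local_law (rho v)) H1
             {\<phi>. is_test \<phi> \<and> has_level (local_law (rho v)) {0} \<alpha> \<phi> \<and> sign_invariant \<phi>}
             (local_lc_test \<alpha> a1 a2 (rho v))
           \<longleftrightarrow> a1 = 0 \<and> a2 * rho v = 0) \<and>
          (a1 = 0 \<and> a2 * rho v = 0 \<longrightarrow>
           UMP_within (local_law (rho v)) H1
             {\<phi>. is_test \<phi> \<and> unbiased_test (local_law (rho v)) {0} H1 \<alpha> \<phi>}
             (local_lc_test \<alpha> a1 a2 (rho v)))))
    \<and>
    \<comment> \<open>(iii) strong identification, fixed alternatives\<close>
    (many_iv_model M K Z \<beta> \<mu> Y X e V \<and>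
     \<C> = (\<lambda>n. Q_form (Z n) (\<mu> n) (\<mu> n)) \<and>
     assumption2 M v \<beta> B \<gamma>h \<and> \<beta>0 \<in> B \<and> -1 < rho_at v \<Delta> \<and> rho_at v \<Delta> < 1 \<and>
     big_Op M (\<lambda>n \<omega>. let x = (\<lambda>i. X n i \<omega>); e0 = null_resid (Y n) (X n) \<beta>0 \<omega> in
       (Q_form (Z n) e0 e0 - \<Delta>\<^sup>2 * \<C> n, Q_form (Z n) x e0 - \<Delta> * \<C> n, Q_form (Z n) x x - \<C> n)) \<and>
     (\<forall>\<^sub>F n in sequentially. \<C> n = Ct / d n) \<and> d \<longlonglongrightarrow> 0 \<and>
     filterlim (\<lambda>n. \<bar>\<C> n\<bar>) at_top sequentially \<and> \<Delta> \<noteq> 0 \<and>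
     qt > lc_crit_max abar \<alpha> (rho_at v \<Delta>) \<and>
     (\<forall>\<^sub>F n in sequentially. 1 \<ge> a1n n \<and>
        a1n n \<ge> qt * Phi1_at v \<Delta> / ((\<C> n)\<^sup>2 * (Delta_star v \<Delta>)^4) \<and>
        (a1n n, a2n n) \<in> weight_set abar) \<longrightarrow>
      conv_in_prob M
        (\<lambda>n \<omega>. feasible_lc_test \<alpha> (a1n n) (a2n n) (Z n) (\<lambda>i. X n i \<omega>)
                 (null_resid (Y n) (X n) \<beta>0 \<omega>) (\<gamma>h n \<beta>0 \<omega>)) 1)"
proof (intro conjI impI allI, goal_cases)
  case (1 a1 a2 U \<nu>1 \<nu>2)
  \<comment> \<open>This claim does not mention the variances, so 1 serves as a positive value for
    both.\<close>
  then show ?case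
    by (intro weak_identification(1)[OF assms(1-3), where p=1 and q=1]) (blast | simp)+
next
  case (2 a1 a2 U \<nu>1 \<nu>2)
  then show ?case by (intro weak_identification(2)[OF assms(1-3)]) blast+
next
  case (3 a1 a2 U \<nu>1 \<nu>2)
  then show ?case
    by (intro weak_identification(3)[OF assms(1-3), where p=1 and q=1]) (blast | simp)+
next
  case (4 a1 a2 H1)
  then show ?case by (intro local_alternatives(1)[OF assms(1-3), where p="Psi v"]) blast+
next
  case (5 a1 a2 H1)
  then show ?case by (intro local_alternatives(2)[OF assms(1-3), where p="Psi v"]) blast+
next
  case 6
  then have "\<And>n. prob_space (M n)" by (simp add: many_iv_model_def)
  with 6 show ?case
    by (intro strong_identification_fixed_alternatives[OF assms(1-4), where B=B and \<C>=\<C> and qt=qt]) blast+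
qed

end
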